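(* Let $\mathcal{P}$ be a (finite) homogeneous simplicial $d$-complex with integer vertices in $\mathbb{R}^{d}$. Let $w$ be a non-negative integer and let $f\in C^{w+1}(\mathbb{R}^{d})$. Let $\{c_{j}\}_{0\leqslant j\leqslant w/2}$ be the solution of the Vandermonde system $$\sum_{0\le j\le \lfloor w/2\rfloor}(2^{-2k})^{j}c_j=\begin{cases}1 & k=0,\\ 0 & 1\le k\le\lfloor w/2\rfloor.\end{cases}$$ Then, for positive integers $N$, $$\int_{\mathcal{P}}f(x)\,dx=\sum_{0\leqslant j\leqslant w/2}c_{j}S_{2^{j}N}(f,\mathcal{P})+O(N^{-w-1}),$$ where the implied constant does not depend on $N$.
   Context: A homogeneous simplicial $d$-complex is a simplicial complex in which every simplex of dimension less than $d$ is a face of some simplex of dimension $d$; it has integer vertices if all its vertices lie in $\mathbb{Z}^d$. In integrals and in $\omega_{\mathcal P}$, $\mathcal P$ denotes the union of its simplices. The normalized solid angle is $\omega_{\mathcal{P}}(x)=\lim_{\varepsilon\to0+}\frac{1}{|\{|y|\le1\}|}\int_{|y|\le1}\chi_{\mathcal{P}}(x-\varepsilon y)\,dy$, and for a continuous function $f$ and a positive integer $N$, $S_{N}(f,\mathcal{P})=N^{-d}\sum_{n\in\mathbb{Z}^{d}}\omega_{\mathcal{P}}(N^{-1}n)f(N^{-1}n)$. *)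

theory Defs
  imports "HOL-Analysis.Analysis"
begin

(* simplicial_complex already includes finiteness.  It also counts the empty set as a
   simplex, of dimension -1; this has no effect on the union of the simplices. *)
definition homogeneous_simplicial_complex :: "int \<Rightarrow> 'a::euclidean_space set set \<Rightarrow> bool" where
  "homogeneous_simplicial_complex d K \<longleftrightarrow>
     simplicial_complex K \<and>
     (\<forall>S\<in>K. \<forall>k. k simplex S \<and> k < d \<longrightarrow> (\<exists>T\<in>K. d simplex T \<and> S face_of T))"

definition int_lattice :: "(real ^ 'n) set" where
  "int_lattice = {x. \<forall>i. x $ i \<in> \<int>}"

definition integer_vertices :: "(real ^ 'n) set set \<Rightarrow> bool" where
  "integer_vertices K \<longleftrightarrow> (\<forall>v. {v} \<in> K \<longrightarrow> v \<in> int_lattice)"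

(* The class C^k on the whole space.  Every directional derivative of a C^(k+1) function is
   required to be C^k; by linearity of the derivative this amounts to the partial derivatives. *)
primrec Ck :: "nat \<Rightarrow> ('a::euclidean_space \<Rightarrow> 'b::real_normed_vector) \<Rightarrow> bool" where
  "Ck 0 f \<longleftrightarrow> continuous_on UNIV f"
| "Ck (Suc k) f \<longleftrightarrow>
     (\<forall>x. f differentiable (at x)) \<and> (\<forall>v. Ck k (\<lambda>x. frechet_derivative f (at x) v))"

definition solid_angle :: "'a::euclidean_space set \<Rightarrow> 'a \<Rightarrow> real" where
  "solid_angle P x =
     Lim (at_right 0) (\<lambda>\<epsilon>. 1 / measure lborel (cball (0::'a) 1) *
       (LINT y:cball 0 1|lborel. indicat_real P (x - \<epsilon> *\<^sub>R y)))"

definition solid_angle_sum :: "nat \<Rightarrow> (real ^ 'n \<Rightarrow> complex) \<Rightarrow> (real ^ 'n) set \<Rightarrow> complex" where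
  "solid_angle_sum N f P =
     (1 / real N ^ CARD('n)) *\<^sub>R
       (\<Sum>\<^sub>\<infinity>n\<in>int_lattice. solid_angle P ((1 / real N) *\<^sub>R n) *\<^sub>R f ((1 / real N) *\<^sub>R n))"

end

theory Submission
  imports Defs
begin

text \<open>
  Why the theorem holds. Replace the lattice \<open>\<int>\<^sup>d\<close> by a shifted copy \<open>\<int>\<^sup>d - y\<close> and let the mesh
  \<open>h = \<plusminus>1/N\<close> have either sign: put
  \<open>S y h = \<bar>h\<bar>\<^sup>d \<Sum> f (h (m - y))\<close>, the sum being over the \<open>m \<in> \<int>\<^sup>d\<close> with \<open>h (m - y) \<in> P\<close>.
  Averaging \<open>S (\<epsilon> y) (1/N)\<close> over the unit ball of all \<open>y\<close> and letting \<open>\<epsilon>\<close> tend to \<open>0\<close> gives the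
  solid angle sum, because each lattice point then counts with the proportion of directions that
  lead from it into \<open>P\<close> (\<open>shifted_lattice_sum_average_tendsto\<close>). It therefore suffices to
  understand \<open>S y\<close> for almost every \<open>y\<close>, namely those for which the shifted lattice avoids suitable hyperplanes
  (in particular all facets of the scaled complexes), as long as the error bounds do not depend on \<open>y\<close>.

  The key point is that for such \<open>y\<close> there is an expansion
  \<open>S y h = a\<^sub>0 + a\<^sub>1 h + \<dots> + a\<^sub>w h\<^sup>w + O(\<bar>h\<bar>\<^sup>w\<^sup>+\<^sup>1)\<close> whose coefficients are the same for both signs of
  \<open>h\<close> and whose error constant does not depend on \<open>y\<close> (\<open>complex_sum_has_expansion\<close>). Since
  \<open>S y (- h) = S (- y) h\<close> and the ball is symmetric, the average over \<open>y\<close> only sees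
  \<open>(S y h + S y (- h)) / 2\<close>, in which all odd powers of \<open>h\<close> cancel. The coefficients \<open>c j\<close> of the Vandermonde system remove the even
  powers \<open>h\<^sup>2, h\<^sup>4, \<dots>\<close> (\<open>has_expansion_extrapolate\<close>), and \<open>a\<^sub>0\<close> is the integral since \<open>S y (1/N)\<close> is
  a Riemann sum (\<open>shifted_lattice_sum_tendsto_integral\<close>).

  For the expansion, the complex is cut into its \<open>d\<close>-simplices. A simplex with vertices
  \<open>v\<^sub>0, \<dots>, v\<^sub>d\<close> consists of the points \<open>v\<^sub>0 + \<Sum> t\<^sub>i (v\<^sub>i - v\<^sub>i\<^sub>-\<^sub>1)\<close> with
  \<open>1 \<ge> t\<^sub>1 \<ge> \<dots> \<ge> t\<^sub>d \<ge> 0\<close>. The edge vectors \<open>v\<^sub>i - v\<^sub>i\<^sub>-\<^sub>1\<close> generate a sublattice of finite index in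
  \<open>\<int>\<^sup>d\<close>, and on each coset the sum is a \<open>d\<close>-fold nested sum over \<open>t\<^sub>i = h (m\<^sub>i + \<theta>\<^sub>i)\<close> with integers
  \<open>m\<^sub>i\<close>, the variable \<open>t\<^sub>i\<^sub>+\<^sub>1\<close> running from \<open>0\<close> to \<open>t\<^sub>i\<close>. Each of the \<open>d\<close> summations is treated by
  the Euler-Maclaurin formula (\<open>euler_maclaurin\<close>). The upper end point \<open>t\<^sub>i\<close> is itself a point of a
  shifted lattice, so the periodic Bernoulli functions in the boundary terms are evaluated at
  \<open>\<theta>\<^sub>i - \<theta>\<^sub>i\<^sub>+\<^sub>1\<close> and \<open>- \<theta>\<^sub>i\<^sub>+\<^sub>1\<close>, which do not depend on \<open>h\<close>. A boundary term with the factor \<open>h\<^sup>l\<close>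
  contains \<open>l - 1\<close> derivatives of the summand, and it only has to be expanded to order
  \<open>w + 1 - l\<close> afterwards; so the \<open>w + 1\<close> derivatives of \<open>f\<close> suffice for an induction on the number of
  summations (\<open>nested_sum_has_expansion\<close>).
\<close>

section \<open>Functions of class \<open>C\<^sup>k\<close>\<close>

lemma Ck_imp_continuous_on: "Ck k f \<Longrightarrow> continuous_on S f"
proof (cases k)
  case 0
  then show "Ck k f \<Longrightarrow> continuous_on S f" by (auto intro: continuous_on_subset)
next
  case (Suc j)
  then show "Ck k f \<Longrightarrow> continuous_on S f"
    by (auto intro!: continuous_at_imp_continuous_on differentiable_imp_continuous_within)
qed

lemma Ck_SucD: "Ck (Suc k) f \<Longrightarrow> Ck k f"
proof (induction k arbitrary: f)
  case 0
  then show ?case using Ck_imp_continuous_on[OF 0] by simp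
next
  case (Suc k)
  then show ?case by (metis Ck.simps(2))
qed

lemma Ck_mono: "Ck k f \<Longrightarrow> j \<le> k \<Longrightarrow> Ck j f"
  by (induction k) (auto dest: Ck_SucD simp: le_Suc_eq simp del: Ck.simps)

lemma Ck_SucI:
  assumes "\<And>x. (f has_derivative f' x) (at x)" "\<And>v. Ck k (\<lambda>x. f' x v)"
  shows "Ck (Suc k) f"
proof -
  have "frechet_derivative f (at x) = f' x" for x
    using frechet_derivative_at[OF assms(1)] by simp
  then show ?thesis using assms by (auto simp: differentiable_def)
qed

lemma Ck_has_derivative:
  "Ck (Suc k) f \<Longrightarrow> (f has_derivative frechet_derivative f (at x)) (at x)"
  using frechet_derivative_works by auto

lemma Ck_frechet_derivative: "Ck (Suc k) f \<Longrightarrow> Ck k (\<lambda>x. frechet_derivative f (at x) v)"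
  by simp

lemma Ck_add: "Ck k f \<Longrightarrow> Ck k g \<Longrightarrow> Ck k (\<lambda>x. f x + g x)"
proof (induction k arbitrary: f g)
  case 0
  then show ?case by (auto intro: continuous_intros)
next
  case (Suc k)
  show ?case
    by (rule Ck_SucI[where f'="\<lambda>x v. frechet_derivative f (at x) v + frechet_derivative g (at x) v"])
      (use Suc in \<open>auto intro!: derivative_intros Ck_has_derivative[of k] simp del: Ck.simps
        intro: Ck_frechet_derivative\<close>)
qed

lemma Ck_scaleR: "Ck k f \<Longrightarrow> Ck k (\<lambda>x. c *\<^sub>R f x)"
proof (induction k arbitrary: f)
  case 0
  then show ?case by (auto intro: continuous_intros)
next
  case (Suc k)
  show ?case
    by (rule Ck_SucI[where f'="\<lambda>x v. c *\<^sub>R frechet_derivative f (at x) v"])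
      (use Suc in \<open>auto intro!: derivative_intros Ck_has_derivative[of k] simp del: Ck.simps
        intro: Ck_frechet_derivative\<close>)
qed

lemma Ck_linear_scaleR:
  assumes l: "bounded_linear l"
  shows "Ck k f \<Longrightarrow> Ck k (\<lambda>x. l x *\<^sub>R f x)"
proof (induction k arbitrary: f)
  case 0
  then show ?case
    by (simp add: continuous_on_scaleR linear_continuous_on[OF l])
next
  case (Suc k)
  have "Ck k (\<lambda>x. l x *\<^sub>R frechet_derivative f (at x) v + l v *\<^sub>R f x)" for v
    by (intro Ck_add Suc.IH Ck_scaleR Ck_frechet_derivative Suc.prems Ck_SucD)
  moreover have "((\<lambda>x. l x *\<^sub>R f x) has_derivative
      (\<lambda>v. l x *\<^sub>R frechet_derivative f (at x) v + l v *\<^sub>R f x)) (at x)" for x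
    by (intro has_derivative_scaleR bounded_linear_imp_has_derivative l
        Ck_has_derivative[OF Suc.prems])
  ultimately show ?case by (intro Ck_SucI)
qed

lemma Ck_compose_linear:
  assumes L: "bounded_linear L"
  shows "Ck k f \<Longrightarrow> Ck k (\<lambda>x. f (L x))"
proof (induction k arbitrary: f)
  case 0
  then show ?case
    by (auto intro: continuous_on_compose2[of UNIV f] linear_continuous_on L)
next
  case (Suc k)
  show ?case
  proof (rule Ck_SucI)
    show "((\<lambda>x. f (L x)) has_derivative (\<lambda>v. frechet_derivative f (at (L x)) (L v))) (at x)" for x
      by (rule has_derivative_compose[OF bounded_linear_imp_has_derivative[OF L]
            Ck_has_derivative[OF Suc.prems]])
    show "Ck k (\<lambda>x. frechet_derivative f (at (L x)) (L v))" for v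
      by (rule Suc.IH[OF Ck_frechet_derivative[OF Suc.prems]])
  qed
qed

text \<open>Integrals of a \<open>C\<^sup>k\<close> function along segments depend on the segment in a \<open>C\<^sup>k\<close> way. The weight \<open>\<rho>\<close>
  makes the induction work: differentiating \<open>g (A z + r B z)\<close> in \<open>z\<close> produces a further factor \<open>r\<close>.\<close>

lemma Ck_segment_average:
  fixes g :: "'a::euclidean_space \<Rightarrow> 'b::{real_normed_vector,banach}"
    and A B :: "'c::euclidean_space \<Rightarrow> 'a"
  assumes A: "bounded_linear A" and B: "bounded_linear B"
  shows "continuous_on {0..1::real} \<rho> \<Longrightarrow> Ck k g \<Longrightarrow>
    Ck k (\<lambda>z. integral {0..1} (\<lambda>r. \<rho> r *\<^sub>R g (A z + r *\<^sub>R B z)))"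
proof (induction k arbitrary: g \<rho>)
  case 0
  have c: "continuous_on (UNIV \<times> cbox 0 1) (\<lambda>(z, r). \<rho> r *\<^sub>R g (A z + r *\<^sub>R B z))"
    unfolding case_prod_beta using 0
    by (auto intro!: continuous_intros continuous_on_compose2[of UNIV g]
        continuous_on_compose2[of "{0..1}" \<rho>] bounded_linear.continuous_on[OF A]
        bounded_linear.continuous_on[OF B])
  show ?case
    using integral_continuous_on_param[OF c] by simp
next
  case (Suc k)
  interpret A: bounded_linear A by fact
  interpret B: bounded_linear B by fact
  define dg where "dg = (\<lambda>x. frechet_derivative g (at x))"
  have dg: "(g has_derivative dg x) (at x)" for x
    unfolding dg_def by (rule Ck_has_derivative[OF Suc.prems(2)])
  have dglin: "linear (dg x)" for x using dg has_derivative_linear by blast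
  have Ckdg: "Ck k (\<lambda>x. dg x v)" for v
    unfolding dg_def by (rule Ck_frechet_derivative[OF Suc.prems(2)])
  have cdg: "continuous_on S (\<lambda>x. dg x v)" for v S
    by (rule Ck_imp_continuous_on[OF Ckdg])
  have cg: "continuous_on S g" for S
    by (rule Ck_imp_continuous_on[OF Suc.prems(2)])
  define D where "D = (\<lambda>z r v. \<rho> r *\<^sub>R dg (A z + r *\<^sub>R B z) (A v + r *\<^sub>R B v))"
  have Dlin: "bounded_linear (D z r)" for z r
    unfolding D_def
    by (intro linear_conv_bounded_linear[THEN iffD1] linearI)
      (simp_all add: A.add B.add A.scaleR B.scaleR linear_add[OF dglin] linear_scale[OF dglin] algebra_simps)
  define F where "F = (\<lambda>z r. Blinfun (D z r))"
  have FD: "blinfun_apply (F z r) = D z r" for z r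
    unfolding F_def by (rule bounded_linear_Blinfun_apply[OF Dlin])
  have Deq: "D z r v = \<rho> r *\<^sub>R dg (A z + r *\<^sub>R B z) (A v) + (\<rho> r * r) *\<^sub>R dg (A z + r *\<^sub>R B z) (B v)" for z r v
    unfolding D_def by (simp add: linear_add[OF dglin] linear_scale[OF dglin] algebra_simps)
  have cF: "continuous_on (UNIV \<times> cbox 0 1) (\<lambda>(z, r). F z r)"
    unfolding case_prod_beta
  proof (rule continuous_on_blinfun_componentwise)
    fix i :: 'c assume "i \<in> Basis"
    show "continuous_on (UNIV \<times> cbox 0 1) (\<lambda>x. blinfun_apply (F (fst x) (snd x)) i)"
      unfolding FD Deq using Suc.prems(1)
      by (auto intro!: continuous_intros continuous_on_compose2[OF cdg[of UNIV]]
          continuous_on_compose2[of "{0..1}" \<rho>] A.continuous_on B.continuous_on)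
  qed
  have int: "(\<lambda>r. \<rho> r *\<^sub>R h (A z + r *\<^sub>R B z)) integrable_on cbox 0 1"
    if "continuous_on {0..1} \<rho>" "continuous_on UNIV h" for z and h :: "'a \<Rightarrow> 'b" and \<rho>
    using that by (intro integrable_continuous)
      (auto intro!: continuous_intros continuous_on_compose2[of UNIV h])
  have fx: "((\<lambda>z. \<rho> r *\<^sub>R g (A z + r *\<^sub>R B z)) has_derivative blinfun_apply (F z r)) (at z within UNIV)" for z r
    unfolding FD D_def
    by (auto intro!: derivative_eq_intros has_derivative_compose[OF _ dg] A.has_derivative B.has_derivative)
  have L: "((\<lambda>z. integral (cbox 0 1) (\<lambda>r. \<rho> r *\<^sub>R g (A z + r *\<^sub>R B z))) has_derivative
      integral (cbox 0 1) (F z)) (at z within UNIV)" for z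
    by (rule leibniz_rule[OF fx int cF]) (use Suc.prems cg in auto)
  have cF1: "continuous_on (cbox 0 1) (F z)" for z
    using continuous_on_compose2[OF cF, of "cbox 0 1" "\<lambda>r. (z, r)"]
    by (simp add: continuous_on_Pair image_subset_iff)
  have ap: "blinfun_apply (integral (cbox 0 1) (F z)) v
      = integral {0..1} (\<lambda>r. \<rho> r *\<^sub>R dg (A z + r *\<^sub>R B z) (A v))
       + integral {0..1} (\<lambda>r. (\<rho> r * r) *\<^sub>R dg (A z + r *\<^sub>R B z) (B v))" for z v
  proof -
    have "blinfun_apply (integral (cbox 0 1) (F z)) v = integral (cbox 0 1) (\<lambda>r. D z r v)"
      by (subst blinfun_apply_integral) (simp_all add: FD integrable_continuous[OF cF1] del: box_real)
    also have "\<dots> = integral (cbox 0 1) (\<lambda>r. \<rho> r *\<^sub>R dg (A z + r *\<^sub>R B z) (A v))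
       + integral (cbox 0 1) (\<lambda>r. (\<rho> r * r) *\<^sub>R dg (A z + r *\<^sub>R B z) (B v))"
      unfolding Deq
      by (intro integral_add int) (auto intro!: cdg continuous_intros Suc.prems)
    finally show ?thesis by simp
  qed
  show ?case
  proof (rule Ck_SucI)
    show "((\<lambda>z. integral {0..1} (\<lambda>r. \<rho> r *\<^sub>R g (A z + r *\<^sub>R B z))) has_derivative
        blinfun_apply (integral (cbox 0 1) (F z))) (at z)" for z
      using L[of z] by simp
    show "Ck k (\<lambda>z. blinfun_apply (integral (cbox 0 1) (F z)) v)" for v
      unfolding ap
      by (intro Ck_add Suc.IH Ckdg Suc.prems continuous_intros)
  qed
qed

section \<open>Periodic Bernoulli functions\<close>

lemma exists_mean_zero_antiderivative:
  fixes q :: "real \<Rightarrow> real"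
  assumes "continuous_on UNIV q"
  shows "\<exists>p. (\<forall>x. (p has_real_derivative q x) (at x)) \<and> integral {0..1} p = 0"
proof -
  obtain P where P: "\<And>x. (P has_real_derivative q x) (at x)"
    using einterval_antiderivative[of "-\<infinity>" "\<infinity>" q] assms
    by (auto simp: continuous_on_eq_continuous_at has_real_derivative_iff_has_vector_derivative)
  define c where "c = integral {0..1} P"
  have "P integrable_on {0..1}"
    by (intro integrable_continuous_real continuous_at_imp_continuous_on ballI DERIV_isCont[OF P])
  then have "integral {0..1} (\<lambda>x. P x - c) = 0"
    using integral_diff[of P "{0..1}" "\<lambda>_. c"] integrable_const_ivl[of c 0 1] by (simp add: c_def)
  moreover have "((\<lambda>x. P x - c) has_real_derivative q x) (at x)" for x
    using P by (auto intro!: derivative_eq_intros)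
  ultimately show ?thesis by blast
qed

text \<open>On \<open>[0, 1]\<close> these are \<open>B\<^sub>l\<^sub>+\<^sub>1(x) / (l + 1)!\<close> with the Bernoulli polynomials \<open>B\<^sub>l\<close>. Choosing antiderivatives of mean
  zero is all that the Euler-Maclaurin formula needs; explicit coefficients never occur.\<close>

primrec bernoulli_fun :: "nat \<Rightarrow> real \<Rightarrow> real" where
  "bernoulli_fun 0 = (\<lambda>x. x - 1/2)"
| "bernoulli_fun (Suc l) = (SOME p. (\<forall>x. (p has_real_derivative bernoulli_fun l x) (at x)) \<and> integral {0..1} p = 0)"

lemma bernoulli_fun_continuous_mean_zero:
  "continuous_on UNIV (bernoulli_fun l)" (is ?c)
  "integral {0..1} (bernoulli_fun l) = 0" (is ?i)
proof -
  have "?c \<and> ?i"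
  proof (induction l)
    case 0
    have "((\<lambda>x::real. x - 1/2) has_integral (1^2/2 - 1/2*1) - (0^2/2 - 1/2*0)) {0..1}"
      by (rule fundamental_theorem_of_calculus)
        (auto intro!: derivative_eq_intros simp flip: has_real_derivative_iff_has_vector_derivative)
    then have "integral {0..1} (\<lambda>x::real. x - 1/2) = 0"
      by (simp add: integral_unique)
    then show ?case by (auto intro!: continuous_intros)
  next
    case (Suc l)
    then show ?case
      using someI_ex[OF exists_mean_zero_antiderivative[of "bernoulli_fun l"]]
      by (auto intro!: continuous_at_imp_continuous_on DERIV_isCont)
  qed
  then show ?c ?i by auto
qed

lemma bernoulli_fun_deriv: "(bernoulli_fun (Suc l) has_real_derivative bernoulli_fun l x) (at x)"
  using someI_ex[OF exists_mean_zero_antiderivative[OF bernoulli_fun_continuous_mean_zero(1)[of l]]] by simp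

text \<open>The mean of \<open>bernoulli_fun l\<close> vanishes, so its antiderivative returns to the same value. This is what
  makes all periodic Bernoulli functions but the first one continuous.\<close>

lemma bernoulli_fun_endpoints: "bernoulli_fun (Suc l) 1 = bernoulli_fun (Suc l) 0"
proof -
  have "(bernoulli_fun l has_integral (bernoulli_fun (Suc l) 1 - bernoulli_fun (Suc l) 0)) {0..1}"
    by (rule fundamental_theorem_of_calculus)
      (auto intro!: has_vector_derivative_at_within
          bernoulli_fun_deriv[unfolded has_real_derivative_iff_has_vector_derivative] simp del: bernoulli_fun.simps)
  then show ?thesis using bernoulli_fun_continuous_mean_zero(2)[of l] by (simp add: integral_unique del: bernoulli_fun.simps)
qed

definition periodic_bernoulli :: "nat \<Rightarrow> real \<Rightarrow> real" where
  "periodic_bernoulli l x = bernoulli_fun l (frac x)"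

lemma periodic_bernoulli_0: "periodic_bernoulli 0 x = x - of_int \<lfloor>x\<rfloor> - 1/2"
  by (simp add: periodic_bernoulli_def frac_def)

lemma periodic_bernoulli_add_int: "periodic_bernoulli l (x + of_int k) = periodic_bernoulli l x"
  by (simp add: periodic_bernoulli_def)

lemma periodic_bernoulli_bounded: "\<exists>M\<ge>0. \<forall>x. \<bar>periodic_bernoulli l x\<bar> \<le> M"
proof -
  have "bounded (bernoulli_fun l ` {0..1})"
    by (intro compact_imp_bounded compact_continuous_image continuous_on_subset[OF bernoulli_fun_continuous_mean_zero(1)]) auto
  then obtain M where "\<And>x. x \<in> {0..1} \<Longrightarrow> \<bar>bernoulli_fun l x\<bar> \<le> M" unfolding bounded_iff by fastforce
  then have "\<forall>x. \<bar>periodic_bernoulli l x\<bar> \<le> M"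
    by (simp add: periodic_bernoulli_def less_imp_le[OF frac_lt_1])
  then show ?thesis by (intro exI[of _ "max M 0"]) (auto intro: order_trans)
qed

lemma periodic_bernoulli_on_cell:
  assumes "of_int k \<le> x" "x \<le> of_int k + 1"
  shows "periodic_bernoulli (Suc l) x = bernoulli_fun (Suc l) (x - of_int k)"
proof (cases "x = of_int k + 1")
  case True
  then show ?thesis by (simp add: periodic_bernoulli_def frac_1_eq bernoulli_fun_endpoints del: bernoulli_fun.simps)
next
  case False
  then have "\<lfloor>x\<rfloor> = k" using assms by linarith
  then show ?thesis by (simp add: periodic_bernoulli_def frac_def)
qed

text \<open>On every closed cell \<open>[j, j + 1]\<close> the function is a translate of a continuous one, the two
  descriptions agreeing at the integers; the point \<open>x\<close> is interior to the union of two adjacent cells.\<close>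

lemma isCont_periodic_bernoulli: "isCont (periodic_bernoulli (Suc l)) x"
proof -
  define k where "k = \<lceil>x\<rceil>"
  have cell: "continuous_on {of_int j..of_int j + 1} (periodic_bernoulli (Suc l))" for j
  proof -
    have "continuous_on {of_int j..of_int j + 1} (\<lambda>x. bernoulli_fun (Suc l) (x - of_int j))"
      by (intro continuous_on_compose2[OF bernoulli_fun_continuous_mean_zero(1)] continuous_intros) auto
    then show ?thesis by (rule continuous_on_eq) (metis atLeastAtMost_iff periodic_bernoulli_on_cell)
  qed
  have "{of_int (k-1)..of_int (k-1) + 1} \<union> {of_int k..of_int k + 1} = {of_int k - 1..of_int k + (1::real)}"
    by auto
  then have "continuous_on {of_int k - 1..of_int k + 1} (periodic_bernoulli (Suc l))"
    using continuous_on_closed_Un[OF closed_atLeastAtMost closed_atLeastAtMost cell cell, of "k-1" k] by simp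
  moreover have "x \<in> interior {of_int k - 1..of_int k + 1}"
    unfolding k_def interior_atLeastAtMost_real greaterThanLessThan_iff by linarith
  ultimately show ?thesis by (rule continuous_on_interior)
qed

lemma periodic_bernoulli_deriv:
  assumes "x \<notin> \<int>"
  shows "(periodic_bernoulli (Suc l) has_real_derivative periodic_bernoulli l x) (at x)"
proof (rule has_field_derivative_transform_within_open)
  let ?k = "\<lfloor>x\<rfloor>"
  have "((\<lambda>y. bernoulli_fun (Suc l) (y - of_int ?k)) has_real_derivative bernoulli_fun l (x - of_int ?k) * 1) (at x)"
    by (rule DERIV_chain2[OF bernoulli_fun_deriv]) (auto intro!: derivative_eq_intros)
  then show "((\<lambda>y. bernoulli_fun (Suc l) (y - of_int ?k)) has_real_derivative periodic_bernoulli l x) (at x)"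
    by (simp add: periodic_bernoulli_def frac_def)
  show "x \<in> {of_int ?k<..<of_int ?k + 1}"
  proof -
    have "x \<noteq> of_int ?k" using assms Ints_of_int by metis
    moreover have "of_int ?k \<le> x" "x < of_int ?k + 1" by linarith+
    ultimately show ?thesis unfolding greaterThanLessThan_iff less_le by argo
  qed
  show "bernoulli_fun (Suc l) (y - of_int ?k) = periodic_bernoulli (Suc l) y" if "y \<in> {of_int ?k<..<of_int ?k + 1}" for y
    using that by (subst periodic_bernoulli_on_cell[of ?k]) auto
qed auto

section \<open>The Euler-Maclaurin formula for shifted lattices\<close>

text \<open>The indices of the points of \<open>h (\<int> + \<theta>)\<close> in the open interval from \<open>0\<close> to \<open>s\<close>; the mesh \<open>h\<close> may be
  negative.\<close>

definition lattice_pts :: "real \<Rightarrow> real \<Rightarrow> real \<Rightarrow> int set" where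
  "lattice_pts h \<theta> s = {m. 0 < h * (of_int m + \<theta>) \<and> h * (of_int m + \<theta>) < s}"

lemma lattice_pts_pos:
  assumes "h > 0" "s / h - \<theta> \<notin> \<int>"
  shows "lattice_pts h \<theta> s = {\<lfloor>-\<theta>\<rfloor><..\<lfloor>s/h - \<theta>\<rfloor>}"
proof -
  have "0 < h * (of_int m + \<theta>) \<longleftrightarrow> \<lfloor>-\<theta>\<rfloor> < m" for m
  proof -
    have "0 < h * (of_int m + \<theta>) \<longleftrightarrow> -\<theta> < of_int m" using assms by (auto simp: zero_less_mult_iff)
    then show ?thesis by (simp add: floor_less_iff)
  qed
  moreover have "h * (of_int m + \<theta>) < s \<longleftrightarrow> m \<le> \<lfloor>s/h - \<theta>\<rfloor>" for m
  proof -
    have "h * (of_int m + \<theta>) < s \<longleftrightarrow> of_int m < s/h - \<theta>" using assms by (auto simp: field_simps)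
    also have "\<dots> \<longleftrightarrow> of_int m \<le> s/h - \<theta>" using assms(2) by (metis Ints_of_int less_le)
    finally show ?thesis by (simp add: le_floor_iff)
  qed
  ultimately show ?thesis by (auto simp: lattice_pts_def)
qed

lemma lattice_pts_neg:
  assumes "h < 0" "\<theta> \<notin> \<int>"
  shows "lattice_pts h \<theta> s = {\<lfloor>s/h - \<theta>\<rfloor><..\<lfloor>-\<theta>\<rfloor>}"
proof -
  have "0 < h * (of_int m + \<theta>) \<longleftrightarrow> m \<le> \<lfloor>-\<theta>\<rfloor>" for m
  proof -
    have "0 < h * (of_int m + \<theta>) \<longleftrightarrow> of_int m < -\<theta>" using assms by (auto simp: zero_less_mult_iff)
    also have "\<dots> \<longleftrightarrow> of_int m \<le> -\<theta>" using assms(2) by (metis Ints_of_int less_le minus_in_Ints_iff)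
    finally show ?thesis by (simp add: le_floor_iff)
  qed
  moreover have "h * (of_int m + \<theta>) < s \<longleftrightarrow> \<lfloor>s/h - \<theta>\<rfloor> < m" for m
  proof -
    have "h * (of_int m + \<theta>) < s \<longleftrightarrow> of_int m > s/h - \<theta>" using assms by (auto simp: field_simps)
    then show ?thesis by (simp add: floor_less_iff)
  qed
  ultimately show ?thesis by (auto simp: lattice_pts_def)
qed

text \<open>Both signs of \<open>h\<close> lead to \<open>\<bar>h\<bar> card (lattice_pts h \<theta> s) = h (\<lfloor>s/h - \<theta>\<rfloor> - \<lfloor>- \<theta>\<rfloor>)\<close>. This common formula is
  the reason why the expansions below have the same coefficients for \<open>h\<close> and \<open>- h\<close>. It can fail when
  a lattice point is an end point of the interval, since a reflection exchanges floor and ceiling there.\<close>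

lemma lattice_pts_count:
  assumes "h \<noteq> 0" "\<theta> \<notin> \<int>" "s/h - \<theta> \<notin> \<int>" "0 \<le> s"
  shows "finite (lattice_pts h \<theta> s)"
    and "\<bar>h\<bar> * card (lattice_pts h \<theta> s) = s - h * periodic_bernoulli 0 (s/h - \<theta>) + h * periodic_bernoulli 0 (-\<theta>)"
proof -
  have "finite (lattice_pts h \<theta> s) \<and>
    \<bar>h\<bar> * card (lattice_pts h \<theta> s) = h * (of_int \<lfloor>s/h - \<theta>\<rfloor> - of_int \<lfloor>-\<theta>\<rfloor>)"
  proof (cases "h > 0")
    case True
    then have "\<lfloor>-\<theta>\<rfloor> \<le> \<lfloor>s/h - \<theta>\<rfloor>" using assms by (intro floor_mono) auto
    then show ?thesis using True assms by (simp add: lattice_pts_pos)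
  next
    case False
    then have h: "h < 0" using assms by auto
    then have "\<lfloor>s/h - \<theta>\<rfloor> \<le> \<lfloor>-\<theta>\<rfloor>" using assms by (intro floor_mono) (auto simp: divide_nonneg_neg)
    then show ?thesis using h assms by (simp add: lattice_pts_neg algebra_simps)
  qed
  then show "finite (lattice_pts h \<theta> s)"
    "\<bar>h\<bar> * card (lattice_pts h \<theta> s) = s - h * periodic_bernoulli 0 (s/h - \<theta>) + h * periodic_bernoulli 0 (-\<theta>)"
    using assms(1) by (simp_all add: periodic_bernoulli_0 algebra_simps)
qed

text \<open>The first periodic Bernoulli function jumps at integers, so integrands containing it are
  controlled only away from these points.\<close>

lemma finite_exceptional_points:
  fixes h :: real
  assumes "h \<noteq> 0"
  shows "finite {t \<in> {0..s}. t/h - \<theta> \<in> \<int>}"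
proof -
  define B where "B = \<lceil>\<bar>s\<bar>/\<bar>h\<bar> + \<bar>\<theta>\<bar>\<rceil>"
  have "{t \<in> {0..s}. t/h - \<theta> \<in> \<int>} \<subseteq> (\<lambda>m. h * (of_int m + \<theta>)) ` {-B..B}"
  proof clarify
    fix t assume t: "t \<in> {0..s}" "t/h - \<theta> \<in> \<int>"
    then obtain m where m: "t/h - \<theta> = of_int m" by (auto elim: Ints_cases)
    have "\<bar>of_int m\<bar> \<le> \<bar>t/h\<bar> + \<bar>\<theta>\<bar>" unfolding m[symmetric] by linarith
    also have "\<bar>t/h\<bar> \<le> \<bar>s\<bar>/\<bar>h\<bar>" using t by (auto intro!: divide_right_mono)
    finally have "\<bar>of_int m\<bar> \<le> (of_int B :: real)" unfolding B_def by linarith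
    then have "m \<in> {-B..B}" by (simp flip: of_int_abs) linarith
    moreover have "t = h * (of_int m + \<theta>)" using assms m by (simp add: field_simps)
    ultimately show "t \<in> (\<lambda>m. h * (of_int m + \<theta>)) ` {-B..B}" by blast
  qed
  then show ?thesis by (rule finite_subset) simp
qed

text \<open>Summation by parts: writing \<open>g(t\<^sub>m) = g(s) - \<integral> g'\<close> with the integral from \<open>t\<^sub>m\<close> to \<open>s\<close> and adding up
  over the lattice points turns the sum into an integral of \<open>g'\<close> against the counting function of the
  lattice; by the counting formula, \<open>\<bar>h\<bar>\<close> times this function is \<open>t\<close> plus a constant minus \<open>h\<close> times a
  periodic Bernoulli function.\<close>

lemma euler_maclaurin_first:
  fixes g :: "real \<Rightarrow> 'b::euclidean_space"
  assumes h: "h \<noteq> 0" and th: "\<theta> \<notin> \<int>" "s/h - \<theta> \<notin> \<int>" and s: "0 \<le> s"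
    and g: "\<And>t. (g has_vector_derivative g' t) (at t)" and g': "continuous_on UNIV g'"
  shows "((\<lambda>t. periodic_bernoulli 0 (t/h - \<theta>) *\<^sub>R g' t) has_integral
     ((1/h) *\<^sub>R ((\<Sum>m\<in>lattice_pts h \<theta> s. \<bar>h\<bar> *\<^sub>R g (h * (of_int m + \<theta>))) - integral {0..s} g)
      + periodic_bernoulli 0 (s/h - \<theta>) *\<^sub>R g s - periodic_bernoulli 0 (-\<theta>) *\<^sub>R g 0)) {0..s}"
proof -
  let ?L = "lattice_pts h \<theta> s" and ?t = "\<lambda>m. h * (of_int m + \<theta>)"
  let ?b = "\<lambda>t. periodic_bernoulli 0 (t/h - \<theta>)" and ?c = "periodic_bernoulli 0 (-\<theta>)"
  have fin: "finite ?L" and cnt: "\<bar>h\<bar> * card ?L = s - h * ?b s + h * ?c"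
    using lattice_pts_count[OF h th s] by auto
  have cg: "continuous_on S g" for S
    using g by (meson continuous_at_imp_continuous_on has_vector_derivative_continuous)
  have ftc: "(g' has_integral (g b - g a)) {a..b}" if "a \<le> b" for a b
    by (rule fundamental_theorem_of_calculus[OF that]) (auto intro: has_vector_derivative_at_within g)
  have step: "((\<lambda>t. (if t \<in> {?t m..s} then g' t else 0)) has_integral (g s - g (?t m))) {0..s}" if "m \<in> ?L" for m
    using ftc[of "?t m" s] that by (subst has_integral_restrict) (auto simp: lattice_pts_def)
  have "((\<lambda>t. \<Sum>m\<in>?L. (if t \<in> {?t m..s} then g' t else 0)) has_integral (\<Sum>m\<in>?L. g s - g (?t m))) {0..s}"
    by (intro has_integral_sum fin step)
  from has_integral_cmul[OF this, of "\<bar>h\<bar>"]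
  have "((\<lambda>t. \<bar>h\<bar> *\<^sub>R (\<Sum>m\<in>?L. (if t \<in> {?t m..s} then g' t else 0))) has_integral
      (\<bar>h\<bar> *\<^sub>R (\<Sum>m\<in>?L. g s - g (?t m)))) {0..s}" .
  then have I1: "((\<lambda>t. (t - h * ?b t + h * ?c) *\<^sub>R g' t) has_integral
      (\<bar>h\<bar> *\<^sub>R (\<Sum>m\<in>?L. g s - g (?t m)))) {0..s}"
  proof (rule has_integral_spike_finite[OF finite_exceptional_points[OF h, of s \<theta>], rotated])
    fix t assume t: "t \<in> {0..s} - {t \<in> {0..s}. t/h - \<theta> \<in> \<int>}"
    then have tt: "t/h - \<theta> \<notin> \<int>" "0 \<le> t" "t \<le> s" by auto
    \<comment> \<open>The indicator functions of \<open>[t\<^sub>m, s]\<close> add up to the counting function of the lattice.\<close>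
    have sub: "{m\<in>?L. t \<in> {?t m..s}} = lattice_pts h \<theta> t"
    proof -
      have "?t m \<noteq> t" for m
      proof
        assume "?t m = t"
        then have "t/h - \<theta> = of_int m" using h by (auto simp: field_simps)
        then show False using tt by auto
      qed
      then show ?thesis using tt by (auto simp: lattice_pts_def less_le)
    qed
    have "(\<Sum>m\<in>?L. (if t \<in> {?t m..s} then g' t else 0)) = real (card (lattice_pts h \<theta> t)) *\<^sub>R g' t"
      unfolding sub[symmetric] using fin by (simp add: sum.If_cases scaleR_conv_of_real Int_def sum_constant_scaleR)
    then show "(t - h * ?b t + h * ?c) *\<^sub>R g' t = \<bar>h\<bar> *\<^sub>R (\<Sum>m\<in>?L. (if t \<in> {?t m..s} then g' t else 0))"
      using lattice_pts_count(2)[OF h th(1) tt(1,2)] by simp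
  qed
  have I2: "((\<lambda>t. t *\<^sub>R g' t) has_integral (s *\<^sub>R g s - integral {0..s} g)) {0..s}"
  proof -
    have 1: "((\<lambda>t. t *\<^sub>R g' t + 1 *\<^sub>R g t) has_integral (s *\<^sub>R g s - 0 *\<^sub>R g 0)) {0..s}"
    proof (rule fundamental_theorem_of_calculus[OF s])
      show "((\<lambda>t. t *\<^sub>R g t) has_vector_derivative t *\<^sub>R g' t + 1 *\<^sub>R g t) (at t within {0..s})" for t
        by (rule has_vector_derivative_scaleR[OF DERIV_ident has_vector_derivative_at_within[OF g]])
    qed
    have 2: "(g has_integral integral {0..s} g) {0..s}"
      by (intro integrable_integral integrable_continuous_real cg)
    show ?thesis using has_integral_diff[OF 1 2] by simp
  qed
  have I3: "((\<lambda>t. (h * ?c) *\<^sub>R g' t) has_integral ((h * ?c) *\<^sub>R (g s - g 0))) {0..s}"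
    by (rule has_integral_cmul[OF ftc[OF s]])
  have "((\<lambda>t. (1/h) *\<^sub>R (t *\<^sub>R g' t + (h * ?c) *\<^sub>R g' t - (t - h * ?b t + h * ?c) *\<^sub>R g' t)) has_integral
     ((1/h) *\<^sub>R (s *\<^sub>R g s - integral {0..s} g + (h * ?c) *\<^sub>R (g s - g 0) - \<bar>h\<bar> *\<^sub>R (\<Sum>m\<in>?L. g s - g (?t m))))) {0..s}"
    by (intro has_integral_cmul has_integral_diff has_integral_add I1 I2 I3)
  moreover have "(1/h) *\<^sub>R (t *\<^sub>R g' t + (h * ?c) *\<^sub>R g' t - (t - h * ?b t + h * ?c) *\<^sub>R g' t) = ?b t *\<^sub>R g' t" for t
  proof -
    have "t *\<^sub>R g' t + (h * ?c) *\<^sub>R g' t - (t - h * ?b t + h * ?c) *\<^sub>R g' t = (h * ?b t) *\<^sub>R g' t"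
      by (simp add: scaleR_left_diff_distrib scaleR_left_distrib)
    then show ?thesis using h by simp
  qed
  moreover have "(1/h) *\<^sub>R (s *\<^sub>R g s - integral {0..s} g + (h * ?c) *\<^sub>R (g s - g 0) - \<bar>h\<bar> *\<^sub>R (\<Sum>m\<in>?L. g s - g (?t m)))
     = (1/h) *\<^sub>R ((\<Sum>m\<in>?L. \<bar>h\<bar> *\<^sub>R g (?t m)) - integral {0..s} g) + ?b s *\<^sub>R g s - ?c *\<^sub>R g 0"
  proof -
    have "\<bar>h\<bar> *\<^sub>R (\<Sum>m\<in>?L. g s - g (?t m)) = (\<bar>h\<bar> * card ?L) *\<^sub>R g s - (\<Sum>m\<in>?L. \<bar>h\<bar> *\<^sub>R g (?t m))"
      by (simp add: sum_subtractf scaleR_right_diff_distrib scaleR_sum_right sum_constant_scaleR)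
    moreover have "(1/h) *\<^sub>R (s *\<^sub>R X - Y + (h * c) *\<^sub>R (X - Z) - ((s - h * b + h * c) *\<^sub>R X - W))
        = (1/h) *\<^sub>R (W - Y) + b *\<^sub>R X - c *\<^sub>R Z" for X Y Z W :: 'b and b c
    proof -
      have "s *\<^sub>R X - Y + (h * c) *\<^sub>R (X - Z) - ((s - h * b + h * c) *\<^sub>R X - W)
        = (W - Y) + h *\<^sub>R (b *\<^sub>R X) - h *\<^sub>R (c *\<^sub>R Z)"
        by (simp add: scaleR_left_diff_distrib scaleR_left_distrib scaleR_right_diff_distrib)
      then have "(1/h) *\<^sub>R (s *\<^sub>R X - Y + (h * c) *\<^sub>R (X - Z) - ((s - h * b + h * c) *\<^sub>R X - W))
        = (1/h) *\<^sub>R ((W - Y) + h *\<^sub>R (b *\<^sub>R X) - h *\<^sub>R (c *\<^sub>R Z))" by simp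
      also have "\<dots> = (1/h) *\<^sub>R (W - Y) + b *\<^sub>R X - c *\<^sub>R Z"
        using h by (simp add: scaleR_right_diff_distrib scaleR_right_distrib)
      finally show ?thesis .
    qed
    ultimately show ?thesis unfolding cnt by simp
  qed
  ultimately show ?thesis by simp
qed

text \<open>Repeated integration by parts. Everything is written with oriented powers \<open>(-h)\<^sup>l\<close>, so that one
  formula covers both signs of \<open>h\<close>.\<close>

lemma euler_maclaurin:
  fixes G :: "nat \<Rightarrow> real \<Rightarrow> 'b::euclidean_space"
  assumes h: "h \<noteq> 0" and th: "\<theta> \<notin> \<int>" "s/h - \<theta> \<notin> \<int>" and s: "0 \<le> s"
    and G: "\<And>l t. l \<le> n \<Longrightarrow> (G l has_vector_derivative G (Suc l) t) (at t)"
    and cG: "continuous_on UNIV (G (Suc n))"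
  shows "\<exists>I. ((\<lambda>t. periodic_bernoulli n (t/h - \<theta>) *\<^sub>R G (Suc n) t) has_integral I) {0..s} \<and>
    (\<Sum>m\<in>lattice_pts h \<theta> s. \<bar>h\<bar> *\<^sub>R G 0 (h * (of_int m + \<theta>))) =
      integral {0..s} (G 0)
      + (\<Sum>l\<le>n. (-h) ^ Suc l *\<^sub>R (periodic_bernoulli l (s/h - \<theta>) *\<^sub>R G l s - periodic_bernoulli l (-\<theta>) *\<^sub>R G l 0))
      - (-h) ^ Suc n *\<^sub>R I"
  using G cG
proof (induction n)
  case 0
  show ?case
  proof (intro exI conjI)
    show "((\<lambda>t. periodic_bernoulli 0 (t/h - \<theta>) *\<^sub>R G (Suc 0) t) has_integral
      ((1/h) *\<^sub>R ((\<Sum>m\<in>lattice_pts h \<theta> s. \<bar>h\<bar> *\<^sub>R G 0 (h * (of_int m + \<theta>))) - integral {0..s} (G 0))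
      + periodic_bernoulli 0 (s/h - \<theta>) *\<^sub>R G 0 s - periodic_bernoulli 0 (-\<theta>) *\<^sub>R G 0 0)) {0..s}"
      using euler_maclaurin_first[OF h th s 0(1) 0(2)] by simp
    show "(\<Sum>m\<in>lattice_pts h \<theta> s. \<bar>h\<bar> *\<^sub>R G 0 (h * (of_int m + \<theta>))) =
      integral {0..s} (G 0)
      + (\<Sum>l\<le>0. (-h) ^ Suc l *\<^sub>R (periodic_bernoulli l (s/h - \<theta>) *\<^sub>R G l s - periodic_bernoulli l (-\<theta>) *\<^sub>R G l 0))
      - (-h) ^ Suc 0 *\<^sub>R ((1/h) *\<^sub>R ((\<Sum>m\<in>lattice_pts h \<theta> s. \<bar>h\<bar> *\<^sub>R G 0 (h * (of_int m + \<theta>))) - integral {0..s} (G 0))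
      + periodic_bernoulli 0 (s/h - \<theta>) *\<^sub>R G 0 s - periodic_bernoulli 0 (-\<theta>) *\<^sub>R G 0 0)"
    proof -
      have "S = I + (-h) *\<^sub>R (X - Y) - (-h) *\<^sub>R ((1/h) *\<^sub>R (S - I) + X - Y)" for S I X Y :: 'b
        using h by (simp add: scaleR_right_diff_distrib scaleR_right_distrib)
      then show ?thesis by simp
    qed
  qed
next
  case (Suc n)
  have cG': "continuous_on S (G l)" if "l \<le> Suc n" for S l
    using Suc.prems(1)[OF that] by (meson continuous_at_imp_continuous_on has_vector_derivative_continuous)
  obtain I where I: "((\<lambda>t. periodic_bernoulli n (t/h - \<theta>) *\<^sub>R G (Suc n) t) has_integral I) {0..s}"
    and eq: "(\<Sum>m\<in>lattice_pts h \<theta> s. \<bar>h\<bar> *\<^sub>R G 0 (h * (of_int m + \<theta>))) =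
      integral {0..s} (G 0)
      + (\<Sum>l\<le>n. (-h) ^ Suc l *\<^sub>R (periodic_bernoulli l (s/h - \<theta>) *\<^sub>R G l s - periodic_bernoulli l (-\<theta>) *\<^sub>R G l 0))
      - (-h) ^ Suc n *\<^sub>R I"
    using Suc.IH[OF Suc.prems(1) cG'] by auto
  let ?b = "\<lambda>t. periodic_bernoulli (Suc n) (t/h - \<theta>)"
  have cb: "continuous_on {0..s} ?b"
    by (intro continuous_at_imp_continuous_on ballI isCont_o2[OF _ isCont_periodic_bernoulli] continuous_intros) (use h in auto)
  define J where "J = integral {0..s} (\<lambda>t. ?b t *\<^sub>R G (Suc (Suc n)) t)"
  have J: "((\<lambda>t. ?b t *\<^sub>R G (Suc (Suc n)) t) has_integral J) {0..s}"
    unfolding J_def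
    by (intro integrable_integral integrable_continuous_real continuous_on_scaleR cb
        continuous_on_subset[OF Suc.prems(2)]) auto
  have db: "(?b has_vector_derivative (1/h) * periodic_bernoulli n (t/h - \<theta>)) (at t)" if "t/h - \<theta> \<notin> \<int>" for t
  proof -
    have "(?b has_real_derivative periodic_bernoulli n (t/h - \<theta>) * (1/h)) (at t)"
      by (rule DERIV_chain2[where f="periodic_bernoulli (Suc n)" and g="\<lambda>t. t/h - \<theta>", OF periodic_bernoulli_deriv[OF that]])
        (use h in \<open>auto intro!: derivative_eq_intros\<close>)
    then show ?thesis by (simp add: has_real_derivative_iff_has_vector_derivative mult.commute)
  qed
  have "((\<lambda>t. ((1/h) * periodic_bernoulli n (t/h - \<theta>)) *\<^sub>R G (Suc n) t) has_integral
      (?b s *\<^sub>R G (Suc n) s - ?b 0 *\<^sub>R G (Suc n) 0 - J)) {0..s}"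
  proof (rule integration_by_parts_interior_strong[OF bounded_bilinear_scaleR
        finite_exceptional_points[OF h, of s \<theta>] s cb cG'])
    show "((\<lambda>t. ?b t *\<^sub>R G (Suc (Suc n)) t) has_integral
        ?b s *\<^sub>R G (Suc n) s - ?b 0 *\<^sub>R G (Suc n) 0
         - (?b s *\<^sub>R G (Suc n) s - ?b 0 *\<^sub>R G (Suc n) 0 - J)) {0..s}"
      using J by simp
  qed (use db Suc.prems(1) in auto)
  moreover have "((\<lambda>t. ((1/h) * periodic_bernoulli n (t/h - \<theta>)) *\<^sub>R G (Suc n) t) has_integral (1/h) *\<^sub>R I) {0..s}"
    using has_integral_cmul[OF I, of "1/h"] by simp
  ultimately have "(1/h) *\<^sub>R I = ?b s *\<^sub>R G (Suc n) s - ?b 0 *\<^sub>R G (Suc n) 0 - J"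
    by (rule has_integral_unique[rotated])
  then have "h *\<^sub>R ((1/h) *\<^sub>R I) = h *\<^sub>R (?b s *\<^sub>R G (Suc n) s - ?b 0 *\<^sub>R G (Suc n) 0 - J)" by simp
  then have "I = h *\<^sub>R (?b s *\<^sub>R G (Suc n) s - ?b 0 *\<^sub>R G (Suc n) 0 - J)" using h by simp
  then show ?case
  proof (intro exI[of _ J] conjI J)
    let ?X = "?b s *\<^sub>R G (Suc n) s - ?b 0 *\<^sub>R G (Suc n) 0"
    have "(-h) ^ Suc n *\<^sub>R I = - ((-h) ^ Suc (Suc n) *\<^sub>R ?X - (-h) ^ Suc (Suc n) *\<^sub>R J)"
      using \<open>I = h *\<^sub>R (?X - J)\<close> by (simp add: scaleR_right_diff_distrib mult_ac)
    then show "(\<Sum>m\<in>lattice_pts h \<theta> s. \<bar>h\<bar> *\<^sub>R G 0 (h * (of_int m + \<theta>))) =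
      integral {0..s} (G 0)
      + (\<Sum>l\<le>Suc n. (-h) ^ Suc l *\<^sub>R (periodic_bernoulli l (s/h - \<theta>) *\<^sub>R G l s - periodic_bernoulli l (-\<theta>) *\<^sub>R G l 0))
      - (-h) ^ Suc (Suc n) *\<^sub>R J"
      unfolding eq sum.atMost_Suc by simp
  qed
qed

section \<open>One summation with parameters\<close>

definition dir_deriv :: "'a::real_normed_vector \<Rightarrow> ('a \<Rightarrow> 'b::real_normed_vector) \<Rightarrow> 'a \<Rightarrow> 'b" where
  "dir_deriv v g = (\<lambda>z. frechet_derivative g (at z) v)"

lemma Ck_dir_deriv_iter: "Ck (l + n) g \<Longrightarrow> Ck n ((dir_deriv v ^^ l) g)"
proof (induction l arbitrary: n)
  case (Suc l)
  then show ?case using Ck_frechet_derivative[OF Suc.IH[of "Suc n"], of v] by (simp add: dir_deriv_def)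
qed auto

lemma dir_deriv_along_line:
  fixes g :: "real \<times> 'a::euclidean_space \<Rightarrow> 'b::real_normed_vector"
  assumes "Ck (Suc l) g"
  shows "((\<lambda>t. (dir_deriv (1, u) ^^ l) g (t, x + t *\<^sub>R u)) has_vector_derivative
    (dir_deriv (1, u) ^^ Suc l) g (t, x + t *\<^sub>R u)) (at t)"
proof -
  let ?g = "(dir_deriv (1, u) ^^ l) g"
  have "Ck (Suc 0) ?g" using assms by (intro Ck_dir_deriv_iter) simp
  from Ck_has_derivative[OF this]
  have d: "(?g has_derivative frechet_derivative ?g (at z)) (at z)" for z .
  have "((\<lambda>t. ?g (t, x + t *\<^sub>R u)) has_derivative (\<lambda>r. frechet_derivative ?g (at (t, x + t *\<^sub>R u)) (r, r *\<^sub>R u))) (at t)"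
    by (rule has_derivative_compose[OF _ d]) (auto intro!: derivative_eq_intros)
  moreover have "frechet_derivative ?g (at z) (r, r *\<^sub>R u) = r *\<^sub>R frechet_derivative ?g (at z) (1, u)" for z r
    using linear_scale[OF has_derivative_linear[OF d], of z r "(1, u)"] by simp
  ultimately show ?thesis by (simp add: has_vector_derivative_def dir_deriv_def)
qed

text \<open>In a pair \<open>z = (s, x)\<close> the number \<open>s\<close> is the current upper end point and \<open>x\<close> the point of the space reached
  so far. Summing over the next coordinate \<open>t < s\<close> moves on to \<open>(t, x + t u)\<close>.\<close>

definition shifted_sum :: "real \<Rightarrow> real \<Rightarrow> 'a::real_normed_vector \<Rightarrow> (real \<times> 'a \<Rightarrow> 'b::real_normed_vector) \<Rightarrow> real \<times> 'a \<Rightarrow> 'b" where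
  "shifted_sum h \<theta> u g z = (\<Sum>m\<in>lattice_pts h \<theta> (fst z).
     \<bar>h\<bar> *\<^sub>R g (h * (of_int m + \<theta>), snd z + (h * (of_int m + \<theta>)) *\<^sub>R u))"

text \<open>This is the integral of \<open>g (t, x + t u)\<close> over \<open>t\<close> from \<open>0\<close> to \<open>s\<close>, scaled to the unit interval so that it is
  visibly smooth in \<open>(s, x)\<close> for all real \<open>s\<close>.\<close>

definition segment_integral :: "'a::real_normed_vector \<Rightarrow> (real \<times> 'a \<Rightarrow> 'b::real_normed_vector) \<Rightarrow> real \<times> 'a \<Rightarrow> 'b" where
  "segment_integral u g z = fst z *\<^sub>R integral {0..1} (\<lambda>r. g (r * fst z, snd z + (r * fst z) *\<^sub>R u))"

lemma Ck_segment_integral: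
  fixes g :: "real \<times> 'a::euclidean_space \<Rightarrow> 'b::euclidean_space"
  assumes "Ck n g"
  shows "Ck n (segment_integral u g)"
proof -
  have "Ck n (\<lambda>z. integral {0..1} (\<lambda>r. 1 *\<^sub>R g ((0, snd z) + r *\<^sub>R (fst z *\<^sub>R (1, u)))))"
    by (rule Ck_segment_average[OF _ _ _ assms])
      (auto intro!: bounded_linear_intros bounded_linear_Pair continuous_intros)
  from Ck_linear_scaleR[OF bounded_linear_fst this] show ?thesis
    by (simp add: segment_integral_def[abs_def] add.commute)
qed

lemma segment_integral_eq:
  fixes g :: "real \<times> 'a::euclidean_space \<Rightarrow> 'b::euclidean_space"
  assumes "continuous_on UNIV g" "0 < fst z"
  shows "integral {0..fst z} (\<lambda>t. g (t, snd z + t *\<^sub>R u)) = segment_integral u g z"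
proof -
  let ?f = "\<lambda>t. g (t, snd z + t *\<^sub>R u)"
  have "(?f has_integral integral {0..fst z} ?f) (cbox 0 (fst z))"
    unfolding box_real
    by (intro integrable_integral integrable_continuous_real continuous_on_compose2[OF assms(1)] continuous_intros) auto
  from has_integral_affinity[OF this, of "fst z" 0] assms(2)
  have "((\<lambda>r. ?f (fst z * r)) has_integral (1/fst z) *\<^sub>R integral {0..fst z} ?f) ((\<lambda>x. x / fst z) ` {0..fst z})"
    by (simp add: divide_inverse mult.commute)
  also have "(\<lambda>x. x / fst z) ` {0..fst z} = {0..1}"
    using assms(2) by (simp add: image_divide_atLeastAtMost)
  finally show ?thesis
    using assms(2) by (simp add: segment_integral_def integral_unique mult.commute)
qed

definition recip_ints :: "real set" where
  "recip_ints = {h. h \<noteq> 0 \<and> 1/h \<in> \<int>}"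

lemma recip_ints_abs_le: "h \<in> recip_ints \<Longrightarrow> \<bar>h\<bar> \<le> 1"
proof -
  assume "h \<in> recip_ints"
  then have h: "h \<noteq> 0" "1/h \<in> \<int>" by (auto simp: recip_ints_def)
  then have "\<bar>1/h\<bar> \<ge> 1" by (intro Ints_nonzero_abs_ge1) auto
  then show ?thesis using h by (simp add: field_simps)
qed

lemma compact_bound:
  fixes g :: "real \<times> 'a::euclidean_space \<Rightarrow> 'b::real_normed_vector"
  assumes "continuous_on UNIV g"
  shows "\<exists>B\<ge>0. \<forall>t x. 0 \<le> t \<and> t \<le> 1 \<and> norm x \<le> R \<longrightarrow> norm (g (t, x)) \<le> B"
proof -
  have "bounded (g ` ({0..1} \<times> cball 0 R))"
    by (intro compact_imp_bounded compact_continuous_image continuous_on_subset[OF assms] compact_Times) auto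
  then obtain B where B: "\<And>y. y \<in> g ` ({0..1} \<times> cball 0 R) \<Longrightarrow> norm y \<le> B"
    unfolding bounded_iff by blast
  show ?thesis
  proof (intro exI[of _ "max B 0"] conjI allI impI)
    fix t :: real and x :: 'a assume "0 \<le> t \<and> t \<le> 1 \<and> norm x \<le> R"
    then have "g (t, x) \<in> g ` ({0..1} \<times> cball 0 R)" by auto
    from B[OF this] show "norm (g (t, x)) \<le> max B 0" by simp
  qed simp
qed

text \<open>The boundary terms are again smooth functions of \<open>z\<close>, with coefficients that depend on the shifts only: since
  \<open>fst z\<close> lies on the lattice with shift \<open>\<eta>\<close>, periodicity allows to replace the argument \<open>fst z / h - \<theta>\<close> of the
  Bernoulli functions by \<open>\<eta> - \<theta>\<close>. The constant is uniform in \<open>h\<close>, in the shifts and for bounded \<open>z\<close>.\<close>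

lemma shifted_sum_expansion:
  fixes g :: "real \<times> 'a::euclidean_space \<Rightarrow> 'b::euclidean_space"
  assumes g: "Ck (Suc n) g"
  shows "\<exists>C\<ge>0. \<forall>h\<in>recip_ints. \<forall>\<theta> \<eta> z. \<theta> \<notin> \<int> \<longrightarrow> \<theta> - \<eta> \<notin> \<int> \<longrightarrow> 0 < fst z \<longrightarrow> fst z \<le> 1 \<longrightarrow>
      fst z / h - \<eta> \<in> \<int> \<longrightarrow> norm (snd z) \<le> R \<longrightarrow>
    norm (shifted_sum h \<theta> u g z - (segment_integral u g z +
       (\<Sum>l\<le>n. (-h) ^ Suc l *\<^sub>R
         (periodic_bernoulli l (\<eta> - \<theta>) *\<^sub>R (dir_deriv (1,u) ^^ l) g (fst z, snd z + fst z *\<^sub>R u)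
          - periodic_bernoulli l (-\<theta>) *\<^sub>R (dir_deriv (1,u) ^^ l) g (0, snd z))))) \<le> C * \<bar>h\<bar> ^ Suc n"
proof -
  obtain M where M: "0 \<le> M" "\<And>x. \<bar>periodic_bernoulli n x\<bar> \<le> M" using periodic_bernoulli_bounded by blast
  have cD: "continuous_on UNIV ((dir_deriv (1,u) ^^ Suc n) g)"
    using Ck_dir_deriv_iter[of "Suc n" 0 g "(1,u)"] g by simp
  obtain B where B: "0 \<le> B" "\<And>t x. 0 \<le> t \<and> t \<le> 1 \<and> norm x \<le> R + norm u \<Longrightarrow>
      norm ((dir_deriv (1,u) ^^ Suc n) g (t, x)) \<le> B"
    using compact_bound[OF cD, of "R + norm u"] by blast
  show ?thesis
  proof (rule exI[of _ "M * B"], intro conjI ballI allI impI)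
    fix h \<theta> \<eta> :: real and z :: "real \<times> 'a"
    assume h: "h \<in> recip_ints" and th: "\<theta> \<notin> \<int>" "\<theta> - \<eta> \<notin> \<int>" and z: "0 < fst z" "fst z \<le> 1"
      and ze: "fst z / h - \<eta> \<in> \<int>" and R: "norm (snd z) \<le> R"
    let ?s = "fst z" and ?G = "\<lambda>l t. (dir_deriv (1,u) ^^ l) g (t, snd z + t *\<^sub>R u)"
    obtain k where k: "?s / h - \<eta> = of_int k" using ze by (auto elim: Ints_cases)
    have sh: "?s / h - \<theta> = (\<eta> - \<theta>) + of_int k" using k by simp
    have h0: "h \<noteq> 0" using h by (auto simp: recip_ints_def)
    have nz: "?s / h - \<theta> \<notin> \<int>"
    proof
      assume "?s / h - \<theta> \<in> \<int>"
      from Ints_diff[OF ze this] show False using th(2) by simp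
    qed
    have cG: "continuous_on UNIV (?G (Suc n))"
      by (intro continuous_on_compose2[OF cD] continuous_intros) auto
    have G: "(?G l has_vector_derivative ?G (Suc l) t) (at t)" if "l \<le> n" for l t
      by (rule dir_deriv_along_line[OF Ck_mono[OF g]]) (use that in auto)
    from euler_maclaurin[of h \<theta> ?s n ?G, OF h0 th(1) nz less_imp_le[OF z(1)] G cG]
    obtain I where I: "((\<lambda>t. periodic_bernoulli n (t/h - \<theta>) *\<^sub>R ?G (Suc n) t) has_integral I) {0..?s}"
      and eq: "(\<Sum>m\<in>lattice_pts h \<theta> ?s. \<bar>h\<bar> *\<^sub>R ?G 0 (h * (of_int m + \<theta>))) =
      integral {0..?s} (?G 0)
      + (\<Sum>l\<le>n. (-h) ^ Suc l *\<^sub>R (periodic_bernoulli l (?s/h - \<theta>) *\<^sub>R ?G l ?s - periodic_bernoulli l (-\<theta>) *\<^sub>R ?G l 0))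
      - (-h) ^ Suc n *\<^sub>R I" by blast
    have "norm (periodic_bernoulli n (t/h - \<theta>) *\<^sub>R ?G (Suc n) t) \<le> M * B" if "t \<in> cbox 0 ?s" for t
    proof -
      have "norm (snd z + t *\<^sub>R u) \<le> norm (snd z) + t * norm u"
        using that by (intro norm_triangle_le) auto
      also have "\<dots> \<le> R + norm u" using that z R mult_right_mono[of t 1 "norm u"] by auto
      finally show ?thesis
        using that z by (simp only: norm_scaleR real_norm_def) (intro mult_mono M B, auto)
    qed
    from has_integral_bound[OF _ I[unfolded box_real[symmetric]] this]
    have "norm I \<le> M * B * ?s" using M B z by simp
    also have "\<dots> \<le> M * B" using M B z by (simp add: mult_left_le)
    finally have nI: "norm I \<le> M * B" .
    have "segment_integral u g z = integral {0..?s} (?G 0)"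
      using segment_integral_eq[OF Ck_imp_continuous_on[OF g] z(1), of u] by simp
    moreover have "shifted_sum h \<theta> u g z = (\<Sum>m\<in>lattice_pts h \<theta> ?s. \<bar>h\<bar> *\<^sub>R ?G 0 (h * (of_int m + \<theta>)))"
      by (simp add: shifted_sum_def)
    ultimately have "shifted_sum h \<theta> u g z - (segment_integral u g z +
       (\<Sum>l\<le>n. (-h) ^ Suc l *\<^sub>R (periodic_bernoulli l (\<eta> - \<theta>) *\<^sub>R ?G l ?s - periodic_bernoulli l (-\<theta>) *\<^sub>R ?G l 0)))
       = - ((-h) ^ Suc n *\<^sub>R I)"
      unfolding eq sh periodic_bernoulli_add_int by simp
    then have "norm (shifted_sum h \<theta> u g z - (segment_integral u g z +
       (\<Sum>l\<le>n. (-h) ^ Suc l *\<^sub>R (periodic_bernoulli l (\<eta> - \<theta>) *\<^sub>R ?G l ?s - periodic_bernoulli l (-\<theta>) *\<^sub>R ?G l 0))))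
       = \<bar>h\<bar> ^ Suc n * norm I" by (simp add: power_abs abs_mult)
    also have "\<dots> \<le> M * B * \<bar>h\<bar> ^ Suc n" using mult_left_mono[OF nI, of "\<bar>h\<bar> ^ Suc n"] by (simp add: mult.commute)
    finally show "norm (shifted_sum h \<theta> u g z - (segment_integral u g z +
       (\<Sum>l\<le>n. (-h) ^ Suc l *\<^sub>R
         (periodic_bernoulli l (\<eta> - \<theta>) *\<^sub>R (dir_deriv (1,u) ^^ l) g (fst z, snd z + fst z *\<^sub>R u)
          - periodic_bernoulli l (-\<theta>) *\<^sub>R (dir_deriv (1,u) ^^ l) g (0, snd z))))) \<le> M * B * \<bar>h\<bar> ^ Suc n" by simp
  qed (use M B in auto)
qed


section \<open>Nested sums and their expansions\<close>

text \<open>The innermost summation, with index \<open>k\<close>, is split off first: in the induction it is replaced by its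
  Euler-Maclaurin expansion, a combination of smooth functions to which the outer summations are applied.\<close>

primrec nested_sum :: "real \<Rightarrow> (nat \<Rightarrow> real) \<Rightarrow> (nat \<Rightarrow> 'a::real_normed_vector) \<Rightarrow> nat \<Rightarrow>
    (real \<times> 'a \<Rightarrow> 'b::real_normed_vector) \<Rightarrow> real \<times> 'a \<Rightarrow> 'b" where
  "nested_sum h \<theta> u 0 g = g"
| "nested_sum h \<theta> u (Suc k) g = nested_sum h \<theta> u k (shifted_sum h (\<theta> k) (u k) g)"

lemma nested_sum_add:
  "nested_sum h \<theta> u k (\<lambda>z. f z + g z) z = nested_sum h \<theta> u k f z + nested_sum h \<theta> u k g z"
proof (induction k arbitrary: f g)
  case (Suc k)
  have "shifted_sum h (\<theta> k) (u k) (\<lambda>z. f z + g z)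
      = (\<lambda>z. shifted_sum h (\<theta> k) (u k) f z + shifted_sum h (\<theta> k) (u k) g z)"
    by (simp add: shifted_sum_def fun_eq_iff scaleR_right_distrib sum.distrib)
  then show ?case by (simp add: Suc.IH)
qed simp

lemma nested_sum_scaleR:
  "nested_sum h \<theta> u k (\<lambda>z. c *\<^sub>R f z) z = c *\<^sub>R nested_sum h \<theta> u k f z"
proof (induction k arbitrary: f)
  case (Suc k)
  have "shifted_sum h (\<theta> k) (u k) (\<lambda>z. c *\<^sub>R f z) = (\<lambda>z. c *\<^sub>R shifted_sum h (\<theta> k) (u k) f z)"
    by (simp add: shifted_sum_def fun_eq_iff scaleR_sum_right mult.commute)
  then show ?case by (simp add: Suc.IH)
qed simp

lemma nested_sum_diff:
  "nested_sum h \<theta> u k (\<lambda>z. f z - g z) z = nested_sum h \<theta> u k f z - nested_sum h \<theta> u k g z"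
  using nested_sum_add[of h \<theta> u k f "\<lambda>z. (-1) *\<^sub>R g z" z] nested_sum_scaleR[of h \<theta> u k "-1" g z]
  by simp

lemma nested_sum_sum:
  assumes "finite A"
  shows "nested_sum h \<theta> u k (\<lambda>z. \<Sum>i\<in>A. f i z) z = (\<Sum>i\<in>A. nested_sum h \<theta> u k (f i) z)"
  using assms
proof (induction A)
  case empty
  then show ?case using nested_sum_scaleR[of h \<theta> u k 0 "\<lambda>_. 0" z] by simp
next
  case (insert i A)
  then show ?case by (simp add: nested_sum_add)
qed

text \<open>The upper end point of the \<open>i\<close>-th summation lies on the lattice with this shift. For \<open>i = 0\<close> the end point
  is \<open>1\<close>, which belongs to \<open>h \<int>\<close> when \<open>1/h\<close> is an integer.\<close>

definition prev_shift :: "(nat \<Rightarrow> real) \<Rightarrow> nat \<Rightarrow> real" where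
  "prev_shift \<theta> i = (if i = 0 then 0 else \<theta> (i - 1))"

text \<open>No summation variable can meet one of its end points.\<close>

definition generic_shift :: "nat \<Rightarrow> (nat \<Rightarrow> real) \<Rightarrow> bool" where
  "generic_shift k \<theta> \<longleftrightarrow> (\<forall>i<k. \<theta> i \<notin> \<int> \<and> \<theta> i - prev_shift \<theta> i \<notin> \<int>)"

lemma shifted_sum_bound:
  assumes h: "h \<in> recip_ints" and th: "\<theta> \<notin> \<int>" "\<theta> - \<eta> \<notin> \<int>"
    and z: "0 < fst z" "fst z \<le> 1" "fst z / h - \<eta> \<in> \<int>"
    and g: "\<And>t. 0 < t \<Longrightarrow> t \<le> 1 \<Longrightarrow> t / h - \<theta> \<in> \<int> \<Longrightarrow> norm (g (t, snd z + t *\<^sub>R u)) \<le> B"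
    and B: "0 \<le> B"
  shows "norm (shifted_sum h \<theta> u g z) \<le> 2 * B"
proof -
  let ?L = "lattice_pts h \<theta> (fst z)" and ?t = "\<lambda>m. h * (of_int m + \<theta>)"
  have h0: "h \<noteq> 0" using h by (auto simp: recip_ints_def)
  have nz: "fst z / h - \<theta> \<notin> \<int>"
  proof
    assume "fst z / h - \<theta> \<in> \<int>"
    from Ints_diff[OF z(3) this] show False using th(2) by simp
  qed
  have b0: "\<bar>periodic_bernoulli 0 x\<bar> \<le> 1/2" for x unfolding periodic_bernoulli_0 by linarith
  have "\<bar>h\<bar> * card ?L = fst z - h * periodic_bernoulli 0 (fst z/h - \<theta>) + h * periodic_bernoulli 0 (-\<theta>)"
    using lattice_pts_count(2)[OF h0 th(1) nz] z by simp
  moreover have "\<bar>h * periodic_bernoulli 0 x\<bar> \<le> 1/2" for x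
    unfolding abs_mult using mult_mono[OF recip_ints_abs_le[OF h] b0[of x]] by simp
  note this[of "fst z/h - \<theta>"] this[of "-\<theta>"]
  ultimately have cnt: "\<bar>h\<bar> * card ?L \<le> 2"
    using z(2) by linarith
  have "norm (shifted_sum h \<theta> u g z) \<le> (\<Sum>m\<in>?L. \<bar>h\<bar> * B)"
    unfolding shifted_sum_def
  proof (rule sum_norm_le)
    fix m assume m: "m \<in> ?L"
    have "?t m / h - \<theta> = of_int m" using h0 by simp
    then have "?t m / h - \<theta> \<in> \<int>" by (metis Ints_of_int)
    then have "norm (g (?t m, snd z + ?t m *\<^sub>R u)) \<le> B"
      using m z by (intro g) (auto simp: lattice_pts_def)
    then show "norm (\<bar>h\<bar> *\<^sub>R g (?t m, snd z + ?t m *\<^sub>R u)) \<le> \<bar>h\<bar> * B"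
      by (simp add: mult_left_mono)
  qed
  also have "\<dots> = (\<bar>h\<bar> * card ?L) * B" by simp
  also have "\<dots> \<le> 2 * B" by (rule mult_right_mono[OF cnt B])
  finally show ?thesis .
qed

text \<open>A summation over one coordinate at most doubles a bound, as an interval of length at most \<open>1\<close> contains at most
  \<open>1 + 1/\<bar>h\<bar>\<close> points of the lattice and \<open>\<bar>h\<bar> \<le> 1\<close>. This makes error terms harmless in the induction; for them it is important
  that only the values of \<open>g\<close> on the shifted lattice in a bounded region enter.\<close>

lemma nested_sum_bound:
  fixes g :: "real \<times> 'a::real_normed_vector \<Rightarrow> 'b::real_normed_vector"
  assumes h: "h \<in> recip_ints" and th: "generic_shift k \<theta>" and B: "0 \<le> B"
    and g: "\<And>z. 0 < fst z \<Longrightarrow> fst z \<le> 1 \<Longrightarrow> fst z / h - prev_shift \<theta> k \<in> \<int> \<Longrightarrow>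
      norm (snd z) \<le> norm x + (\<Sum>i<k. norm (u i)) \<Longrightarrow> norm (g z) \<le> B"
  shows "norm (nested_sum h \<theta> u k g (1, x)) \<le> 2 ^ k * B"
  using th B g
proof (induction k arbitrary: g B)
  case 0
  then show ?case using h by (simp add: prev_shift_def recip_ints_def)
next
  case (Suc k)
  have "norm (nested_sum h \<theta> u k (shifted_sum h (\<theta> k) (u k) g) (1, x)) \<le> 2 ^ k * (2 * B)"
  proof (rule Suc.IH)
    show "generic_shift k \<theta>" using Suc.prems(1) by (simp add: generic_shift_def)
    show "0 \<le> 2 * B" using Suc.prems by simp
    fix z :: "real \<times> 'a"
    assume z: "0 < fst z" "fst z \<le> 1" "fst z / h - prev_shift \<theta> k \<in> \<int>"
      and nz: "norm (snd z) \<le> norm x + (\<Sum>i<k. norm (u i))"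
    show "norm (shifted_sum h (\<theta> k) (u k) g z) \<le> 2 * B"
    proof (rule shifted_sum_bound[OF h _ _ z])
      show "\<theta> k \<notin> \<int>" "\<theta> k - prev_shift \<theta> k \<notin> \<int>" using Suc.prems(1) by (auto simp: generic_shift_def)
      fix t :: real assume t: "0 < t" "t \<le> 1" "t / h - \<theta> k \<in> \<int>"
      have "norm (snd z + t *\<^sub>R u k) \<le> norm (snd z) + t * norm (u k)"
        using t by (intro norm_triangle_le) auto
      also have "\<dots> \<le> norm x + (\<Sum>i<Suc k. norm (u i))"
        using nz t mult_right_mono[of t 1 "norm (u k)"] by auto
      finally show "norm (g (t, snd z + t *\<^sub>R u k)) \<le> B"
        using t by (intro Suc.prems(3)) (auto simp: prev_shift_def)
    qed (use Suc.prems in auto)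
  qed
  then show ?case by simp
qed

text \<open>The same coefficients serve positive and negative \<open>h\<close>. The constant \<open>C\<close> is a parameter of its own because
  it has to be uniform in the shifts while the coefficients depend on them.\<close>

definition has_expansion :: "nat \<Rightarrow> real \<Rightarrow> (real \<Rightarrow> 'b::real_normed_vector) \<Rightarrow> bool" where
  "has_expansion n C \<phi> \<longleftrightarrow> (\<exists>a. \<forall>h\<in>recip_ints. norm (\<phi> h - (\<Sum>i<n. h ^ i *\<^sub>R a i)) \<le> C * \<bar>h\<bar> ^ n)"

lemma has_expansion_add:
  assumes "has_expansion n C \<phi>" "has_expansion n D \<psi>"
  shows "has_expansion n (C + D) (\<lambda>h. \<phi> h + \<psi> h)"
proof -
  obtain a b where a: "\<And>h. h \<in> recip_ints \<Longrightarrow> norm (\<phi> h - (\<Sum>i<n. h ^ i *\<^sub>R a i)) \<le> C * \<bar>h\<bar> ^ n"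
    and b: "\<And>h. h \<in> recip_ints \<Longrightarrow> norm (\<psi> h - (\<Sum>i<n. h ^ i *\<^sub>R b i)) \<le> D * \<bar>h\<bar> ^ n"
    using assms by (auto simp: has_expansion_def)
  have "norm (\<phi> h + \<psi> h - (\<Sum>i<n. h ^ i *\<^sub>R (a i + b i))) \<le> (C + D) * \<bar>h\<bar> ^ n" if "h \<in> recip_ints" for h
  proof -
    have "\<phi> h + \<psi> h - (\<Sum>i<n. h ^ i *\<^sub>R (a i + b i))
      = (\<phi> h - (\<Sum>i<n. h ^ i *\<^sub>R a i)) + (\<psi> h - (\<Sum>i<n. h ^ i *\<^sub>R b i))"
      by (simp add: scaleR_right_distrib sum.distrib)
    also have "norm \<dots> \<le> C * \<bar>h\<bar> ^ n + D * \<bar>h\<bar> ^ n"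
      by (intro norm_triangle_le add_mono a b that)
    finally show ?thesis by (simp add: algebra_simps)
  qed
  then show ?thesis unfolding has_expansion_def by (intro exI[of _ "\<lambda>i. a i + b i"]) blast
qed

lemma has_expansion_sum:
  assumes "finite A" "\<And>i. i \<in> A \<Longrightarrow> has_expansion n (C i) (\<phi> i)"
  shows "has_expansion n (\<Sum>i\<in>A. C i) (\<lambda>h. \<Sum>i\<in>A. \<phi> i h)"
  using assms
proof (induction A)
  case empty
  show ?case unfolding has_expansion_def by (intro exI[of _ "\<lambda>_. 0"]) auto
next
  case (insert i A)
  then show ?case by (simp add: has_expansion_add)
qed

lemma has_expansion_mono: "has_expansion n C \<phi> \<Longrightarrow> C \<le> D \<Longrightarrow> has_expansion n D \<phi>"
  unfolding has_expansion_def by (meson mult_right_mono order_trans zero_le_power abs_ge_zero)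

lemma has_expansion_power_mult:
  assumes "has_expansion n C \<phi>" "\<bar>c\<bar> \<le> M" "0 \<le> C"
  shows "has_expansion (n + j) (M * C) (\<lambda>h. (h ^ j * c) *\<^sub>R \<phi> h)"
proof -
  obtain a where a: "\<And>h. h \<in> recip_ints \<Longrightarrow> norm (\<phi> h - (\<Sum>i<n. h ^ i *\<^sub>R a i)) \<le> C * \<bar>h\<bar> ^ n"
    using assms by (auto simp: has_expansion_def)
  define b where "b i = (if i < j then 0 else c *\<^sub>R a (i - j))" for i
  have "norm ((h ^ j * c) *\<^sub>R \<phi> h - (\<Sum>i<n + j. h ^ i *\<^sub>R b i)) \<le> M * C * \<bar>h\<bar> ^ (n + j)" if "h \<in> recip_ints" for h
  proof -
    have "(\<Sum>i<n + j. h ^ i *\<^sub>R b i) = (\<Sum>i\<in>{j..<n + j}. h ^ i *\<^sub>R b i)"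
      by (rule sum.mono_neutral_right) (auto simp: b_def)
    also have "\<dots> = (\<Sum>i<n. h ^ (i + j) *\<^sub>R b (i + j))"
      using sum.shift_bounds_nat_ivl[of "\<lambda>i. h ^ i *\<^sub>R b i" 0 j n] by (simp add: lessThan_atLeast0)
    also have "\<dots> = (h ^ j * c) *\<^sub>R (\<Sum>i<n. h ^ i *\<^sub>R a i)"
      by (simp add: b_def scaleR_sum_right power_add mult_ac)
    finally have "(h ^ j * c) *\<^sub>R \<phi> h - (\<Sum>i<n + j. h ^ i *\<^sub>R b i)
        = (h ^ j * c) *\<^sub>R (\<phi> h - (\<Sum>i<n. h ^ i *\<^sub>R a i))"
      by (simp add: scaleR_right_diff_distrib)
    then have "norm ((h ^ j * c) *\<^sub>R \<phi> h - (\<Sum>i<n + j. h ^ i *\<^sub>R b i))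
        = \<bar>h\<bar> ^ j * \<bar>c\<bar> * norm (\<phi> h - (\<Sum>i<n. h ^ i *\<^sub>R a i))"
      by (simp add: abs_mult power_abs)
    also have "\<dots> \<le> \<bar>h\<bar> ^ j * M * (C * \<bar>h\<bar> ^ n)"
      using assms(2) by (intro mult_mono a that) auto
    finally show ?thesis by (simp add: power_add mult_ac)
  qed
  then show ?thesis unfolding has_expansion_def by (intro exI[of _ b]) blast
qed

lemma has_expansion_perturb:
  assumes "has_expansion n C \<phi>" "\<And>h. h \<in> recip_ints \<Longrightarrow> norm (\<psi> h - \<phi> h) \<le> D * \<bar>h\<bar> ^ n"
  shows "has_expansion n (C + D) \<psi>"
proof -
  have "has_expansion n D (\<lambda>h. \<psi> h - \<phi> h)"
    unfolding has_expansion_def using assms(2) by (intro exI[of _ "\<lambda>_. 0"]) auto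
  from has_expansion_add[OF assms(1) this] show ?thesis by simp
qed

text \<open>Induction on the number of summations. The Euler-Maclaurin formula replaces the innermost summation by
  its integral, which is as smooth as \<open>g\<close>, by boundary terms \<open>P l\<close> and \<open>Q l\<close> with a factor \<open>h\<^sup>l\<^sup>+\<^sup>1\<close>, and by an error
  of order \<open>\<bar>h\<bar>\<^sup>n\<close>. The boundary terms have lost \<open>l\<close> derivatives, but because of their factor they only need to be expanded
  to order \<open>n - l - 1\<close>.\<close>

theorem nested_sum_has_expansion:
  fixes g :: "real \<times> 'a::euclidean_space \<Rightarrow> 'b::euclidean_space"
  assumes "Ck n g"
  shows "\<exists>C\<ge>0. \<forall>\<theta>. generic_shift k \<theta> \<longrightarrow> has_expansion n C (\<lambda>h. nested_sum h \<theta> u k g (1, x))"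
  using assms
proof (induction k arbitrary: n g)
  case 0
  have "norm (g (1, x) - (\<Sum>i<n. h ^ i *\<^sub>R (if i = 0 then g (1, x) else 0))) \<le> norm (g (1, x)) * \<bar>h\<bar> ^ n" for h :: real
    by (cases n) (simp_all add: sum.lessThan_Suc_shift del: sum.lessThan_Suc)
  then show ?case
    by (intro exI[of _ "norm (g (1, x))"] conjI allI impI)
      (auto simp: has_expansion_def intro!: exI[of _ "\<lambda>i. if i = 0 then g (1, x) else 0"])
next
  case (Suc k)
  define R where "R = norm x + (\<Sum>i<k. norm (u i))"
  show ?case
  proof (cases n)
    case 0
    obtain B where B: "0 \<le> B" "\<And>t y. 0 \<le> t \<and> t \<le> 1 \<and> norm y \<le> R + norm (u k) \<Longrightarrow> norm (g (t, y)) \<le> B"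
      using compact_bound[OF Ck_imp_continuous_on[OF Suc.prems], of "R + norm (u k)"] by blast
    have "norm (nested_sum h \<theta> u (Suc k) g (1, x)) \<le> 2 ^ Suc k * B"
      if "generic_shift (Suc k) \<theta>" "h \<in> recip_ints" for h \<theta>
    proof (rule nested_sum_bound[OF that(2,1) B(1)])
      fix z :: "real \<times> 'a"
      assume "0 < fst z" "fst z \<le> 1" "norm (snd z) \<le> norm x + (\<Sum>i<Suc k. norm (u i))"
      then show "norm (g z) \<le> B" using B(2)[of "fst z" "snd z"] by (simp add: R_def add.assoc)
    qed
    then show ?thesis using B(1) 0
      by (intro exI[of _ "2 ^ Suc k * B"]) (auto simp: has_expansion_def)
  next
    case (Suc n')
    note n = this
    define P where "P l z = (dir_deriv (1, u k) ^^ l) g (fst z, snd z + fst z *\<^sub>R u k)" for l z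
    define Q where "Q l z = (dir_deriv (1, u k) ^^ l) g (0, snd z)" for l and z :: "real \<times> 'a"
    define E where "E = (\<lambda>h \<theta> z. segment_integral (u k) g z + (\<Sum>l\<le>n'. (-h) ^ Suc l *\<^sub>R
      (periodic_bernoulli l (prev_shift \<theta> k - \<theta> k) *\<^sub>R P l z - periodic_bernoulli l (- \<theta> k) *\<^sub>R Q l z)))"
    obtain C1 where C10: "0 \<le> C1" and C1raw: "\<forall>h\<in>recip_ints. \<forall>\<theta> \<eta> z. \<theta> \<notin> \<int> \<longrightarrow> \<theta> - \<eta> \<notin> \<int> \<longrightarrow>
        0 < fst z \<longrightarrow> fst z \<le> 1 \<longrightarrow> fst z / h - \<eta> \<in> \<int> \<longrightarrow> norm (snd z) \<le> R \<longrightarrow>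
        norm (shifted_sum h \<theta> (u k) g z - (segment_integral (u k) g z + (\<Sum>l\<le>n'. (-h) ^ Suc l *\<^sub>R
          (periodic_bernoulli l (\<eta> - \<theta>) *\<^sub>R P l z - periodic_bernoulli l (- \<theta>) *\<^sub>R Q l z)))) \<le> C1 * \<bar>h\<bar> ^ n"
      using shifted_sum_expansion[of n' g R "u k"] Suc.prems unfolding n P_def Q_def by blast
    have C1: "norm (shifted_sum h (\<theta> k) (u k) g z - E h \<theta> z) \<le> C1 * \<bar>h\<bar> ^ n"
      if "h \<in> recip_ints" "generic_shift (Suc k) \<theta>" "0 < fst z" "fst z \<le> 1"
        "fst z / h - prev_shift \<theta> k \<in> \<int>" "norm (snd z) \<le> R" for h \<theta> z
      using C1raw[rule_format, of h "\<theta> k" "prev_shift \<theta> k" z] that by (simp add: generic_shift_def E_def)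
    obtain CI where CI: "CI \<ge> 0" "\<And>\<theta>. generic_shift k \<theta> \<Longrightarrow>
        has_expansion n CI (\<lambda>h. nested_sum h \<theta> u k (segment_integral (u k) g) (1, x))"
      using Suc.IH[OF Ck_segment_integral[OF Suc.prems]] by blast
    have CkD: "Ck (n' - l) ((dir_deriv (1, u k) ^^ l) g)" if "l \<le> n'" for l
      by (rule Ck_dir_deriv_iter, rule Ck_mono[OF Suc.prems]) (use that n in auto)
    have CkP: "Ck (n' - l) (P l)" if "l \<le> n'" for l
    proof -
      have "Ck (n' - l) (\<lambda>z. (dir_deriv (1, u k) ^^ l) g (fst z, snd z + fst z *\<^sub>R u k))"
        by (rule Ck_compose_linear[OF _ CkD[OF that]])
          (intro bounded_linear_Pair bounded_linear_add bounded_linear_fst bounded_linear_snd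
            bounded_linear_scaleR_const)
      then show ?thesis by (simp add: P_def[abs_def])
    qed
    have CkQ: "Ck (n' - l) (Q l)" if "l \<le> n'" for l
    proof -
      have "Ck (n' - l) (\<lambda>z. (dir_deriv (1, u k) ^^ l) g (0, snd z))"
        by (rule Ck_compose_linear[OF _ CkD[OF that]])
          (intro bounded_linear_Pair bounded_linear_zero bounded_linear_snd)
      then show ?thesis by (simp add: Q_def[abs_def])
    qed
    have "\<forall>l. \<exists>C. l \<le> n' \<longrightarrow> 0 \<le> C \<and>
        (\<forall>\<theta>. generic_shift k \<theta> \<longrightarrow> has_expansion (n' - l) C (\<lambda>h. nested_sum h \<theta> u k (P l) (1, x)))"
      using Suc.IH[OF CkP] by blast
    from choice[OF this] obtain CP where CP: "\<And>l. l \<le> n' \<Longrightarrow> 0 \<le> CP l"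
      "\<And>l \<theta>. l \<le> n' \<Longrightarrow> generic_shift k \<theta> \<Longrightarrow> has_expansion (n' - l) (CP l) (\<lambda>h. nested_sum h \<theta> u k (P l) (1, x))"
      by blast
    have "\<forall>l. \<exists>C. l \<le> n' \<longrightarrow> 0 \<le> C \<and>
        (\<forall>\<theta>. generic_shift k \<theta> \<longrightarrow> has_expansion (n' - l) C (\<lambda>h. nested_sum h \<theta> u k (Q l) (1, x)))"
      using Suc.IH[OF CkQ] by blast
    from choice[OF this] obtain CQ where CQ: "\<And>l. l \<le> n' \<Longrightarrow> 0 \<le> CQ l"
      "\<And>l \<theta>. l \<le> n' \<Longrightarrow> generic_shift k \<theta> \<Longrightarrow> has_expansion (n' - l) (CQ l) (\<lambda>h. nested_sum h \<theta> u k (Q l) (1, x))"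
      by blast
    have "\<forall>l. \<exists>M\<ge>0. \<forall>x. \<bar>periodic_bernoulli l x\<bar> \<le> M" using periodic_bernoulli_bounded by blast
    from choice[OF this] obtain M where M: "\<And>l. 0 \<le> M l" "\<And>l x. \<bar>periodic_bernoulli l x\<bar> \<le> M l" by blast
    define C where "C = (CI + (\<Sum>l\<le>n'. M l * CP l + M l * CQ l)) + 2 ^ k * C1"
    have "has_expansion n C (\<lambda>h. nested_sum h \<theta> u (Suc k) g (1, x))" if th: "generic_shift (Suc k) \<theta>" for \<theta>
    proof -
      have thk: "generic_shift k \<theta>" using th by (simp add: generic_shift_def)
      \<comment> \<open>The signs of \<open>(-h)\<^sup>l\<^sup>+\<^sup>1\<close> are absorbed into the coefficients, so that plain powers of \<open>h\<close> remain.\<close>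
      define p where "p l = (-1) ^ Suc l * periodic_bernoulli l (prev_shift \<theta> k - \<theta> k)" for l
      define q where "q l = (-1) ^ l * periodic_bernoulli l (- \<theta> k)" for l
      have E: "E h \<theta> z = segment_integral (u k) g z +
          (\<Sum>l\<le>n'. (h ^ Suc l * p l) *\<^sub>R P l z + (h ^ Suc l * q l) *\<^sub>R Q l z)" for h z
        unfolding E_def p_def q_def
        by (intro arg_cong2[of _ _ _ _ "(+)"] refl sum.cong)
          (simp add: power_minus[of h] scaleR_right_diff_distrib mult_ac)
      have "nested_sum h \<theta> u k (E h \<theta>) (1, x) = nested_sum h \<theta> u k (segment_integral (u k) g) (1, x) +
          (\<Sum>l\<le>n'. (h ^ Suc l * p l) *\<^sub>R nested_sum h \<theta> u k (P l) (1, x)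
                 + (h ^ Suc l * q l) *\<^sub>R nested_sum h \<theta> u k (Q l) (1, x))" for h
        unfolding E[abs_def] nested_sum_add nested_sum_sum[OF finite_atMost] nested_sum_scaleR ..
      moreover have "has_expansion n (CI + (\<Sum>l\<le>n'. M l * CP l + M l * CQ l))
         (\<lambda>h. nested_sum h \<theta> u k (segment_integral (u k) g) (1, x) +
          (\<Sum>l\<le>n'. (h ^ Suc l * p l) *\<^sub>R nested_sum h \<theta> u k (P l) (1, x)
                 + (h ^ Suc l * q l) *\<^sub>R nested_sum h \<theta> u k (Q l) (1, x)))"
      proof (intro has_expansion_add[OF CI(2)[OF thk]] has_expansion_sum has_expansion_add finite_atMost)
        fix l assume "l \<in> {..n'}"
        then have l: "l \<le> n'" "n = (n' - l) + Suc l" using n by auto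
        have pq: "\<bar>p l\<bar> \<le> M l" "\<bar>q l\<bar> \<le> M l"
          using M(2) by (simp_all add: p_def q_def abs_mult power_abs)
        show "has_expansion n (M l * CP l) (\<lambda>h. (h ^ Suc l * p l) *\<^sub>R nested_sum h \<theta> u k (P l) (1, x))"
          unfolding l(2) by (rule has_expansion_power_mult[OF CP(2)[OF l(1) thk] pq(1) CP(1)[OF l(1)]])
        show "has_expansion n (M l * CQ l) (\<lambda>h. (h ^ Suc l * q l) *\<^sub>R nested_sum h \<theta> u k (Q l) (1, x))"
          unfolding l(2) by (rule has_expansion_power_mult[OF CQ(2)[OF l(1) thk] pq(2) CQ(1)[OF l(1)]])
      qed
      ultimately have 1: "has_expansion n (CI + (\<Sum>l\<le>n'. M l * CP l + M l * CQ l))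
         (\<lambda>h. nested_sum h \<theta> u k (E h \<theta>) (1, x))" by simp
      show ?thesis
        unfolding C_def
      proof (rule has_expansion_perturb[OF 1])
        fix h assume h: "h \<in> recip_ints"
        have "norm (nested_sum h \<theta> u k (\<lambda>z. shifted_sum h (\<theta> k) (u k) g z - E h \<theta> z) (1, x))
            \<le> 2 ^ k * (C1 * \<bar>h\<bar> ^ n)"
          by (rule nested_sum_bound[OF h thk]) (use C1[OF h th] C10 in \<open>auto simp: R_def intro!: mult_nonneg_nonneg\<close>)
        then show "norm (nested_sum h \<theta> u (Suc k) g (1, x) - nested_sum h \<theta> u k (E h \<theta>) (1, x))
            \<le> 2 ^ k * C1 * \<bar>h\<bar> ^ n"
          by (simp add: nested_sum_diff mult.assoc)
      qed
    qed
    moreover have "C \<ge> 0"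
      unfolding C_def using CI(1) C10 by (intro add_nonneg_nonneg sum_nonneg mult_nonneg_nonneg M CP CQ) auto
    ultimately show ?thesis by blast
  qed
qed

section \<open>Lattice sums over a simplex as nested sums\<close>

text \<open>The upper end point of the summation following the first \<open>k\<close> ones.\<close>

definition last_coord :: "real \<Rightarrow> (nat \<Rightarrow> real) \<Rightarrow> nat \<Rightarrow> (nat \<Rightarrow> int) \<Rightarrow> real" where
  "last_coord h \<theta> k m = (if k = 0 then 1 else h * (of_int (m (k - 1)) + \<theta> (k - 1)))"

definition nested_pts :: "real \<Rightarrow> (nat \<Rightarrow> real) \<Rightarrow> nat \<Rightarrow> (nat \<Rightarrow> int) set" where
  "nested_pts h \<theta> k = {m \<in> extensional {..<k}. \<forall>i<k. m i \<in> lattice_pts h (\<theta> i) (last_coord h \<theta> i m)}"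

lemma finite_lattice_pts:
  assumes "h \<noteq> 0"
  shows "finite (lattice_pts h \<theta> s)"
proof -
  define B where "B = \<lceil>\<bar>s\<bar>/\<bar>h\<bar> + \<bar>\<theta>\<bar>\<rceil>"
  have "lattice_pts h \<theta> s \<subseteq> {-B..B}"
  proof
    fix m assume "m \<in> lattice_pts h \<theta> s"
    then have "\<bar>h\<bar> * \<bar>of_int m + \<theta>\<bar> \<le> \<bar>s\<bar>" by (auto simp: lattice_pts_def simp flip: abs_mult)
    then have "\<bar>of_int m + \<theta>\<bar> \<le> \<bar>s\<bar>/\<bar>h\<bar>" using assms by (simp add: field_simps)
    then have "\<bar>of_int m\<bar> \<le> (of_int B :: real)" unfolding B_def by linarith
    then show "m \<in> {-B..B}" by (simp flip: of_int_abs) linarith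
  qed
  then show ?thesis by (rule finite_subset) simp
qed

lemma bij_betw_nested_pts_Suc:
  "bij_betw (\<lambda>(m, j). m(k := j)) (SIGMA m:nested_pts h \<theta> k. lattice_pts h (\<theta> k) (last_coord h \<theta> k m)) (nested_pts h \<theta> (Suc k))"
proof (rule bij_betw_byWitness[where f'="\<lambda>m. (restrict m {..<k}, m k)"])
  have lc: "last_coord h \<theta> i (m(k := j)) = last_coord h \<theta> i m"
    "last_coord h \<theta> i (restrict m {..<k}) = last_coord h \<theta> i m" if "i \<le> k" for i m j
    using that by (auto simp: last_coord_def)
  show "\<forall>a\<in>SIGMA m:nested_pts h \<theta> k. lattice_pts h (\<theta> k) (last_coord h \<theta> k m).
      (\<lambda>m. (restrict m {..<k}, m k)) ((\<lambda>(m, j). m(k := j)) a) = a"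
    by (auto simp: nested_pts_def fun_eq_iff restrict_def extensional_def)
  show "\<forall>m\<in>nested_pts h \<theta> (Suc k). (\<lambda>(m, j). m(k := j)) (restrict m {..<k}, m k) = m"
    by (auto simp: nested_pts_def fun_eq_iff restrict_def extensional_def less_Suc_eq)
  show "(\<lambda>(m, j). m(k := j)) ` (SIGMA m:nested_pts h \<theta> k. lattice_pts h (\<theta> k) (last_coord h \<theta> k m)) \<subseteq> nested_pts h \<theta> (Suc k)"
    by (auto simp: nested_pts_def lc less_Suc_eq extensional_def)
  show "(\<lambda>m. (restrict m {..<k}, m k)) ` nested_pts h \<theta> (Suc k) \<subseteq> (SIGMA m:nested_pts h \<theta> k. lattice_pts h (\<theta> k) (last_coord h \<theta> k m))"
    by (auto simp: nested_pts_def lc)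
qed

lemma finite_nested_pts: "h \<noteq> 0 \<Longrightarrow> finite (nested_pts h \<theta> k)"
proof (induction k)
  case 0
  then show ?case by (simp add: nested_pts_def)
next
  case (Suc k)
  then show ?case
    using bij_betw_finite[OF bij_betw_nested_pts_Suc[of k h \<theta>]] finite_lattice_pts[OF Suc.prems]
    by (auto intro!: finite_SigmaI)
qed

lemma nested_sum_eq_sum_nested_pts:
  assumes h: "h \<noteq> 0"
  shows "nested_sum h \<theta> u k g (1, x) = (\<Sum>m\<in>nested_pts h \<theta> k. \<bar>h\<bar> ^ k *\<^sub>R
    g (last_coord h \<theta> k m, x + (\<Sum>i<k. (h * (of_int (m i) + \<theta> i)) *\<^sub>R u i)))"
proof (induction k arbitrary: g)
  case 0
  have "nested_pts h \<theta> 0 = {\<lambda>_. undefined}" by (auto simp: nested_pts_def)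
  then show ?case by (simp add: last_coord_def)
next
  case (Suc k)
  let ?p = "\<lambda>k m. x + (\<Sum>i<k. (h * (of_int (m i) + \<theta> i)) *\<^sub>R u i)"
  let ?L = "\<lambda>m. lattice_pts h (\<theta> k) (last_coord h \<theta> k m)"
  let ?F = "\<lambda>m. \<bar>h\<bar> ^ Suc k *\<^sub>R g (last_coord h \<theta> (Suc k) m, ?p (Suc k) m)"
  have p: "?p k (m(k := j)) = ?p k m" for m j
    by (intro arg_cong2[of _ _ _ _ "(+)"] refl sum.cong) auto
  have "nested_sum h \<theta> u (Suc k) g (1, x) = (\<Sum>m\<in>nested_pts h \<theta> k. \<Sum>j\<in>?L m. ?F (m(k := j)))"
    by (simp add: Suc.IH shifted_sum_def scaleR_sum_right last_coord_def p[unfolded fun_upd_def] fun_upd_def add.assoc mult.commute)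
  also have "\<dots> = (\<Sum>(m, j)\<in>(SIGMA m:nested_pts h \<theta> k. ?L m). ?F (m(k := j)))"
    by (rule sum.Sigma) (auto intro: finite_nested_pts[OF h] finite_lattice_pts[OF h])
  also have "\<dots> = (\<Sum>m\<in>nested_pts h \<theta> (Suc k). ?F m)"
    using sum.reindex_bij_betw[OF bij_betw_nested_pts_Suc[of k h \<theta>], of ?F] by (simp add: case_prod_beta)
  finally show ?case .
qed

lemma mem_nested_pts_iff:
  "m \<in> nested_pts h \<theta> k \<longleftrightarrow> m \<in> extensional {..<k} \<and> (\<forall>i<k. 0 < h * (of_int (m i) + \<theta> i) \<and>
     h * (of_int (m i) + \<theta> i) < (if i = 0 then 1 else h * (of_int (m (i - 1)) + \<theta> (i - 1))))"
  by (auto simp: nested_pts_def lattice_pts_def last_coord_def)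

lemma sum_by_parts_vec:
  fixes v :: "nat \<Rightarrow> 'a::real_vector"
  shows "(\<Sum>j\<le>d. (s j - s (Suc j)) *\<^sub>R v j)
    = s 0 *\<^sub>R v 0 + (\<Sum>i<d. s (Suc i) *\<^sub>R (v (Suc i) - v i)) - s (Suc d) *\<^sub>R v d"
  by (induction d) (simp_all add: scaleR_left_diff_distrib scaleR_right_diff_distrib)

text \<open>By summation by parts a relation between the increments \<open>v (Suc i) - v i\<close> is a relation between the \<open>v j\<close>, with
  coefficients that add up to zero; affine independence makes the coefficients \<open>a i\<close> constant in \<open>i\<close>, with end value \<open>0\<close>.\<close>

lemma affine_independent_increments:
  fixes v :: "nat \<Rightarrow> 'a::real_vector"
  assumes C: "\<not> affine_dependent C" and v: "bij_betw v {..d} C"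
    and z: "(\<Sum>i<d. a i *\<^sub>R (v (Suc i) - v i)) = 0" and i: "i < d"
  shows "a i = 0"
proof -
  have finC: "finite C" using bij_betw_finite[OF v] by simp
  define s where "s j = (if j = 0 \<or> j > d then 0 else a (j - 1))" for j
  define U where "U = (\<lambda>j. s j - s (Suc j)) \<circ> the_inv_into {..d} v"
  have U: "U (v j) = s j - s (Suc j)" if "j \<le> d" for j
    using that v by (simp add: U_def the_inv_into_f_f bij_betw_def)
  have "sum U C = (\<Sum>j\<le>d. s j - s (Suc j))"
    using sum.reindex_bij_betw[OF v, of U] U by simp
  also have "\<dots> = 0" unfolding sum_telescope by (simp add: s_def)
  finally have 1: "sum U C = 0" .
  have "(\<Sum>x\<in>C. U x *\<^sub>R x) = (\<Sum>j\<le>d. (s j - s (Suc j)) *\<^sub>R v j)"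
    using sum.reindex_bij_betw[OF v, of "\<lambda>x. U x *\<^sub>R x"] U by simp
  also have "\<dots> = (\<Sum>i<d. a i *\<^sub>R (v (Suc i) - v i))"
    unfolding sum_by_parts_vec by (simp add: s_def)
  finally have 2: "(\<Sum>x\<in>C. U x *\<^sub>R x) = 0" using z by simp
  have "\<forall>x\<in>C. U x = 0"
    using C 1 2 unfolding affine_dependent_explicit_finite[OF finC] by blast
  then have st: "s j = s (Suc j)" if "j \<le> d" for j
    using U[OF that] v that by (auto simp: bij_betw_def)
  have "s j = 0" if "j \<le> d" for j using that
    by (induction j) (auto simp: s_def[of 0] dest: st[OF Suc_leD])
  from this[of "Suc i"] show ?thesis using i by (simp add: s_def)
qed

lemma simplex_increment_basis:
  fixes v :: "nat \<Rightarrow> 'a::euclidean_space"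
  assumes C: "\<not> affine_dependent C" and v: "bij_betw v {..d} C" and d: "d = DIM('a)"
  obtains c :: "nat \<Rightarrow> 'a \<Rightarrow> real"
  where "\<And>i. linear (c i)" "\<And>y. y = (\<Sum>i<d. c i y *\<^sub>R (v (Suc i) - v i))"
    "\<And>a i. i < d \<Longrightarrow> c i (\<Sum>j<d. a j *\<^sub>R (v (Suc j) - v j)) = a i"
proof -
  let ?u = "\<lambda>i. v (Suc i) - v i"
  note ind = affine_independent_increments[OF C v]
  have inj: "inj_on ?u {..<d}"
  proof (rule inj_onI, rule ccontr)
    fix i j assume ij: "i \<in> {..<d}" "j \<in> {..<d}" "?u i = ?u j" "i \<noteq> j"
    have "(\<Sum>k<d. (if k = i then 1 else if k = j then -1 else 0 :: real) *\<^sub>R ?u k)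
        = (\<Sum>k\<in>{i,j}. (if k = i then 1 else if k = j then -1 else 0 :: real) *\<^sub>R ?u k)"
      by (rule sum.mono_neutral_right) (use ij in auto)
    also have "\<dots> = 0" using ij by simp
    finally have "(\<lambda>k. if k = i then 1 else if k = j then -1 else 0 :: real) i = 0"
      by (rule ind) (use ij in auto)
    then show False by simp
  qed
  define S where "S = ?u ` {..<d}"
  have cS: "card S = d" unfolding S_def using card_image[OF inj] by simp
  have iS: "independent S"
  proof -
    have "\<not> dependent S"
    proof
      assume "dependent S"
      then obtain U where U: "\<exists>x\<in>S. U x \<noteq> 0" "(\<Sum>x\<in>S. U x *\<^sub>R x) = 0"
        using dependent_finite[of S] by (auto simp: S_def)
      have "(\<Sum>i<d. U (?u i) *\<^sub>R ?u i) = 0"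
        using U(2) unfolding S_def by (subst (asm) sum.reindex[OF inj]) simp
      from ind[OF this] U(1) show False by (auto simp: S_def)
    qed
    then show ?thesis .
  qed
  have spS: "span S = UNIV"
    using card_eq_dim[of S UNIV] iS cS d by (auto simp: dim_UNIV S_def)
  have "\<exists>g. linear g \<and> (\<forall>x\<in>S. g x = (if x = ?u i then 1 else 0 :: real))" for i
    using linear_independent_extend[OF iS, of "\<lambda>x. if x = ?u i then 1 else 0"] .
  then obtain c where c: "\<And>i. linear (c i)" "\<And>i x. x \<in> S \<Longrightarrow> c i x = (if x = ?u i then 1 else 0 :: real)"
    by metis
  have comb: "c i (\<Sum>j<d. a j *\<^sub>R ?u j) = a i" if "i < d" for a i
  proof -
    have "c i (\<Sum>j<d. a j *\<^sub>R ?u j) = (\<Sum>j<d. a j * c i (?u j))"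
      by (simp add: linear_sum[OF c(1)] linear_scale[OF c(1)])
    also have "\<dots> = (\<Sum>j<d. if j = i then a i else 0)"
      by (rule sum.cong) (use that inj c(2) in \<open>auto simp: S_def inj_on_def\<close>)
    finally show ?thesis using that by simp
  qed
  have rep: "y = (\<Sum>i<d. c i y *\<^sub>R ?u i)" for y
  proof -
    have "y \<in> span S" using spS by simp
    then obtain U where "y = (\<Sum>x\<in>S. U x *\<^sub>R x)" by (auto simp: S_def span_finite)
    also have "\<dots> = (\<Sum>i<d. U (?u i) *\<^sub>R ?u i)" unfolding S_def by (subst sum.reindex[OF inj]) simp
    finally have y: "y = (\<Sum>i<d. U (?u i) *\<^sub>R ?u i)" .
    have "c i y = U (?u i)" if "i < d" for i
      by (subst y, subst comb[OF that], rule refl)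
    then have "(\<Sum>i<d. c i y *\<^sub>R ?u i) = (\<Sum>i<d. U (?u i) *\<^sub>R ?u i)" by simp
    then show ?thesis using y by simp
  qed
  show thesis by (rule that[OF c(1) rep comb])
qed

text \<open>In the coordinates \<open>s (Suc i)\<close> along the increments, the barycentric coordinates of \<open>x\<close> are the differences
  \<open>s j - s (Suc j)\<close>, where \<open>s 0 = 1\<close> and \<open>s (Suc d) = 0\<close>.\<close>

lemma mem_simplex_iff:
  fixes v :: "nat \<Rightarrow> 'a::euclidean_space"
  assumes C: "\<not> affine_dependent C" and v: "bij_betw v {..d} C" and d: "d = DIM('a)"
    and s: "s 0 = 1" "s (Suc d) = 0"
    and x: "x = v 0 + (\<Sum>i<d. s (Suc i) *\<^sub>R (v (Suc i) - v i))"
  shows "x \<in> convex hull C \<longleftrightarrow> (\<forall>j\<le>d. s (Suc j) \<le> s j)"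
    and "(\<And>j. j \<le> d \<Longrightarrow> s (Suc j) < s j) \<Longrightarrow> x \<in> interior (convex hull C)"
proof -
  have finC: "finite C" using bij_betw_finite[OF v] by simp
  have inv: "the_inv_into {..d} v (v j) = j" if "j \<le> d" for j
    using that v by (simp add: the_inv_into_f_f bij_betw_def)
  have Cv: "C = v ` {..d}" using v by (simp add: bij_betw_def)
  define U where "U = (\<lambda>j. s j - s (Suc j)) \<circ> the_inv_into {..d} v"
  have U: "U (v j) = s j - s (Suc j)" if "j \<le> d" for j by (simp add: U_def inv that)
  have U1: "sum U C = 1"
  proof -
    have "sum U C = (\<Sum>j\<le>d. s j - s (Suc j))" using sum.reindex_bij_betw[OF v, of U] U by simp
    then show ?thesis unfolding sum_telescope using s by simp
  qed
  have Ux: "(\<Sum>y\<in>C. U y *\<^sub>R y) = x"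
  proof -
    have "(\<Sum>y\<in>C. U y *\<^sub>R y) = (\<Sum>j\<le>d. (s j - s (Suc j)) *\<^sub>R v j)"
      using sum.reindex_bij_betw[OF v, of "\<lambda>x. U x *\<^sub>R x"] U by simp
    then show ?thesis unfolding sum_by_parts_vec using s x by simp
  qed
  show "x \<in> convex hull C \<longleftrightarrow> (\<forall>j\<le>d. s (Suc j) \<le> s j)"
  proof
    assume "\<forall>j\<le>d. s (Suc j) \<le> s j"
    then have "\<forall>y\<in>C. 0 \<le> U y" by (auto simp: Cv U)
    then show "x \<in> convex hull C" using U1 Ux unfolding convex_hull_finite[OF finC] by blast
  next
    assume "x \<in> convex hull C"
    then obtain W where W: "\<forall>y\<in>C. 0 \<le> W y" "sum W C = 1" "(\<Sum>y\<in>C. W y *\<^sub>R y) = x"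
      unfolding convex_hull_finite[OF finC] by blast
    have "\<forall>y\<in>C. W y - U y = 0"
    proof -
      have "sum (\<lambda>y. W y - U y) C = 0" "(\<Sum>y\<in>C. (W y - U y) *\<^sub>R y) = 0"
        using W U1 Ux by (simp_all add: sum_subtractf scaleR_left_diff_distrib)
      then show ?thesis using C unfolding affine_dependent_explicit_finite[OF finC] by blast
    qed
    then have "\<forall>y\<in>C. 0 \<le> U y" using W(1) by simp
    then show "\<forall>j\<le>d. s (Suc j) \<le> s j" by (auto simp: Cv U)
  qed
  assume "\<And>j. j \<le> d \<Longrightarrow> s (Suc j) < s j"
  then have "\<forall>y\<in>C. 0 < U y" by (auto simp: Cv U)
  moreover have "\<not> card C \<le> DIM('a)" using bij_betw_same_card[OF v] d by simp
  ultimately show "x \<in> interior (convex hull C)"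
    unfolding interior_convex_hull_explicit_minimal[OF C] using U1 Ux by auto
qed

lemma int_lattice_add: "x \<in> int_lattice \<Longrightarrow> y \<in> int_lattice \<Longrightarrow> x + y \<in> int_lattice"
  and int_lattice_diff: "x \<in> int_lattice \<Longrightarrow> y \<in> int_lattice \<Longrightarrow> x - y \<in> int_lattice"
  and int_lattice_scaleR: "r \<in> \<int> \<Longrightarrow> x \<in> int_lattice \<Longrightarrow> r *\<^sub>R x \<in> int_lattice"
  by (auto simp: int_lattice_def)

lemma int_lattice_sum: "(\<And>i. i \<in> A \<Longrightarrow> f i \<in> int_lattice) \<Longrightarrow> sum f A \<in> int_lattice"
  by (auto simp: int_lattice_def intro: Ints_sum)

lemma int_lattice_eq_range:
  "(int_lattice :: (real^'n) set) = range (\<lambda>f. \<chi> i. of_int (f i))"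
proof -
  have "x \<in> range (\<lambda>f. \<chi> i. of_int (f i))" if "x \<in> int_lattice" for x :: "real^'n"
  proof (rule range_eqI)
    show "x = (\<chi> i. of_int \<lfloor>x $ i\<rfloor>)"
      using that by (auto simp: int_lattice_def vec_eq_iff of_int_floor)
  qed
  then show ?thesis by (auto simp: int_lattice_def)
qed

lemma countable_int_lattice: "countable (int_lattice :: (real^'n) set)"
  unfolding int_lattice_eq_range by simp

lemma finite_bounded_int_lattice:
  assumes "bounded B"
  shows "finite (int_lattice \<inter> B :: (real^'n) set)"
proof -
  obtain r where r: "\<And>x. x \<in> B \<Longrightarrow> norm x \<le> r" using assms by (auto simp: bounded_iff)
  let ?F = "PiE (UNIV :: 'n set) (\<lambda>_. {-\<lceil>r\<rceil>..\<lceil>r\<rceil>})"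
  have "int_lattice \<inter> B \<subseteq> (\<lambda>f. \<chi> i. of_int (f i)) ` ?F"
  proof
    fix x assume x: "x \<in> int_lattice \<inter> B"
    then obtain f where f: "x = (\<chi> i. of_int (f i))" unfolding int_lattice_eq_range by auto
    have "f i \<in> {-\<lceil>r\<rceil>..\<lceil>r\<rceil>}" for i
    proof -
      have "\<bar>of_int (f i)\<bar> \<le> r"
        using component_le_norm_cart[of x i] r[of x] x f by auto
      then show ?thesis by (simp add: abs_le_iff) linarith
    qed
    then have "f \<in> ?F" by auto
    then show "x \<in> (\<lambda>f. \<chi> i. of_int (f i)) ` ?F" using f by blast
  qed
  then show ?thesis by (rule finite_subset) (intro finite_imageI finite_PiE, auto)
qed

lemma negligible_linear_level:
  fixes \<phi> :: "'a::euclidean_space \<Rightarrow> real"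
  assumes "linear \<phi>" "\<phi> w \<noteq> 0"
  shows "negligible {y. \<phi> y = b}"
proof -
  have "\<phi> y = adjoint \<phi> 1 \<bullet> y" for y
    using adjoint_works[OF assms(1), of y 1] by (simp add: inner_commute)
  moreover have "adjoint \<phi> 1 \<noteq> 0" using calculation[of w] assms(2) by auto
  ultimately show ?thesis using negligible_hyperplane[of "adjoint \<phi> 1" b] by simp
qed

text \<open>For a generic shift no coordinate inequality can be an equality: an equality would put some \<open>a i\<close> or
  \<open>a i - a (i - 1)\<close> into the integers. Hence points of the shifted lattice in a simplex lie in its interior.\<close>

lemma generic_point_in_simplex:
  fixes v :: "nat \<Rightarrow> 'a::euclidean_space"
  assumes C: "\<not> affine_dependent C" and v: "bij_betw v {..d} C" and d: "d = DIM('a)"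
    and h: "h \<in> recip_ints" and gen: "generic_shift d a"
    and x: "x = v 0 + (\<Sum>i<d. (h * a i) *\<^sub>R (v (Suc i) - v i))"
  shows "x \<in> convex hull C \<longleftrightarrow> (\<forall>i<d. 0 < h * a i \<and> h * a i < (if i = 0 then 1 else h * a (i - 1)))"
    and "x \<in> convex hull C \<Longrightarrow> x \<in> interior (convex hull C)"
proof -
  have d0: "0 < d" using d by simp
  have h0: "h \<noteq> 0" "1/h \<in> \<int>" using h by (auto simp: recip_ints_def)
  define s where "s j = (if j = 0 then 1 else if j \<le> d then h * a (j - 1) else 0)" for j
  have s0: "s 0 = 1" "s (Suc d) = 0" by (auto simp: s_def)
  have xs: "x = v 0 + (\<Sum>i<d. s (Suc i) *\<^sub>R (v (Suc i) - v i))"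
    unfolding x by (simp add: s_def)
  note mem = mem_simplex_iff[OF C v d s0 xs]
  let ?chain = "\<forall>i<d. 0 < h * a i \<and> h * a i < (if i = 0 then 1 else h * a (i - 1))"
  have strict: "s (Suc j) < s j" if ?chain "j \<le> d" for j
  proof (cases "j = d")
    case True
    then show ?thesis using that d0 by (auto simp: s_def)
  next
    case False
    then have "j < d" using that by simp
    with that(1) have "h * a j < (if j = 0 then 1 else h * a (j - 1))" by blast
    then show ?thesis using \<open>j < d\<close> by (auto simp: s_def split: if_splits)
  qed
  have chain: ?chain if "\<forall>j\<le>d. s (Suc j) \<le> s j"
  proof (intro allI impI)
    fix i assume i: "i < d"
    have "s (Suc d) \<le> s j" if "j \<le> Suc d" for j
      using that
    proof (induction rule: inc_induct)
      case (step k)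
      then have "s (Suc k) \<le> s k" using \<open>\<forall>j\<le>d. s (Suc j) \<le> s j\<close> by simp
      then show ?case using step.IH by linarith
    qed simp
    from this[of "Suc i"] i have "s (Suc d) \<le> s (Suc i)" by simp
    then have "0 \<le> h * a i" using i by (simp add: s_def)
    moreover have "a i \<notin> \<int>" "a i - prev_shift a i \<notin> \<int>" using gen i by (auto simp: generic_shift_def)
    then have "h * a i \<noteq> 0" using h0 by auto
    ultimately have 1: "0 < h * a i" by linarith
    have "h * a i \<le> (if i = 0 then 1 else h * a (i - 1))"
      using that[rule_format, of i] i by (auto simp: s_def)
    moreover have "h * a i \<noteq> (if i = 0 then 1 else h * a (i - 1))"
    proof
      assume eq: "h * a i = (if i = 0 then 1 else h * a (i - 1))"
      have "a i - prev_shift a i \<in> \<int>"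
      proof (cases "i = 0")
        case True
        then have "a i = 1/h" using eq h0 by (simp add: field_simps)
        then show ?thesis using True h0 by (simp add: prev_shift_def)
      next
        case False
        then show ?thesis using eq h0 by (simp add: prev_shift_def)
      qed
      then show False using \<open>a i - prev_shift a i \<notin> \<int>\<close> by simp
    qed
    ultimately show "0 < h * a i \<and> h * a i < (if i = 0 then 1 else h * a (i - 1))"
      using 1 by linarith
  qed
  show iff: "x \<in> convex hull C \<longleftrightarrow> ?chain"
    using mem(1) chain strict by (metis less_imp_le)
  show "x \<in> interior (convex hull C)" if "x \<in> convex hull C"
    using that iff strict by (intro mem(2)) auto
qed

text \<open>For negative \<open>h\<close> the shifted lattice is reflected in the origin as well as scaled.\<close>

definition shifted_lattice_sum :: "(real^'n) set \<Rightarrow> (real^'n \<Rightarrow> 'b::real_normed_vector) \<Rightarrow> real \<Rightarrow> real^'n \<Rightarrow> 'b" where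
  "shifted_lattice_sum P f h y =
    (\<Sum>m | m \<in> int_lattice \<and> h *\<^sub>R (m - y) \<in> P. \<bar>h\<bar> ^ CARD('n) *\<^sub>R f (h *\<^sub>R (m - y)))"

text \<open>The increments \<open>u i\<close> of the vertices span a sublattice of \<open>\<int>\<^sup>d\<close>. The set \<open>R\<close> of integer points in its fundamental
  parallelepiped represents the cosets, and over each coset the lattice sum is a nested sum with shift
  \<open>c i (r - y)\<close>. The vertex \<open>v 0\<close> being an integer point, it can be moved to the origin by a translation by \<open>(1/h) v 0\<close>,
  which preserves \<open>\<int>\<^sup>d\<close>. The null set \<open>N\<close> consists of the \<open>y\<close> for which some coordinate \<open>c i (m - y)\<close>, or difference
  of consecutive coordinates, is an integer.\<close>

theorem simplex_sum_has_expansion: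
  fixes C :: "(real^'n) set" and f :: "real^'n \<Rightarrow> 'b::euclidean_space"
  assumes C: "\<not> affine_dependent C" and card: "card C = Suc CARD('n)" and int: "C \<subseteq> int_lattice"
    and f: "Ck n f"
  shows "\<exists>K N. negligible N \<and> (\<forall>y. y \<notin> N \<longrightarrow>
    (\<forall>h\<in>recip_ints. \<forall>m\<in>int_lattice. h *\<^sub>R (m - y) \<in> convex hull C \<longrightarrow> h *\<^sub>R (m - y) \<in> interior (convex hull C)) \<and>
    has_expansion n K (\<lambda>h. shifted_lattice_sum (convex hull C) f h y))"
proof -
  define d where "d = CARD('n)"
  have d: "d = DIM(real^'n)" by (simp add: d_def)
  have "finite C" using C aff_independent_finite by blast
  then obtain v where "bij_betw v {0..<card C} C" using ex_bij_betw_nat_finite by blast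
  then have v: "bij_betw v {..d} C"
    by (simp add: card d_def atLeast0LessThan lessThan_Suc_atMost)
  define u where "u i = v (Suc i) - v i" for i
  obtain c :: "nat \<Rightarrow> real^'n \<Rightarrow> real" where lin: "\<And>i. linear (c i)"
    and rep: "\<And>y. y = (\<Sum>i<d. c i y *\<^sub>R u i)"
    and comb: "\<And>a i. i < d \<Longrightarrow> c i (\<Sum>j<d. a j *\<^sub>R u j) = a i"
    using simplex_increment_basis[OF C v d] unfolding u_def by blast
  have vint: "v i \<in> int_lattice" if "i \<le> d" for i
    using that v int by (auto simp: bij_betw_def)
  have uint: "u i \<in> int_lattice" if "i < d" for i
    unfolding u_def by (intro int_lattice_diff vint) (use that in auto)
  have cu: "c i (u j) = (if i = j then 1 else 0)" if "i < d" "j < d" for i j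
  proof -
    have "u j = (\<Sum>k<d. (if k = j then 1 else 0) *\<^sub>R u k)"
      using that by (simp add: if_distrib[of "\<lambda>r. r *\<^sub>R _"] cong: if_cong)
    then show ?thesis using comb[of i "\<lambda>k. if k = j then 1 else 0"] that by simp
  qed
  define pc where "pc i = (if i = 0 then (\<lambda>_. 0) else c (i - 1))" for i
  have pclin: "linear (\<lambda>y. c i y - pc i y)" for i
    unfolding pc_def by (cases "i = 0") (auto intro!: linear_compose_sub lin)
  define N where "N = (\<Union>m\<in>int_lattice. \<Union>i\<in>{..<d}. \<Union>k::int.
    {y. c i y = c i m - of_int k} \<union> {y. c i y - pc i y = c i m - pc i m - of_int k})"
  have negN: "negligible N"
  proof -
    have "negligible (\<Union>k::int. {y. c i y = c i m - of_int k} \<union> {y. c i y - pc i y = c i m - pc i m - of_int k})"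
      if "i < d" for i m
    proof (rule negligible_countable_Union)
      fix S assume "S \<in> range (\<lambda>k::int. {y. c i y = c i m - of_int k} \<union> {y. c i y - pc i y = c i m - pc i m - of_int k})"
      moreover have "c i (u i) \<noteq> 0" "c i (u i) - pc i (u i) \<noteq> 0"
        using that by (auto simp: cu pc_def)
      then have "negligible {y. c i y = b}" "negligible {y. c i y - pc i y = b}" for b
        using negligible_linear_level[OF lin] negligible_linear_level[OF pclin] by blast+
      ultimately show "negligible S" by auto
    qed simp
    then have "negligible (\<Union>i\<in>{..<d}. \<Union>k::int. {y. c i y = c i m - of_int k} \<union> {y. c i y - pc i y = c i m - pc i m - of_int k})" for m
      by (intro negligible_countable_Union) auto
    then show ?thesis
      unfolding N_def by (intro negligible_countable_Union) (auto simp: countable_int_lattice)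
  qed
  have gen: "generic_shift d (\<lambda>i. c i (m - y))" if y: "y \<notin> N" and m: "m \<in> int_lattice" for y m
    unfolding generic_shift_def
  proof (intro allI impI conjI notI)
    fix i assume i: "i < d"
    note inN = y[unfolded N_def, simplified, rule_format, OF m, of i]
    {
      assume "c i (m - y) \<in> \<int>"
      then obtain k where "c i (m - y) = of_int k" by (auto elim: Ints_cases)
      then have "c i y = c i m - of_int k" by (simp add: linear_diff[OF lin])
      then show False using inN i by simp
    }
    {
      assume "c i (m - y) - prev_shift (\<lambda>i. c i (m - y)) i \<in> \<int>"
      moreover have "prev_shift (\<lambda>i. c i (m - y)) i = pc i m - pc i y"
        by (simp add: prev_shift_def pc_def linear_diff[OF lin])
      ultimately obtain k where "c i (m - y) - (pc i m - pc i y) = of_int k" by (auto elim: Ints_cases)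
      then have "c i y - pc i y = c i m - pc i m - of_int k" by (simp add: linear_diff[OF lin])
      then show False using inN i by simp
    }
  qed
  define R where "R = {r \<in> int_lattice. \<forall>i<d. 0 \<le> c i r \<and> c i r < 1}"
  have finR: "finite R"
  proof -
    have "norm r \<le> (\<Sum>i<d. norm (u i))" if "r \<in> R" for r
    proof -
      have "norm r \<le> (\<Sum>i<d. norm (c i r *\<^sub>R u i))" by (subst rep[of r]) (rule norm_sum)
      also have "\<dots> \<le> (\<Sum>i<d. norm (u i))"
        using that by (intro sum_mono) (auto simp: R_def intro!: mult_left_le_one_le)
      finally show ?thesis .
    qed
    then have "bounded R" by (auto simp: bounded_iff)
    from finite_bounded_int_lattice[OF this] show ?thesis
      by (rule rev_finite_subset) (auto simp: R_def)
  qed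
  define g where "g = (\<lambda>z :: real \<times> (real^'n). f (snd z))"
  have "Ck n g" unfolding g_def by (rule Ck_compose_linear[OF bounded_linear_snd f])
  from nested_sum_has_expansion[OF this, of d u "v 0"] obtain K0 where
    K0: "\<And>\<theta>. generic_shift d \<theta> \<Longrightarrow> has_expansion n K0 (\<lambda>h. nested_sum h \<theta> u d g (1, v 0))" by blast
  have point: "h *\<^sub>R (m - y) = v 0 + (\<Sum>i<d. (h * c i (m - (1/h) *\<^sub>R v 0 - y)) *\<^sub>R u i)" if "h \<noteq> 0" for h m y
  proof -
    have "(\<Sum>i<d. (h * c i (m - (1/h) *\<^sub>R v 0 - y)) *\<^sub>R u i) = h *\<^sub>R (m - (1/h) *\<^sub>R v 0 - y)"
      by (subst (2) rep) (simp add: scaleR_sum_right)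
    then show ?thesis using that by (simp add: scaleR_right_diff_distrib)
  qed
  have shift: "m - (1/h) *\<^sub>R v 0 \<in> int_lattice" if "m \<in> int_lattice" "h \<in> recip_ints" for m h
    using that vint[of 0] by (intro int_lattice_diff int_lattice_scaleR) (auto simp: recip_ints_def)
  have eq: "(\<Sum>m | m \<in> int_lattice \<and> h *\<^sub>R (m - y) \<in> convex hull C. \<bar>h\<bar> ^ d *\<^sub>R f (h *\<^sub>R (m - y)))
     = (\<Sum>r\<in>R. nested_sum h (\<lambda>i. c i (r - y)) u d g (1, v 0))" (is "?lhs = ?rhs")
    if y: "y \<notin> N" and h: "h \<in> recip_ints" for y h
  proof -
    have h0: "h \<noteq> 0" using h by (auto simp: recip_ints_def)
    let ?P = "\<lambda>r. nested_pts h (\<lambda>i. c i (r - y)) d"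
    let ?A = "{m. m \<in> int_lattice \<and> h *\<^sub>R (m - y) \<in> convex hull C}"
    \<comment> \<open>Lattice points near the simplex correspond to pairs of a coset representative and integer coordinates; \<open>\<phi>\<close> takes integer parts of coordinates.\<close>
    define \<psi> where "\<psi> = (\<lambda>(r, m :: nat \<Rightarrow> int). r + (\<Sum>i<d. of_int (m i) *\<^sub>R u i) + (1/h) *\<^sub>R v 0)"
    define \<phi> where "\<phi> = (\<lambda>n. let p = n - (1/h) *\<^sub>R v 0 in
        (p - (\<Sum>i<d. of_int \<lfloor>c i p\<rfloor> *\<^sub>R u i), restrict (\<lambda>i. \<lfloor>c i p\<rfloor>) {..<d}))"
    have cshift: "c i (r + (\<Sum>i<d. of_int (m i) *\<^sub>R u i) - y) = of_int (m i) + c i (r - y)" if "i < d" for i r y and m :: "nat \<Rightarrow> int"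
      by (simp add: linear_add[OF lin] linear_diff[OF lin] comb[OF that])
    have pt: "h *\<^sub>R (\<psi> (r, m) - y) = v 0 + (\<Sum>i<d. (h * (of_int (m i) + c i (r - y))) *\<^sub>R u i)" for r m
      unfolding point[OF h0] \<psi>_def by (simp add: cshift)
    have mem: "h *\<^sub>R (\<psi> (r, m) - y) \<in> convex hull C \<longleftrightarrow> m \<in> ?P r"
      if "r \<in> int_lattice" "m \<in> extensional {..<d}" for r m
    proof -
      have "r + (\<Sum>i<d. of_int (m i) *\<^sub>R u i) \<in> int_lattice"
        using that uint by (intro int_lattice_add int_lattice_sum int_lattice_scaleR) auto
      from gen[OF y this] have g: "generic_shift d (\<lambda>i. c i (r + (\<Sum>i<d. of_int (m i) *\<^sub>R u i) - y))" .
      have "h *\<^sub>R (\<psi> (r, m) - y) = v 0 + (\<Sum>i<d. (h * c i (r + (\<Sum>i<d. of_int (m i) *\<^sub>R u i) - y)) *\<^sub>R (v (Suc i) - v i))"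
        unfolding pt u_def[symmetric] by (simp add: cshift)
      from generic_point_in_simplex(1)[OF C v d h g this] show ?thesis
        using that(2) by (auto simp: mem_nested_pts_iff cshift)
    qed
    have bij: "bij_betw \<psi> (SIGMA r:R. ?P r) ?A"
    proof (rule bij_betw_byWitness[where f'=\<phi>])
      show "\<forall>a\<in>SIGMA r:R. ?P r. \<phi> (\<psi> a) = a"
      proof clarify
        fix r m assume r: "r \<in> R" and m: "m \<in> ?P r"
        have fl: "\<lfloor>c i (r + (\<Sum>i<d. of_int (m i) *\<^sub>R u i))\<rfloor> = m i" if "i < d" for i
        proof -
          have "c i (r + (\<Sum>i<d. of_int (m i) *\<^sub>R u i)) = of_int (m i) + c i r"
            by (simp add: linear_add[OF lin] comb[OF that])
          then show ?thesis using r that by (simp add: R_def floor_eq_iff)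
        qed
        have "m \<in> extensional {..<d}" using m by (simp add: mem_nested_pts_iff)
        then have "restrict (\<lambda>i. \<lfloor>c i (r + (\<Sum>i<d. of_int (m i) *\<^sub>R u i))\<rfloor>) {..<d} = m"
          by (intro extensionalityI[of _ "{..<d}"]) (auto simp: fl)
        then show "\<phi> (\<psi> (r, m)) = (r, m)"
          by (simp add: \<psi>_def \<phi>_def fl)
      qed
      show "\<forall>n\<in>?A. \<psi> (\<phi> n) = n"
        by (simp add: \<psi>_def \<phi>_def Let_def)
      show "\<psi> ` (SIGMA r:R. ?P r) \<subseteq> ?A"
      proof clarify
        fix r m assume r: "r \<in> R" and m: "m \<in> ?P r"
        have "m \<in> extensional {..<d}" using m by (simp add: mem_nested_pts_iff)
        moreover have "\<psi> (r, m) \<in> int_lattice"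
          unfolding \<psi>_def split_conv using r h uint vint[of 0]
          by (intro int_lattice_add int_lattice_sum int_lattice_scaleR) (auto simp: R_def recip_ints_def)
        ultimately show "\<psi> (r, m) \<in> int_lattice \<and> h *\<^sub>R (\<psi> (r, m) - y) \<in> convex hull C"
          using mem[of r m] r m by (auto simp: R_def)
      qed
      show "\<phi> ` ?A \<subseteq> (SIGMA r:R. ?P r)"
      proof clarify
        fix n r m assume n: "n \<in> int_lattice" "h *\<^sub>R (n - y) \<in> convex hull C" and rm: "(r, m) = \<phi> n"
        define p where "p = n - (1/h) *\<^sub>R v 0"
        have r: "r = p - (\<Sum>i<d. of_int \<lfloor>c i p\<rfloor> *\<^sub>R u i)" and m: "m = restrict (\<lambda>i. \<lfloor>c i p\<rfloor>) {..<d}"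
          using rm by (auto simp: \<phi>_def Let_def p_def)
        have "r \<in> int_lattice"
          unfolding r p_def using uint by (intro int_lattice_diff[OF shift[OF n(1) h]] int_lattice_sum int_lattice_scaleR) auto
        moreover have "c i r = c i p - of_int \<lfloor>c i p\<rfloor>" if "i < d" for i
          unfolding r by (simp add: linear_diff[OF lin] comb[OF that])
        then have "0 \<le> c i r \<and> c i r < 1" if "i < d" for i
          using that by (simp flip: frac_def add: frac_lt_1)
        ultimately have R: "r \<in> R" by (simp add: R_def)
        have "\<psi> (r, m) = n" using r m by (simp add: \<psi>_def p_def)
        then have "m \<in> ?P r" using mem[of r m] n(2) \<open>r \<in> int_lattice\<close> m by simp
        with R show "r \<in> R \<and> m \<in> ?P r" by simp
      qed
    qed
    have "?rhs = (\<Sum>r\<in>R. \<Sum>m\<in>?P r. \<bar>h\<bar> ^ d *\<^sub>R f (h *\<^sub>R (\<psi> (r, m) - y)))"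
      by (simp add: nested_sum_eq_sum_nested_pts[OF h0] g_def pt)
    also have "\<dots> = (\<Sum>(r, m)\<in>(SIGMA r:R. ?P r). \<bar>h\<bar> ^ d *\<^sub>R f (h *\<^sub>R (\<psi> (r, m) - y)))"
      by (rule sum.Sigma) (auto intro: finR finite_nested_pts[OF h0])
    also have "\<dots> = ?lhs"
      using sum.reindex_bij_betw[OF bij, of "\<lambda>m. \<bar>h\<bar> ^ d *\<^sub>R f (h *\<^sub>R (m - y))"]
      by (simp add: case_prod_beta)
    finally show ?thesis by simp
  qed
  have "has_expansion n (\<Sum>r\<in>R. K0) (\<lambda>h. \<Sum>m | m \<in> int_lattice \<and> h *\<^sub>R (m - y) \<in> convex hull C. \<bar>h\<bar> ^ d *\<^sub>R f (h *\<^sub>R (m - y)))"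
    if y: "y \<notin> N" for y
  proof -
    have "has_expansion n (\<Sum>r\<in>R. K0) (\<lambda>h. \<Sum>r\<in>R. nested_sum h (\<lambda>i. c i (r - y)) u d g (1, v 0))"
      by (intro has_expansion_sum finR K0 gen y) (auto simp: R_def)
    then show ?thesis by (simp add: has_expansion_def eq[OF y])
  qed
  moreover have "h *\<^sub>R (m - y) \<in> interior (convex hull C)"
    if "y \<notin> N" "h \<in> recip_ints" "m \<in> int_lattice" "h *\<^sub>R (m - y) \<in> convex hull C" for y h m
  proof (rule generic_point_in_simplex(2)[OF C v d that(2) gen[OF that(1) shift[OF that(3,2)]] _ that(4)])
    show "h *\<^sub>R (m - y) = v 0 + (\<Sum>i<d. (h * c i (m - (1/h) *\<^sub>R v 0 - y)) *\<^sub>R (v (Suc i) - v i))"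
      using point[of h m y] that(2) by (simp add: recip_ints_def u_def)
  qed
  ultimately show ?thesis
    using negN unfolding d_def shifted_lattice_sum_def
    by (intro exI[of _ "\<Sum>r\<in>R. K0"] exI[of _ N] conjI allI impI ballI) simp_all
qed

section \<open>Lattice sums over a complex\<close>

lemma finite_lattice_points_in_bounded:
  fixes P :: "(real^'n) set"
  assumes "bounded P" "h \<noteq> 0"
  shows "finite {m \<in> int_lattice. h *\<^sub>R (m - y) \<in> P}"
proof -
  obtain B where B: "\<And>x. x \<in> P \<Longrightarrow> norm x \<le> B" using assms(1) by (auto simp: bounded_iff)
  have "norm m \<le> B / \<bar>h\<bar> + norm y" if "h *\<^sub>R (m - y) \<in> P" for m
  proof -
    have "\<bar>h\<bar> * norm (m - y) \<le> B" using B[OF that] by simp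
    then have "norm (m - y) \<le> B / \<bar>h\<bar>" using assms(2) by (simp add: field_simps)
    then show ?thesis using norm_triangle_sub[of m y] by linarith
  qed
  then have "bounded {m. h *\<^sub>R (m - y) \<in> P}" by (auto simp: bounded_iff)
  from finite_bounded_int_lattice[OF this] show ?thesis by (rule rev_finite_subset) auto
qed

text \<open>By homogeneity the \<open>d\<close>-simplices cover the complex. Two of them meet in a common face, which can contain an
  interior point of one of them only if it is all of it.\<close>

lemma homogeneous_complex_cells:
  fixes K :: "(real^'n) set set"
  assumes hom: "homogeneous_simplicial_complex (int CARD('n)) K" and vert: "integer_vertices K"
  obtains \<T> where "finite \<T>" "\<Union>\<T> = \<Union>K"
    "\<And>T. T \<in> \<T> \<Longrightarrow> \<exists>C. \<not> affine_dependent C \<and> card C = Suc CARD('n) \<and> C \<subseteq> int_lattice \<and> T = convex hull C"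
    "\<And>T T'. T \<in> \<T> \<Longrightarrow> T' \<in> \<T> \<Longrightarrow> T \<noteq> T' \<Longrightarrow> interior T \<inter> T' = {}"
proof -
  let ?d = "int CARD('n)"
  have fin: "finite K" and simp: "\<And>S. S \<in> K \<Longrightarrow> \<exists>n. n simplex S"
    and face: "\<And>F S. S \<in> K \<Longrightarrow> F face_of S \<Longrightarrow> F \<in> K"
    and int: "\<And>S S'. S \<in> K \<Longrightarrow> S' \<in> K \<Longrightarrow> S \<inter> S' face_of S"
    and top: "\<And>S k. S \<in> K \<Longrightarrow> k simplex S \<Longrightarrow> k < ?d \<Longrightarrow> \<exists>T\<in>K. ?d simplex T \<and> S face_of T"
    using hom unfolding homogeneous_simplicial_complex_def simplicial_complex_def by blast+
  define \<T> where "\<T> = {T \<in> K. ?d simplex T}"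
  have un: "\<Union>\<T> = \<Union>K"
  proof
    show "\<Union>K \<subseteq> \<Union>\<T>"
    proof
      fix x assume "x \<in> \<Union>K"
      then obtain S where S: "S \<in> K" "x \<in> S" by blast
      obtain k where k: "k simplex S" using simp[OF S(1)] by blast
      have "k \<le> ?d" using aff_dim_simplex[OF k] aff_dim_le_DIM[of S] by simp
      show "x \<in> \<Union>\<T>"
      proof (cases "k < ?d")
        case True
        then obtain T where "T \<in> K" "?d simplex T" "S face_of T" using top[OF S(1) k] by blast
        then show ?thesis using S(2) face_of_imp_subset unfolding \<T>_def by blast
      next
        case False
        then show ?thesis using S k \<open>k \<le> ?d\<close> unfolding \<T>_def by auto
      qed
    qed
  qed (auto simp: \<T>_def)
  have cell: "\<exists>C. \<not> affine_dependent C \<and> card C = Suc CARD('n) \<and> C \<subseteq> int_lattice \<and> T = convex hull C"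
    if T: "T \<in> \<T>" for T
  proof -
    have TK: "T \<in> K" and "?d simplex T" using T by (auto simp: \<T>_def)
    then obtain C where C: "\<not> affine_dependent C" "int (card C) = ?d + 1" "T = convex hull C"
      unfolding simplex_def by blast
    have "a \<in> int_lattice" if "a \<in> C" for a
    proof -
      have "{a} face_of T"
        unfolding C(3) face_of_convex_hull_affine_independent[OF C(1)] using that
        by (intro exI[of _ "{a}"]) auto
      then show ?thesis using face[OF TK] vert by (auto simp: integer_vertices_def)
    qed
    moreover have "card C = Suc CARD('n)" using C(2) by linarith
    ultimately show ?thesis using C by blast
  qed
  have ne: "interior T \<noteq> {}" if T: "T \<in> \<T>" for T
  proof -
    obtain C where "\<not> affine_dependent C" "card C = Suc CARD('n)" "T = convex hull C"
      using cell[OF T] by blast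
    then show ?thesis using interior_convex_hull_eq_empty[of C] by simp
  qed
  have disj: "interior T \<inter> T' = {}" if T: "T \<in> \<T>" "T' \<in> \<T>" "T \<noteq> T'" for T T'
  proof (rule ccontr)
    assume nd: "interior T \<inter> T' \<noteq> {}"
    have TK: "T \<in> K" "T' \<in> K" using T by (auto simp: \<T>_def)
    have f: "T \<inter> T' face_of T" "T \<inter> T' face_of T'"
      using int[OF TK] int[OF TK(2,1)] by (simp_all add: Int_commute)
    have "T \<inter> T' = T"
      using face_of_disjoint_interior[OF f(1)] nd interior_subset[of T] by blast
    then have sub: "T \<subseteq> T'" by blast
    have "T face_of T'" using f(2) \<open>T \<inter> T' = T\<close> by simp
    from face_of_disjoint_interior[OF this T(3)] have "T \<inter> interior T' = {}" .
    then show False using interior_mono[OF sub] ne[OF T(1)] interior_subset[of T] by blast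
  qed
  show thesis
    by (rule that[of \<T>]) (use fin un cell disj in \<open>auto simp: \<T>_def\<close>)
qed

text \<open>For generic \<open>y\<close> no point of the shifted lattice is counted twice, as it lies in the interior of every cell
  that contains it.\<close>

lemma complex_sum_has_expansion:
  fixes \<T> :: "(real^'n) set set" and f :: "real^'n \<Rightarrow> 'b::euclidean_space"
  assumes fin: "finite \<T>"
    and cell: "\<And>T. T \<in> \<T> \<Longrightarrow> \<exists>C. \<not> affine_dependent C \<and> card C = Suc CARD('n) \<and> C \<subseteq> int_lattice \<and> T = convex hull C"
    and disj: "\<And>T T'. T \<in> \<T> \<Longrightarrow> T' \<in> \<T> \<Longrightarrow> T \<noteq> T' \<Longrightarrow> interior T \<inter> T' = {}"
    and f: "Ck n f"
  shows "\<exists>K N. negligible N \<and> (\<forall>y. y \<notin> N \<longrightarrow>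
    has_expansion n K (\<lambda>h. shifted_lattice_sum (\<Union>\<T>) f h y))"
proof -
  let ?A = "\<lambda>S h y. {m. m \<in> int_lattice \<and> h *\<^sub>R (m - y) \<in> S}"
  let ?F = "\<lambda>h y m. \<bar>h\<bar> ^ CARD('n) *\<^sub>R f (h *\<^sub>R (m - y))"
  define good where "good T K N \<longleftrightarrow> negligible N \<and> (\<forall>y. y \<notin> N \<longrightarrow>
    (\<forall>h\<in>recip_ints. \<forall>m\<in>int_lattice. h *\<^sub>R (m - y) \<in> T \<longrightarrow> h *\<^sub>R (m - y) \<in> interior T) \<and>
    has_expansion n K (\<lambda>h. sum (?F h y) (?A T h y)))" for T K N
  have "\<exists>K N. good T K N" if T: "T \<in> \<T>" for T
  proof -
    obtain C where C: "\<not> affine_dependent C" "card C = Suc CARD('n)" "C \<subseteq> int_lattice"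
      and TC: "T = convex hull C" using cell[OF T] by blast
    show ?thesis unfolding good_def TC by (rule simplex_sum_has_expansion[OF C f, unfolded shifted_lattice_sum_def])
  qed
  then obtain K N where good: "\<And>T. T \<in> \<T> \<Longrightarrow> good T (K T) (N T)" by metis
  have KN: "\<And>T. T \<in> \<T> \<Longrightarrow> negligible (N T)"
    "\<And>T y h m. T \<in> \<T> \<Longrightarrow> y \<notin> N T \<Longrightarrow> h \<in> recip_ints \<Longrightarrow> m \<in> int_lattice \<Longrightarrow> h *\<^sub>R (m - y) \<in> T \<Longrightarrow> h *\<^sub>R (m - y) \<in> interior T"
    "\<And>T y. T \<in> \<T> \<Longrightarrow> y \<notin> N T \<Longrightarrow> has_expansion n (K T) (\<lambda>h. sum (?F h y) (?A T h y))"
    using good unfolding good_def by simp_all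
  have "has_expansion n (\<Sum>T\<in>\<T>. K T) (\<lambda>h. sum (?F h y) (?A (\<Union>\<T>) h y))" if y: "y \<notin> \<Union>(N ` \<T>)" for y
  proof -
    have eq: "sum (?F h y) (?A (\<Union>\<T>) h y) = (\<Sum>T\<in>\<T>. sum (?F h y) (?A T h y))" if h: "h \<in> recip_ints" for h
    proof -
      have "?A (\<Union>\<T>) h y = (\<Union>T\<in>\<T>. ?A T h y)" by auto
      moreover have "finite (?A T h y)" if T: "T \<in> \<T>" for T
      proof -
        have "bounded T" using cell[OF T] aff_independent_finite finite_imp_bounded_convex_hull by blast
        from finite_lattice_points_in_bounded[OF this, of h y] show ?thesis using h by (simp add: recip_ints_def)
      qed
      moreover have "?A T h y \<inter> ?A T' h y = {}" if "T \<in> \<T>" "T' \<in> \<T>" "T \<noteq> T'" for T T'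
        using KN(2)[OF that(1) _ h] y disj[OF that] that by blast
      ultimately show ?thesis by (simp add: sum.UNION_disjoint[OF fin])
    qed
    have "has_expansion n (\<Sum>T\<in>\<T>. K T) (\<lambda>h. \<Sum>T\<in>\<T>. sum (?F h y) (?A T h y))"
      by (intro has_expansion_sum fin KN(3)) (use y in auto)
    then show ?thesis by (simp only: has_expansion_def eq cong: ball_cong)
  qed
  moreover have "negligible (\<Union>(N ` \<T>))" using fin KN(1) by (intro negligible_Union) auto
  ultimately show ?thesis
    unfolding shifted_lattice_sum_def
    by (intro exI[of _ "\<Sum>T\<in>\<T>. K T"] exI[of _ "\<Union>(N ` \<T>)"] conjI allI impI)
qed

text \<open>Richardson extrapolation: averaging over \<open>\<plusminus>h\<close> removes the odd powers, and the combination with coefficients \<open>c j\<close>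
  removes the even powers up to \<open>w\<close> while it keeps the constant term.\<close>

lemma has_expansion_extrapolate:
  fixes \<phi> :: "real \<Rightarrow> 'b::euclidean_space" and c :: "nat \<Rightarrow> real"
  assumes ap: "has_expansion (Suc w) K \<phi>"
    and c: "\<And>k. k \<le> w div 2 \<Longrightarrow> (\<Sum>j\<le>w div 2. c j * (1 / 2 ^ j) ^ (2 * k)) = (if k = 0 then 1 else 0)"
    and lim: "(\<lambda>N. \<phi> (1 / real (Suc N))) \<longlonglongrightarrow> a" and K: "0 \<le> K" and N: "N > 0"
  shows "norm (a - (\<Sum>j\<le>w div 2. c j *\<^sub>R ((1/2) *\<^sub>R (\<phi> (1 / (2 ^ j * real N)) + \<phi> (- (1 / (2 ^ j * real N)))))))
     \<le> (\<Sum>j\<le>w div 2. \<bar>c j\<bar>) * K * (1 / real N) ^ Suc w"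
proof -
  obtain b where b: "\<And>h. h \<in> recip_ints \<Longrightarrow> norm (\<phi> h - (\<Sum>i<Suc w. h ^ i *\<^sub>R b i)) \<le> K * \<bar>h\<bar> ^ Suc w"
    using ap by (auto simp: has_expansion_def)
  have inv: "1 / real n \<in> recip_ints" "- (1 / real n) \<in> recip_ints" if "n > 0" for n
    using that by (auto simp: recip_ints_def)
  have ab: "a = b 0"
  proof -
    have l0: "(\<lambda>N. 1 / real (Suc N)) \<longlonglongrightarrow> 0" using LIMSEQ_inverse_real_of_nat by (simp add: inverse_eq_divide)
    have "(\<lambda>N. (\<Sum>i<Suc w. (1 / real (Suc N)) ^ i *\<^sub>R b i)) \<longlonglongrightarrow> (\<Sum>i<Suc w. 0 ^ i *\<^sub>R b i)"
      by (intro tendsto_intros l0)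
    also have "(\<Sum>i<Suc w. 0 ^ i *\<^sub>R b i) = b 0"
      by (simp add: sum.lessThan_Suc_shift del: sum.lessThan_Suc)
    finally have 1: "(\<lambda>N. (\<Sum>i<Suc w. (1 / real (Suc N)) ^ i *\<^sub>R b i)) \<longlonglongrightarrow> b 0" .
    have 2: "(\<lambda>N. \<phi> (1 / real (Suc N)) - (\<Sum>i<Suc w. (1 / real (Suc N)) ^ i *\<^sub>R b i)) \<longlonglongrightarrow> 0"
    proof (rule Lim_null_comparison)
      show "\<forall>\<^sub>F N in sequentially. norm (\<phi> (1 / real (Suc N)) - (\<Sum>i<Suc w. (1 / real (Suc N)) ^ i *\<^sub>R b i)) \<le> K * \<bar>1 / real (Suc N)\<bar> ^ Suc w"
        by (intro always_eventually allI b inv) simp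
      have "(\<lambda>N. K * \<bar>1 / real (Suc N)\<bar> ^ Suc w) \<longlonglongrightarrow> K * \<bar>0\<bar> ^ Suc w"
        by (intro tendsto_intros l0)
      then show "(\<lambda>N. K * \<bar>1 / real (Suc N)\<bar> ^ Suc w) \<longlonglongrightarrow> 0" by simp
    qed
    from tendsto_add[OF 1 2] have "(\<lambda>N. \<phi> (1 / real (Suc N))) \<longlonglongrightarrow> b 0" by simp
    then show ?thesis using lim LIMSEQ_unique by blast
  qed
  define e where "e i = (if even i then 1 else 0 :: real)" for i :: nat
  define q where "q h = (\<Sum>i<Suc w. (e i * h ^ i) *\<^sub>R b i)" for h
  have avg: "norm ((1/2) *\<^sub>R (\<phi> h + \<phi> (-h)) - q h) \<le> K * \<bar>h\<bar> ^ Suc w" if "h \<in> recip_ints" "-h \<in> recip_ints" for h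
  proof -
    have "q h = (1/2) *\<^sub>R ((\<Sum>i<Suc w. h ^ i *\<^sub>R b i) + (\<Sum>i<Suc w. (-h) ^ i *\<^sub>R b i))"
      unfolding q_def sum.distrib[symmetric] scaleR_sum_right
      by (rule sum.cong) (auto simp: e_def simp flip: scaleR_add_left)
    then have "(1/2) *\<^sub>R (\<phi> h + \<phi> (-h)) - q h
      = (1/2) *\<^sub>R ((\<phi> h - (\<Sum>i<Suc w. h ^ i *\<^sub>R b i)) + (\<phi> (-h) - (\<Sum>i<Suc w. (-h) ^ i *\<^sub>R b i)))"
      by (simp add: scaleR_right_diff_distrib scaleR_right_distrib del: sum.lessThan_Suc)
    also have "norm \<dots> \<le> (1/2) * (K * \<bar>h\<bar> ^ Suc w + K * \<bar>-h\<bar> ^ Suc w)"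
      unfolding norm_scaleR by (intro mult_mono norm_triangle_le add_mono b that) auto
    finally show ?thesis by simp
  qed
  define h where "h j = 1 / (2 ^ j * real N)" for j :: nat
  have hinv: "h j \<in> recip_ints" "- h j \<in> recip_ints" for j
    using inv[of "2 ^ j * N"] N by (simp_all add: h_def)
  have hle: "\<bar>h j\<bar> ^ Suc w \<le> (1 / real N) ^ Suc w" for j
  proof (rule power_mono)
    have "real N \<le> 2 ^ j * real N" using N by simp
    then show "\<bar>h j\<bar> \<le> 1 / real N" using N by (simp add: h_def frac_le)
  qed simp
  have main: "(\<Sum>j\<le>w div 2. c j *\<^sub>R q (h j)) = b 0"
  proof -
    have "(\<Sum>j\<le>w div 2. c j *\<^sub>R q (h j)) = (\<Sum>j\<le>w div 2. \<Sum>i<Suc w. (c j * (e i * h j ^ i)) *\<^sub>R b i)"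
      unfolding q_def scaleR_sum_right by simp
    also have "\<dots> = (\<Sum>i<Suc w. \<Sum>j\<le>w div 2. (c j * (e i * h j ^ i)) *\<^sub>R b i)" by (rule sum.swap)
    also have "\<dots> = (\<Sum>i<Suc w. if i = 0 then b i else 0)"
    proof (rule sum.cong)
      fix i assume "i \<in> {..<Suc w}"
      then have i: "i \<le> w" by simp
      have "(\<Sum>j\<le>w div 2. (c j * (e i * h j ^ i)) *\<^sub>R b i)
         = (e i * (1 / real N) ^ i * (\<Sum>j\<le>w div 2. c j * (1 / 2 ^ j) ^ i)) *\<^sub>R b i"
        unfolding sum_distrib_left scaleR_sum_left
        by (rule sum.cong) (auto simp: h_def power_divide power_mult_distrib field_simps)
      also have "\<dots> = (if i = 0 then b i else 0)"
      proof (cases "even i")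
        case True
        then obtain k where k: "i = 2 * k" by blast
        then have "k \<le> w div 2" using i by simp
        from c[OF this] show ?thesis by (auto simp: k e_def)
      next
        case False
        then show ?thesis by (auto simp: e_def)
      qed
      finally show "(\<Sum>j\<le>w div 2. (c j * (e i * h j ^ i)) *\<^sub>R b i) = (if i = 0 then b i else 0)" .
    qed simp
    also have "\<dots> = b 0" by (simp add: sum.lessThan_Suc_shift del: sum.lessThan_Suc)
    finally show ?thesis .
  qed
  have "a - (\<Sum>j\<le>w div 2. c j *\<^sub>R ((1/2) *\<^sub>R (\<phi> (h j) + \<phi> (- h j))))
     = (\<Sum>j\<le>w div 2. c j *\<^sub>R q (h j)) - (\<Sum>j\<le>w div 2. c j *\<^sub>R ((1/2) *\<^sub>R (\<phi> (h j) + \<phi> (- h j))))"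
    using main ab by simp
  also have "\<dots> = (\<Sum>j\<le>w div 2. c j *\<^sub>R (q (h j) - (1/2) *\<^sub>R (\<phi> (h j) + \<phi> (- h j))))"
    by (simp only: scaleR_right_diff_distrib sum_subtractf)
  also have "norm \<dots> \<le> (\<Sum>j\<le>w div 2. \<bar>c j\<bar> * (K * (1 / real N) ^ Suc w))"
  proof (rule sum_norm_le)
    fix j
    have "norm (q (h j) - (1/2) *\<^sub>R (\<phi> (h j) + \<phi> (- h j))) \<le> K * \<bar>h j\<bar> ^ Suc w"
      using avg[OF hinv, of j] by (simp add: norm_minus_commute)
    also have "\<dots> \<le> K * (1 / real N) ^ Suc w" by (intro mult_left_mono hle K)
    finally have "\<bar>c j\<bar> * norm (q (h j) - (1/2) *\<^sub>R (\<phi> (h j) + \<phi> (- h j))) \<le> \<bar>c j\<bar> * (K * (1 / real N) ^ Suc w)"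
      by (rule mult_left_mono) simp
    then show "norm (c j *\<^sub>R (q (h j) - (1/2) *\<^sub>R (\<phi> (h j) + \<phi> (- h j)))) \<le> \<bar>c j\<bar> * (K * (1 / real N) ^ Suc w)"
      by (simp only: norm_scaleR)
  qed
  finally show ?thesis by (simp only: h_def sum_distrib_right mult.assoc)
qed

section \<open>Riemann sums\<close>

lemma cell_measure:
  fixes m :: "real^'n" and M :: real
  assumes M: "M > 0"
  defines "cell \<equiv> {x :: real^'n. \<forall>i. m $ i / M \<le> x $ i \<and> x $ i < (m $ i + 1) / M}"
  shows "cell \<in> fmeasurable lborel" "measure lborel cell = (1 / M) ^ CARD('n)"
proof -
  let ?a = "\<chi> i. m $ i / M" and ?b = "\<chi> i. (m $ i + 1) / M"
  have sub: "box ?a ?b \<subseteq> cell" "cell \<subseteq> cbox ?a ?b"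
    unfolding cell_def by (auto simp: mem_box_cart less_imp_le)
  have "cell = (\<Inter>i. {x. m $ i / M \<le> x $ i} \<inter> {x. x $ i < (m $ i + 1) / M})"
    unfolding cell_def by auto
  moreover have "{x :: real^'n. m $ i / M \<le> x $ i} \<in> sets borel" "{x :: real^'n. x $ i < (m $ i + 1) / M} \<in> sets borel" for i
    by (auto intro!: borel_closed borel_open closed_Collect_le open_Collect_less continuous_intros)
  ultimately have meas: "cell \<in> sets lborel" by auto
  show fm: "cell \<in> fmeasurable lborel"
    by (rule fmeasurableI2[OF fmeasurable_cbox sub(2) meas])
  have ab: "?a $ i \<le> ?b $ i" for i using M by (simp add: divide_right_mono)
  have "measure lborel (cbox ?a ?b) = (\<Prod>i\<in>UNIV. ?b $ i - ?a $ i)"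
    using ab by (intro content_cbox_cart) (auto simp: interval_ne_empty_cart)
  also have "\<dots> = (1 / M) ^ CARD('n)" by (simp add: add_divide_distrib)
  finally have cb: "measure lborel (cbox ?a ?b) = (1 / M) ^ CARD('n)" .
  have "measure lborel (box ?a ?b) = measure lborel (cbox ?a ?b)"
    unfolding measure_lborel_box_eq measure_lborel_cbox_eq ..
  moreover have "measure lborel (box ?a ?b) \<le> measure lborel cell"
    by (rule measure_mono_fmeasurable[OF sub(1) _ fm]) simp
  moreover have "measure lborel cell \<le> measure lborel (cbox ?a ?b)"
    by (rule measure_mono_fmeasurable[OF sub(2) meas fmeasurable_cbox])
  ultimately show "measure lborel cell = (1 / M) ^ CARD('n)" using cb by linarith
qed

lemma AE_lborel_not_in_negligible: "negligible N \<Longrightarrow> AE x in lborel. x \<notin> N"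
  using AE_not_in[of N lebesgue] by (simp add: negligible_iff_null_sets AE_completion_iff)

lemma continuous_bounded_on_compact:
  fixes f :: "'a::t2_space \<Rightarrow> 'b::real_normed_vector"
  assumes "compact P" "continuous_on P f"
  obtains B where "0 \<le> B" "\<And>x. norm (indicat_real P x *\<^sub>R f x) \<le> B"
proof -
  have "bounded (f ` P)" by (intro compact_imp_bounded compact_continuous_image assms)
  then obtain B where "\<And>x. x \<in> P \<Longrightarrow> norm (f x) \<le> B" unfolding bounded_iff by fastforce
  then show thesis by (intro that[of "max B 0"]) (auto simp: indicator_def max.coboundedI1)
qed

lemma borel_measurable_indicator_continuous:
  fixes f :: "'a::euclidean_space \<Rightarrow> 'b::euclidean_space"
  assumes "closed P" "continuous_on UNIV f"
  shows "(\<lambda>x. indicat_real P x *\<^sub>R f x) \<in> borel_measurable borel"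
  using assms by (intro borel_measurable_scaleR borel_measurable_indicator borel_closed borel_measurable_continuous_onI)

text \<open>The sum is the integral of the step function \<open>F \<circ> q N\<close>, where \<open>q N x\<close> is a point of the shifted and scaled lattice
  near \<open>x\<close>. Since \<open>F\<close> is continuous off the frontier of \<open>P\<close>, dominated convergence applies.\<close>

theorem shifted_lattice_sum_tendsto_integral:
  fixes P :: "(real^'n) set" and f :: "real^'n \<Rightarrow> 'b::euclidean_space"
  assumes P: "compact P" and neg: "negligible (frontier P)" and f: "continuous_on UNIV f"
  shows "(\<lambda>N. shifted_lattice_sum P f (1 / real (Suc N)) y) \<longlonglongrightarrow> (LINT x:P|lborel. f x)"
proof -
  define F where "F = (\<lambda>x. indicat_real P x *\<^sub>R f x)"
  obtain B where B: "0 \<le> B" "\<And>x. norm (F x) \<le> B"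
    using continuous_bounded_on_compact[OF P continuous_on_subset[OF f subset_UNIV]] unfolding F_def by blast
  have Fm: "F \<in> borel_measurable borel"
    unfolding F_def by (rule borel_measurable_indicator_continuous[OF compact_imp_closed[OF P] f])
  define M where "M N = real (Suc N)" for N
  have M: "M N > 0" "M N \<ge> 1" for N by (auto simp: M_def)
  define fl where "fl N x = (\<chi> i. real_of_int \<lfloor>M N * x $ i\<rfloor>)" for N and x :: "real^'n"
  define q where "q N x = (1 / M N) *\<^sub>R (fl N x - y)" for N x
  define A where "A N = {m. m \<in> int_lattice \<and> (1 / M N) *\<^sub>R (m - y) \<in> P}" for N
  define cell where "cell N m = {x :: real^'n. \<forall>i. m $ i / M N \<le> x $ i \<and> x $ i < (m $ i + 1) / M N}" for N m
  have finA: "finite (A N)" for N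
    using finite_lattice_points_in_bounded[OF compact_imp_bounded[OF P], of "1 / M N" y] M[of N]
    by (simp add: A_def)
  have fl_int: "fl N x \<in> int_lattice" for N x by (simp add: fl_def int_lattice_def)
  have cell_iff: "x \<in> cell N m \<longleftrightarrow> fl N x = m" if m: "m \<in> int_lattice" for N m x
  proof -
    obtain k where k: "m = (\<chi> i. real_of_int (k i))" using m unfolding int_lattice_eq_range by blast
    have "\<lfloor>M N * x $ i\<rfloor> = k i \<longleftrightarrow> m $ i / M N \<le> x $ i \<and> x $ i < (m $ i + 1) / M N" for i
      using M(1)[of N] by (simp add: k floor_eq_iff field_simps)
    moreover have "fl N x = m \<longleftrightarrow> (\<forall>i. \<lfloor>M N * x $ i\<rfloor> = k i)"
      unfolding fl_def k vec_eq_iff by simp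
    ultimately show ?thesis by (simp add: cell_def)
  qed
  have Fq: "F (q N x) = (\<Sum>m\<in>A N. indicat_real (cell N m) x *\<^sub>R F ((1 / M N) *\<^sub>R (m - y)))" for N x
  proof -
    have "(\<Sum>m\<in>A N. indicat_real (cell N m) x *\<^sub>R F ((1 / M N) *\<^sub>R (m - y)))
      = (\<Sum>m\<in>A N. if m = fl N x then F ((1 / M N) *\<^sub>R (m - y)) else 0)"
      by (rule sum.cong) (auto simp: A_def indicator_def cell_iff)
    also have "\<dots> = (if fl N x \<in> A N then F (q N x) else 0)" by (simp add: finA q_def)
    also have "\<dots> = F (q N x)" using fl_int by (auto simp: A_def q_def F_def)
    finally show ?thesis by simp
  qed
  have cellm: "cell N m \<in> fmeasurable lborel" "measure lborel (cell N m) = (1 / M N) ^ CARD('n)" for N m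
    using cell_measure[OF M(1)[of N], of m] by (simp_all add: cell_def)
  have int: "integral\<^sup>L lborel (\<lambda>x. F (q N x)) = shifted_lattice_sum P f (1 / real (Suc N)) y" for N
  proof -
    have "integral\<^sup>L lborel (\<lambda>x. F (q N x)) = (\<Sum>m\<in>A N. integral\<^sup>L lborel (\<lambda>x. indicat_real (cell N m) x *\<^sub>R F ((1 / M N) *\<^sub>R (m - y))))"
      unfolding Fq using cellm by (intro Bochner_Integration.integral_sum) (auto simp: fmeasurable_def)
    also have "\<dots> = (\<Sum>m\<in>A N. (1 / M N) ^ CARD('n) *\<^sub>R F ((1 / M N) *\<^sub>R (m - y)))"
      using cellm by (intro sum.cong refl) (auto simp: fmeasurable_def)
    also have "\<dots> = shifted_lattice_sum P f (1 / real (Suc N)) y"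
      unfolding shifted_lattice_sum_def A_def M_def by (rule sum.cong) (auto simp: F_def)
    finally show ?thesis .
  qed
  have qx: "norm (x - q N x) \<le> (real CARD('n) + norm y) / M N" for N x
  proof -
    have "x - q N x = (1 / M N) *\<^sub>R ((M N *\<^sub>R x - fl N x) + y)"
      using M(1)[of N] by (simp add: q_def scaleR_right_diff_distrib scaleR_right_distrib)
    then have "norm (x - q N x) = norm ((M N *\<^sub>R x - fl N x) + y) / M N"
      using M(1)[of N] by simp
    also have "norm ((M N *\<^sub>R x - fl N x) + y) \<le> real CARD('n) + norm y"
    proof (rule norm_triangle_le, rule add_right_mono)
      have "norm (M N *\<^sub>R x - fl N x) \<le> (\<Sum>i\<in>UNIV. \<bar>(M N *\<^sub>R x - fl N x) $ i\<bar>)" by (rule norm_le_l1_cart)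
      also have "\<dots> \<le> (\<Sum>i\<in>(UNIV :: 'n set). 1)"
        by (rule sum_mono) (simp add: fl_def, linarith)
      finally show "norm (M N *\<^sub>R x - fl N x) \<le> real CARD('n)" by simp
    qed
    finally show ?thesis using M(1)[of N] by (simp add: divide_right_mono)
  qed
  have qlim: "(\<lambda>N. q N x) \<longlonglongrightarrow> x" for x
  proof -
    have "(\<lambda>N. (real CARD('n) + norm y) * (1 / M N)) \<longlonglongrightarrow> (real CARD('n) + norm y) * 0"
      unfolding M_def using LIMSEQ_inverse_real_of_nat by (intro tendsto_intros) (simp add: inverse_eq_divide)
    then have "(\<lambda>N. q N x - x) \<longlonglongrightarrow> 0"
      by (intro Lim_null_comparison[of "\<lambda>N. q N x - x" "\<lambda>N. (real CARD('n) + norm y) * (1 / M N)"])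
        (use qx in \<open>auto simp: norm_minus_commute\<close>)
    then show ?thesis by (simp add: LIM_zero_iff)
  qed
  obtain B0 where B0: "\<And>x. x \<in> P \<Longrightarrow> norm x \<le> B0" using compact_imp_bounded[OF P] by (auto simp: bounded_iff)
  define R where "R = B0 + real CARD('n) + norm y"
  have "(\<lambda>N. integral\<^sup>L lborel (\<lambda>x. F (q N x))) \<longlonglongrightarrow> integral\<^sup>L lborel F"
  proof (rule integral_dominated_convergence[where w="\<lambda>x. indicat_real (cball 0 R) x * B"])
    show "F \<in> borel_measurable lborel" using Fm by simp
    show "(\<lambda>x. F (q N x)) \<in> borel_measurable lborel" for N
      unfolding Fq using cellm by (intro borel_measurable_sum borel_measurable_scaleR borel_measurable_indicator) (auto simp: fmeasurable_def)
    show "integrable lborel (\<lambda>x :: real^'n. indicat_real (cball 0 R) x * B)"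
      using emeasure_lborel_cball_finite[of "0 :: real^'n" R]
      by (intro integrable_mult_left) (simp add: integrable_indicator_iff)
    show "AE x in lborel. (\<lambda>N. F (q N x)) \<longlonglongrightarrow> F x"
      using AE_lborel_not_in_negligible[OF neg]
    proof eventually_elim
      case (elim x)
      have "isCont F x"
      proof (cases "x \<in> P")
        case True
        then have x: "x \<in> interior P" using elim closure_subset[of P] by (auto simp: frontier_def)
        have "continuous_on (interior P) F"
          using continuous_on_subset[OF f, of "interior P"]
          by (rule continuous_on_eq) (use interior_subset[of P] in \<open>auto simp: F_def\<close>)
        then show ?thesis using x by (simp add: continuous_on_eq_continuous_at)
      next
        case False
        have "continuous_on (-P) F"
          using continuous_on_const[of "-P" 0] by (rule continuous_on_eq) (auto simp: F_def)
        then show ?thesis using False compact_imp_closed[OF P] by (simp add: continuous_on_eq_continuous_at open_Compl)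
      qed
      then show ?case by (rule isCont_tendsto_compose[OF _ qlim])
    qed
    show "AE x in lborel. norm (F (q N x)) \<le> indicat_real (cball 0 R) x * B" for N
    proof (rule AE_I2)
      fix x
      show "norm (F (q N x)) \<le> indicat_real (cball 0 R) x * B"
      proof (cases "q N x \<in> P")
        case True
        have "norm x \<le> norm (q N x) + norm (x - q N x)" by (metis add.commute diff_add_cancel norm_triangle_ineq)
        also have "\<dots> \<le> B0 + (real CARD('n) + norm y) / M N" by (intro add_mono B0 True qx)
        also have "(real CARD('n) + norm y) / M N \<le> (real CARD('n) + norm y) / 1"
          by (rule divide_left_mono) (use M[of N] in auto)
        also have "B0 + (real CARD('n) + norm y) / 1 = R" by (simp add: R_def)
        finally show ?thesis using B by simp
      next
        case False
        then show ?thesis using B by (simp add: F_def)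
      qed
    qed
  qed
  then show ?thesis unfolding int by (simp add: set_lebesgue_integral_def F_def)
qed

section \<open>Solid angles as averages over directions\<close>

text \<open>A ray meets a convex set in an interval.\<close>

lemma convex_ray_eventually:
  fixes T :: "'a::real_normed_vector set"
  assumes "convex T"
  shows "(\<forall>\<^sub>F \<epsilon> in at_right 0. x - \<epsilon> *\<^sub>R y \<in> T) \<or> (\<forall>\<^sub>F \<epsilon> in at_right 0. x - \<epsilon> *\<^sub>R y \<notin> T)"
proof (rule disjCI)
  assume ne: "\<not> (\<forall>\<^sub>F \<epsilon> in at_right 0. x - \<epsilon> *\<^sub>R y \<notin> T)"
  have freq: "\<exists>\<epsilon>. 0 < \<epsilon> \<and> \<epsilon> < b \<and> x - \<epsilon> *\<^sub>R y \<in> T" if "b > 0" for b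
    using ne that by (auto simp: eventually_at_right_field)
  obtain b where b: "0 < b" "x - b *\<^sub>R y \<in> T" using freq[of 1] by auto
  have "x - \<epsilon> *\<^sub>R y \<in> T" if e: "0 < \<epsilon>" "\<epsilon> < b" for \<epsilon>
  proof -
    obtain a where a: "0 < a" "a < \<epsilon>" "x - a *\<^sub>R y \<in> T" using freq[OF e(1)] by auto
    define t where "t = (\<epsilon> - a) / (b - a)"
    have t: "0 \<le> t" "t \<le> 1" using a e by (auto simp: t_def)
    have "(1 - t) * a + t * b = a + t * (b - a)" by (simp add: algebra_simps)
    also have "t * (b - a) = \<epsilon> - a" using a e by (simp add: t_def)
    finally have ta: "(1 - t) * a + t * b = \<epsilon>" by simp
    have "(1 - t) *\<^sub>R (x - a *\<^sub>R y) + t *\<^sub>R (x - b *\<^sub>R y) \<in> T"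
      using convexD[OF assms a(3) b(2), of "1 - t" t] t by simp
    also have "(1 - t) *\<^sub>R (x - a *\<^sub>R y) + t *\<^sub>R (x - b *\<^sub>R y) = x - ((1 - t) * a + t * b) *\<^sub>R y"
      by (simp add: algebra_simps)
    finally show ?thesis using ta by simp
  qed
  then show "\<forall>\<^sub>F \<epsilon> in at_right 0. x - \<epsilon> *\<^sub>R y \<in> T"
    using b(1) by (auto simp: eventually_at_right_field)
qed

lemma ray_indicator_tendsto:
  fixes \<T> :: "'a::real_normed_vector set set"
  assumes fin: "finite \<T>" and conv: "\<And>T. T \<in> \<T> \<Longrightarrow> convex T"
  shows "\<exists>c. ((\<lambda>\<epsilon>. indicat_real (\<Union>\<T>) (x - \<epsilon> *\<^sub>R y)) \<longlongrightarrow> c) (at_right 0)"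
proof (cases "\<exists>T\<in>\<T>. \<forall>\<^sub>F \<epsilon> in at_right 0. x - \<epsilon> *\<^sub>R y \<in> T")
  case True
  then obtain T where "T \<in> \<T>" "\<forall>\<^sub>F \<epsilon> in at_right 0. x - \<epsilon> *\<^sub>R y \<in> T" by blast
  then have "\<forall>\<^sub>F \<epsilon> in at_right 0. indicat_real (\<Union>\<T>) (x - \<epsilon> *\<^sub>R y) = 1"
    by (auto simp: indicator_def elim!: eventually_mono)
  then show ?thesis by (intro exI[of _ 1] tendsto_eventually)
next
  case False
  then have "\<forall>T\<in>\<T>. \<forall>\<^sub>F \<epsilon> in at_right 0. x - \<epsilon> *\<^sub>R y \<notin> T"
    by (metis convex_ray_eventually conv)
  then have "\<forall>\<^sub>F \<epsilon> in at_right 0. \<forall>T\<in>\<T>. x - \<epsilon> *\<^sub>R y \<notin> T"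
    by (rule eventually_ball_finite[OF fin])
  then have "\<forall>\<^sub>F \<epsilon> in at_right 0. indicat_real (\<Union>\<T>) (x - \<epsilon> *\<^sub>R y) = 0"
    by (auto simp: indicator_def elim!: eventually_mono)
  then show ?thesis by (intro exI[of _ 0] tendsto_eventually)
qed

lemma ball_average_tendsto:
  fixes P :: "'a::euclidean_space set" and g :: "'a \<Rightarrow> 'b::euclidean_space"
  assumes P: "compact P" and g: "continuous_on UNIV g"
    and \<beta>: "\<And>y. ((\<lambda>\<epsilon>. indicat_real P (x - \<epsilon> *\<^sub>R y)) \<longlongrightarrow> \<beta> y) (at_right 0)"
  shows "integrable lborel (\<lambda>y. indicat_real (cball 0 1) y *\<^sub>R (\<beta> y *\<^sub>R g x))"
    and "((\<lambda>\<epsilon>. LINT y:cball 0 1|lborel. indicat_real P (x - \<epsilon> *\<^sub>R y) *\<^sub>R g (x - \<epsilon> *\<^sub>R y))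
      \<longlongrightarrow> (LINT y:cball 0 1|lborel. \<beta> y *\<^sub>R g x)) (at_right 0)"
proof -
  define F where "F = (\<lambda>x. indicat_real P x *\<^sub>R g x)"
  obtain B where B: "0 \<le> B" "\<And>x. norm (F x) \<le> B"
    using continuous_bounded_on_compact[OF P continuous_on_subset[OF g subset_UNIV]] unfolding F_def by blast
  have Fm: "F \<in> borel_measurable borel"
    unfolding F_def by (rule borel_measurable_indicator_continuous[OF compact_imp_closed[OF P] g])
  let ?I = "indicat_real (cball (0::'a) 1)"
  have inv0: "((\<lambda>t. inverse t) \<longlongrightarrow> 0) (at_top :: real filter)" by (rule tendsto_inverse_0_at_top[OF filterlim_ident])
  have lim: "((\<lambda>t. F (x - inverse t *\<^sub>R y)) \<longlongrightarrow> \<beta> y *\<^sub>R g x) at_top" for y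
    unfolding F_def
  proof (rule tendsto_scaleR)
    show "((\<lambda>t. indicat_real P (x - inverse t *\<^sub>R y)) \<longlongrightarrow> \<beta> y) at_top"
      using \<beta>[of y] unfolding filterlim_at_right_to_top .
    have "((\<lambda>t. x - inverse t *\<^sub>R y) \<longlongrightarrow> x - 0 *\<^sub>R y) at_top" by (intro tendsto_intros inv0)
    then have "((\<lambda>t. x - inverse t *\<^sub>R y) \<longlongrightarrow> x) at_top" by simp
    moreover have "isCont g x" using g by (simp add: continuous_on_eq_continuous_at)
    ultimately show "((\<lambda>t. g (x - inverse t *\<^sub>R y)) \<longlongrightarrow> g x) at_top" by (rule isCont_tendsto_compose[rotated])
  qed
  have ms: "(\<lambda>y. ?I y *\<^sub>R F (x - inverse t *\<^sub>R y)) \<in> borel_measurable lborel" for t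
  proof -
    have "(\<lambda>y. x - inverse t *\<^sub>R y) \<in> borel_measurable lborel"
      by (simp add: borel_measurable_continuous_onI continuous_intros)
    from measurable_compose[OF this Fm] show ?thesis
      by (intro borel_measurable_scaleR borel_measurable_indicator) auto
  qed
  have limI: "((\<lambda>t. ?I y *\<^sub>R F (x - inverse t *\<^sub>R y)) \<longlongrightarrow> ?I y *\<^sub>R (\<beta> y *\<^sub>R g x)) at_top" for y
    by (intro tendsto_intros lim)
  have mf: "(\<lambda>y. ?I y *\<^sub>R (\<beta> y *\<^sub>R g x)) \<in> borel_measurable lborel"
    by (rule borel_measurable_LIMSEQ_metric[where f="\<lambda>n y. ?I y *\<^sub>R F (x - inverse (real n) *\<^sub>R y)"])
      (rule ms, rule filterlim_compose[OF limI filterlim_real_sequentially])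
  have iw: "integrable lborel (\<lambda>y :: 'a. ?I y * B)"
    using emeasure_lborel_cball_finite[of "0 :: 'a" 1]
    by (intro integrable_mult_left) (simp add: integrable_indicator_iff)
  have bd: "norm (?I y *\<^sub>R F z) \<le> ?I y * B" for y z
    using B by (simp add: indicator_def)
  have bdl: "norm (?I y *\<^sub>R (\<beta> y *\<^sub>R g x)) \<le> ?I y * B" for y
    by (rule Lim_norm_ubound[OF trivial_limit_at_top_linorder limI always_eventually]) (rule allI, rule bd)
  show "integrable lborel (\<lambda>y. ?I y *\<^sub>R (\<beta> y *\<^sub>R g x))"
    by (rule Bochner_Integration.integrable_bound[OF iw mf]) (use bdl B in auto)
  have "((\<lambda>t. LINT y|lborel. ?I y *\<^sub>R F (x - inverse t *\<^sub>R y)) \<longlongrightarrow> (LINT y|lborel. ?I y *\<^sub>R (\<beta> y *\<^sub>R g x))) at_top"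
    by (rule integral_dominated_convergence_at_top[OF mf ms iw]) (use bd limI in auto)
  then show "((\<lambda>\<epsilon>. LINT y:cball 0 1|lborel. indicat_real P (x - \<epsilon> *\<^sub>R y) *\<^sub>R g (x - \<epsilon> *\<^sub>R y))
      \<longlongrightarrow> (LINT y:cball 0 1|lborel. \<beta> y *\<^sub>R g x)) (at_right 0)"
    unfolding filterlim_at_right_to_top set_lebesgue_integral_def F_def .
qed

text \<open>Along every ray from \<open>x\<close> the indicator of a finite union of convex sets is eventually constant, so the limit in the definition of the
  solid angle exists by dominated convergence; a continuous weight contributes its value at \<open>x\<close>.\<close>

lemma ball_average_tendsto_solid_angle:
  fixes \<T> :: "'a::euclidean_space set set" and g :: "'a \<Rightarrow> 'b::euclidean_space"
  assumes fin: "finite \<T>" and conv: "\<And>T. T \<in> \<T> \<Longrightarrow> convex T" and comp: "compact (\<Union>\<T>)"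
    and g: "continuous_on UNIV g"
  shows "((\<lambda>\<epsilon>. LINT y:cball 0 1|lborel. indicat_real (\<Union>\<T>) (x - \<epsilon> *\<^sub>R y) *\<^sub>R g (x - \<epsilon> *\<^sub>R y))
      \<longlongrightarrow> (measure lborel (cball (0::'a) 1) * solid_angle (\<Union>\<T>) x) *\<^sub>R g x) (at_right 0)"
proof -
  let ?V = "measure lborel (cball (0::'a) 1)"
  have V: "?V > 0" using content_cball_pos[of 1 "0::'a"] by simp
  obtain \<beta> where \<beta>: "\<And>y. ((\<lambda>\<epsilon>. indicat_real (\<Union>\<T>) (x - \<epsilon> *\<^sub>R y)) \<longlongrightarrow> \<beta> y) (at_right 0)"
    using ray_indicator_tendsto[OF fin conv] by metis
  note one = ball_average_tendsto[OF comp continuous_on_const[of UNIV "1::real"] \<beta>]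
  have "((\<lambda>\<epsilon>. 1 / ?V * (LINT y:cball 0 1|lborel. indicat_real (\<Union>\<T>) (x - \<epsilon> *\<^sub>R y)))
      \<longlongrightarrow> 1 / ?V * (LINT y:cball 0 1|lborel. \<beta> y)) (at_right 0)"
    using one(2) by (intro tendsto_intros) simp
  then have "solid_angle (\<Union>\<T>) x = 1 / ?V * (LINT y:cball 0 1|lborel. \<beta> y)"
    unfolding solid_angle_def by (intro tendsto_Lim) auto
  then have sa: "?V * solid_angle (\<Union>\<T>) x = (LINT y:cball 0 1|lborel. \<beta> y)" using V by simp
  have "integrable lborel (\<lambda>y. indicat_real (cball 0 1) y * \<beta> y)" using one(1) by simp
  then have "(LINT y:cball 0 1|lborel. \<beta> y *\<^sub>R g x) = (LINT y:cball 0 1|lborel. \<beta> y) *\<^sub>R g x"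
    unfolding set_lebesgue_integral_def by (simp only: scaleR_scaleR integral_scaleR_left real_scaleR_def)
  then show ?thesis using ball_average_tendsto(2)[OF comp g \<beta>] by (simp add: sa)
qed

lemma solid_angle_outside:
  fixes P :: "'a::euclidean_space set"
  assumes "closed P" "x \<notin> P"
  shows "solid_angle P x = 0"
proof -
  obtain e where e: "e > 0" "ball x e \<subseteq> - P"
    using assms openE[of "-P" x] by (auto simp: open_Compl)
  have "\<forall>\<^sub>F \<epsilon> in at_right 0. \<epsilon> < e"
    using e(1) by (auto simp: eventually_at_right_field)
  moreover have "\<forall>\<^sub>F \<epsilon> in at_right 0. 0 < (\<epsilon> :: real)" by (simp add: eventually_at_right_less)
  ultimately have "\<forall>\<^sub>F \<epsilon> in at_right 0. 1 / measure lborel (cball (0::'a) 1) *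
       (LINT y:cball 0 1|lborel. indicat_real P (x - \<epsilon> *\<^sub>R y)) = 0"
  proof eventually_elim
    case (elim \<epsilon>)
    have "indicat_real P (x - \<epsilon> *\<^sub>R y) = 0" if "y \<in> cball 0 1" for y
    proof -
      have "\<epsilon> * norm y \<le> \<epsilon> * 1" using that elim by (intro mult_left_mono) auto
      moreover have "dist x (x - \<epsilon> *\<^sub>R y) = \<epsilon> * norm y" using elim by (simp add: dist_norm)
      ultimately have "x - \<epsilon> *\<^sub>R y \<in> ball x e" using elim unfolding mem_ball by linarith
      then have "x - \<epsilon> *\<^sub>R y \<notin> P" using e(2) by blast
      then show ?thesis by simp
    qed
    then have "(LINT y:cball 0 1|lborel. indicat_real P (x - \<epsilon> *\<^sub>R y)) = (LINT y:cball (0::'a) 1|lborel. 0 :: real)"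
      by (intro set_lebesgue_integral_cong) auto
    then show ?case by simp
  qed
  then have "((\<lambda>\<epsilon>. 1 / measure lborel (cball (0::'a) 1) *
       (LINT y:cball 0 1|lborel. indicat_real P (x - \<epsilon> *\<^sub>R y))) \<longlongrightarrow> 0) (at_right 0)"
    by (rule tendsto_eventually)
  then show ?thesis unfolding solid_angle_def by (intro tendsto_Lim) auto
qed

text \<open>Both sides describe the point reflection of the lattice. This is where the sign of \<open>h\<close> is
  translated into a direction of the shift.\<close>

lemma shifted_lattice_sum_uminus:
  "shifted_lattice_sum P f (-h) y = shifted_lattice_sum P f h (-y)"
proof -
  have "bij_betw uminus {m. m \<in> int_lattice \<and> (-h) *\<^sub>R (m - y) \<in> P} {m. m \<in> int_lattice \<and> h *\<^sub>R (m - (-y)) \<in> P}"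
  proof (rule bij_betw_byWitness[where f'=uminus])
    have *: "(-h) *\<^sub>R (m - y) = h *\<^sub>R (- m - (-y))" for m by (simp add: scaleR_right_diff_distrib)
    have neg: "- m \<in> int_lattice" if "m \<in> int_lattice" for m :: "real^'n"
      using int_lattice_scaleR[of "-1" m] that by simp
    show "uminus ` {m. m \<in> int_lattice \<and> (-h) *\<^sub>R (m - y) \<in> P} \<subseteq> {m. m \<in> int_lattice \<and> h *\<^sub>R (m - (-y)) \<in> P}"
      unfolding * by (auto intro: neg simp: add.commute)
    show "uminus ` {m. m \<in> int_lattice \<and> h *\<^sub>R (m - (-y)) \<in> P} \<subseteq> {m. m \<in> int_lattice \<and> (-h) *\<^sub>R (m - y) \<in> P}"
      unfolding * by (auto intro: neg simp: add.commute)
  qed auto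
  from sum.reindex_bij_betw[OF this, of "\<lambda>m. \<bar>h\<bar> ^ CARD('n) *\<^sub>R f (h *\<^sub>R (m - (-y)))"]
  show ?thesis
    by (simp add: shifted_lattice_sum_def scaleR_right_diff_distrib scaleR_right_distrib)
qed

text \<open>A finite set of indices that contains those of all summands for shifts in the unit ball. It allows to exchange
  the sum with the average over the shift.\<close>

definition lattice_window :: "(real^'n) set \<Rightarrow> real \<Rightarrow> (real^'n) set" where
  "lattice_window P h = {m \<in> int_lattice. \<exists>y\<in>cball 0 1. h *\<^sub>R (m - y) \<in> P}"

lemma finite_lattice_window:
  assumes "bounded P" "h \<noteq> 0"
  shows "finite (lattice_window P h)"
proof -
  obtain B where B: "\<And>x. x \<in> P \<Longrightarrow> norm x \<le> B" using assms(1) by (auto simp: bounded_iff)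
  have "norm m \<le> B / \<bar>h\<bar> + 1" if "h *\<^sub>R (m - y) \<in> P" "norm y \<le> 1" for m y
  proof -
    have "\<bar>h\<bar> * norm (m - y) \<le> B" using B[OF that(1)] by simp
    then have "norm (m - y) \<le> B / \<bar>h\<bar>" using assms(2) by (simp add: field_simps)
    then show ?thesis using norm_triangle_sub[of m y] that(2) by linarith
  qed
  then have "bounded {m. \<exists>y\<in>cball 0 1. h *\<^sub>R (m - y) \<in> P}"
    unfolding bounded_iff by (intro exI[of _ "B / \<bar>h\<bar> + 1"]) auto
  from finite_bounded_int_lattice[OF this] show ?thesis
    by (rule rev_finite_subset) (auto simp: lattice_window_def)
qed

lemma shifted_lattice_sum_window:
  assumes P: "bounded P" and h: "h \<noteq> 0" and y: "y \<in> cball 0 1"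
  shows "shifted_lattice_sum P f h y = (\<Sum>m\<in>lattice_window P h.
    \<bar>h\<bar> ^ CARD('n) *\<^sub>R (indicat_real P (h *\<^sub>R (m - y)) *\<^sub>R f (h *\<^sub>R (m - (y :: real^'n)))))"
  unfolding shifted_lattice_sum_def
  by (rule sum.mono_neutral_cong_left[OF finite_lattice_window[OF P h]])
    (use y in \<open>auto simp: lattice_window_def\<close>)

lemma set_integrable_shifted_term:
  fixes P :: "(real^'n) set" and f :: "real^'n \<Rightarrow> 'b::euclidean_space"
  assumes P: "compact P" and f: "continuous_on UNIV f"
  shows "set_integrable lborel (cball 0 1) (\<lambda>y. indicat_real P (h *\<^sub>R (m - \<epsilon> *\<^sub>R y)) *\<^sub>R f (h *\<^sub>R (m - \<epsilon> *\<^sub>R y)))"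
proof -
  define F where "F = (\<lambda>x. indicat_real P x *\<^sub>R f x)"
  obtain B where B: "0 \<le> B" "\<And>x. norm (F x) \<le> B"
    using continuous_bounded_on_compact[OF P continuous_on_subset[OF f subset_UNIV]] unfolding F_def by blast
  have Fm: "F \<in> borel_measurable borel"
    unfolding F_def by (rule borel_measurable_indicator_continuous[OF compact_imp_closed[OF P] f])
  have "(\<lambda>y. h *\<^sub>R (m - \<epsilon> *\<^sub>R y)) \<in> borel_measurable lborel"
    by (simp add: borel_measurable_continuous_onI continuous_intros)
  from measurable_compose[OF this Fm]
  have "set_integrable lborel (cball 0 1) (\<lambda>y. F (h *\<^sub>R (m - \<epsilon> *\<^sub>R y)))"
    unfolding set_integrable_def using emeasure_lborel_cball_finite[of "0 :: real^'n" 1] B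
    by (intro integrableI_bounded_set_indicator[where B=B]) auto
  then show ?thesis by (simp add: F_def)
qed

lemma shifted_lattice_sum_average:
  fixes P :: "(real^'n) set" and f :: "real^'n \<Rightarrow> 'b::euclidean_space"
  assumes P: "compact P" and f: "continuous_on UNIV f" and h: "h \<noteq> 0" and e: "\<bar>\<epsilon>\<bar> \<le> 1"
  shows "set_integrable lborel (cball 0 1) (\<lambda>y. shifted_lattice_sum P f h (\<epsilon> *\<^sub>R y))"
    and "(LINT y:cball 0 1|lborel. shifted_lattice_sum P f h (\<epsilon> *\<^sub>R y)) = (\<Sum>m\<in>lattice_window P h.
      \<bar>h\<bar> ^ CARD('n) *\<^sub>R (LINT y:cball 0 1|lborel. indicat_real P (h *\<^sub>R (m - \<epsilon> *\<^sub>R y)) *\<^sub>R f (h *\<^sub>R (m - \<epsilon> *\<^sub>R y))))"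
proof -
  let ?t = "\<lambda>m y. indicat_real P (h *\<^sub>R (m - \<epsilon> *\<^sub>R y)) *\<^sub>R f (h *\<^sub>R (m - \<epsilon> *\<^sub>R y))"
  let ?I = "indicat_real (cball (0 :: real^'n) 1)"
  have eq: "?I y *\<^sub>R shifted_lattice_sum P f h (\<epsilon> *\<^sub>R y)
      = (\<Sum>m\<in>lattice_window P h. \<bar>h\<bar> ^ CARD('n) *\<^sub>R (?I y *\<^sub>R ?t m y))" for y
  proof (cases "y \<in> cball 0 1")
    case True
    have "\<bar>\<epsilon>\<bar> * norm y \<le> 1 * 1" using True e by (intro mult_mono) auto
    then have "\<epsilon> *\<^sub>R y \<in> cball 0 1" by simp
    then show ?thesis using True by (simp add: shifted_lattice_sum_window[OF compact_imp_bounded[OF P] h])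
  next
    case False
    then show ?thesis by simp
  qed
  have int: "integrable lborel (\<lambda>y. \<bar>h\<bar> ^ CARD('n) *\<^sub>R (?I y *\<^sub>R ?t m y))" for m
    using set_integrable_shifted_term[OF P f, of h m \<epsilon>] unfolding set_integrable_def
    by (rule integrable_scaleR_right)
  show "set_integrable lborel (cball 0 1) (\<lambda>y. shifted_lattice_sum P f h (\<epsilon> *\<^sub>R y))"
    unfolding set_integrable_def eq by (intro Bochner_Integration.integrable_sum int)
  show "(LINT y:cball 0 1|lborel. shifted_lattice_sum P f h (\<epsilon> *\<^sub>R y)) = (\<Sum>m\<in>lattice_window P h.
      \<bar>h\<bar> ^ CARD('n) *\<^sub>R (LINT y:cball 0 1|lborel. ?t m y))"
    unfolding set_lebesgue_integral_def eq
    by (simp only: Bochner_Integration.integral_sum[OF int] integral_scaleR_right)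
qed

lemma set_integral_ball_uminus:
  fixes g :: "'a::euclidean_space \<Rightarrow> 'b::euclidean_space"
  assumes "set_integrable lborel (cball 0 1) g"
  shows "set_integrable lborel (cball 0 1) (\<lambda>y. g (-y))"
    and "(LINT y:cball 0 1|lborel. g (-y)) = (LINT y:cball 0 1|lborel. g y)"
proof -
  have d: "distr lborel borel uminus = (lborel :: 'a measure)"
    using lborel_affine[of "-1" "0 :: 'a"] by (simp add: density_1)
  let ?g = "\<lambda>y. indicat_real (cball 0 1) y *\<^sub>R g y"
  have i: "integrable lborel ?g" using assms by (simp add: set_integrable_def)
  have m: "?g \<in> borel_measurable borel" using borel_measurable_integrable[OF i] by simp
  have eq: "?g (-y) = indicat_real (cball 0 1) y *\<^sub>R g (-y)" for y by (simp add: indicator_def)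
  have "integrable (distr lborel borel uminus) ?g" unfolding d by (rule i)
  then have "integrable lborel (\<lambda>y. ?g (-y))" by (subst (asm) integrable_distr_eq) (use m in auto)
  then show "set_integrable lborel (cball 0 1) (\<lambda>y. g (-y))" by (simp only: set_integrable_def eq)
  have "(LINT y|distr lborel borel uminus. ?g y) = (LINT y|lborel. ?g (-y))"
    by (rule integral_distr) (use m in auto)
  then show "(LINT y:cball 0 1|lborel. g (-y)) = (LINT y:cball 0 1|lborel. g y)"
    unfolding d set_lebesgue_integral_def eq by simp
qed

text \<open>A lattice point \<open>m\<close> contributes the average of \<open>f\<close> over the points of a ball of radius \<open>\<epsilon>/N\<close> around \<open>m/N\<close> that lie in the
  complex, hence \<open>solid_angle\<close> times the value of \<open>f\<close> in the limit.\<close>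

theorem shifted_lattice_sum_average_tendsto:
  fixes \<T> :: "(real^'n) set set" and f :: "real^'n \<Rightarrow> complex"
  assumes fin: "finite \<T>" and conv: "\<And>T. T \<in> \<T> \<Longrightarrow> convex T" and comp: "compact (\<Union>\<T>)"
    and f: "continuous_on UNIV f" and N: "N > 0"
  shows "((\<lambda>\<epsilon>. LINT y:cball 0 1|lborel. shifted_lattice_sum (\<Union>\<T>) f (1 / real N) (\<epsilon> *\<^sub>R y))
    \<longlongrightarrow> measure lborel (cball (0 :: real^'n) 1) *\<^sub>R solid_angle_sum N f (\<Union>\<T>)) (at_right 0)"
proof -
  let ?P = "\<Union>\<T>" and ?V = "measure lborel (cball (0 :: real^'n) 1)"
  define h where "h = 1 / real N"
  have h: "h > 0" using N by (simp add: h_def)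
  let ?W = "lattice_window ?P h"
  let ?s = "\<lambda>m. solid_angle ?P (h *\<^sub>R m) *\<^sub>R f (h *\<^sub>R m)"
  have bP: "bounded ?P" by (rule compact_imp_bounded[OF comp])
  have "filterlim (\<lambda>\<epsilon>. h * \<epsilon>) (at_right 0) (at_right 0)"
  proof -
    have "((\<lambda>\<epsilon>. h * \<epsilon>) \<longlongrightarrow> h * 0) (at_right 0)" by (intro tendsto_intros)
    moreover have "\<forall>\<^sub>F \<epsilon> in at_right 0. h * \<epsilon> \<in> {0<..}"
      using eventually_at_right_less[of 0] by eventually_elim (use h in simp)
    ultimately show ?thesis by (simp add: filterlim_at eventually_conj_iff) (auto elim: eventually_mono)
  qed
  from filterlim_compose[OF ball_average_tendsto_solid_angle[OF fin conv comp f] this]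
  have each: "((\<lambda>\<epsilon>. LINT y:cball 0 1|lborel. indicat_real ?P (h *\<^sub>R (m - \<epsilon> *\<^sub>R y)) *\<^sub>R f (h *\<^sub>R (m - \<epsilon> *\<^sub>R y)))
      \<longlongrightarrow> (?V * solid_angle ?P (h *\<^sub>R m)) *\<^sub>R f (h *\<^sub>R m)) (at_right 0)" for m
    by (simp add: scaleR_right_diff_distrib)
  have "((\<lambda>\<epsilon>. \<Sum>m\<in>?W. \<bar>h\<bar> ^ CARD('n) *\<^sub>R (LINT y:cball 0 1|lborel.
        indicat_real ?P (h *\<^sub>R (m - \<epsilon> *\<^sub>R y)) *\<^sub>R f (h *\<^sub>R (m - \<epsilon> *\<^sub>R y))))
      \<longlongrightarrow> (\<Sum>m\<in>?W. \<bar>h\<bar> ^ CARD('n) *\<^sub>R ((?V * solid_angle ?P (h *\<^sub>R m)) *\<^sub>R f (h *\<^sub>R m)))) (at_right 0)"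
    by (intro tendsto_sum tendsto_scaleR tendsto_const each)
  moreover have "\<forall>\<^sub>F \<epsilon> in at_right 0. (\<Sum>m\<in>?W. \<bar>h\<bar> ^ CARD('n) *\<^sub>R (LINT y:cball 0 1|lborel.
        indicat_real ?P (h *\<^sub>R (m - \<epsilon> *\<^sub>R y)) *\<^sub>R f (h *\<^sub>R (m - \<epsilon> *\<^sub>R y))))
      = (LINT y:cball 0 1|lborel. shifted_lattice_sum ?P f h (\<epsilon> *\<^sub>R y))"
  proof -
    have "\<forall>\<^sub>F \<epsilon> in at_right 0. 0 < \<epsilon> \<and> \<epsilon> < (1 :: real)"
      unfolding eventually_at_right_field by (intro exI[of _ 1]) auto
    then show ?thesis
      by eventually_elim (use shifted_lattice_sum_average(2)[OF comp f, of h] h in auto)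
  qed
  ultimately have lim: "((\<lambda>\<epsilon>. LINT y:cball 0 1|lborel. shifted_lattice_sum ?P f h (\<epsilon> *\<^sub>R y))
      \<longlongrightarrow> (\<Sum>m\<in>?W. \<bar>h\<bar> ^ CARD('n) *\<^sub>R ((?V * solid_angle ?P (h *\<^sub>R m)) *\<^sub>R f (h *\<^sub>R m)))) (at_right 0)"
    by (rule Lim_transform_eventually)
  have "(\<Sum>\<^sub>\<infinity>m\<in>int_lattice. ?s m) = (\<Sum>\<^sub>\<infinity>m\<in>?W. ?s m)"
  proof (rule infsum_cong_neutral)
    fix m assume m: "m \<in> int_lattice - ?W"
    have "h *\<^sub>R (m - 0) \<notin> ?P"
    proof
      assume "h *\<^sub>R (m - 0) \<in> ?P"
      then have "\<exists>y\<in>cball 0 1. h *\<^sub>R (m - y) \<in> ?P" by (rule bexI) simp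
      then show False using m by (simp add: lattice_window_def)
    qed
    then have "solid_angle ?P (h *\<^sub>R m) = 0"
      using solid_angle_outside[OF compact_imp_closed[OF comp]] by simp
    then show "?s m = 0" by simp
  qed (auto simp: lattice_window_def)
  also have "\<dots> = (\<Sum>m\<in>?W. ?s m)"
    by (rule infsum_finite) (rule finite_lattice_window[OF bP], use h in simp)
  finally have inf: "(\<Sum>\<^sub>\<infinity>m\<in>int_lattice. ?s m) = (\<Sum>m\<in>?W. ?s m)" .
  have "solid_angle_sum N f ?P = (1 / real N ^ CARD('n)) *\<^sub>R (\<Sum>m\<in>?W. ?s m)"
    unfolding solid_angle_sum_def h_def[symmetric] inf ..
  also have "1 / real N ^ CARD('n) = h ^ CARD('n)" by (simp add: h_def power_divide)
  finally have "?V *\<^sub>R solid_angle_sum N f ?P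
      = (\<Sum>m\<in>?W. \<bar>h\<bar> ^ CARD('n) *\<^sub>R ((?V * solid_angle ?P (h *\<^sub>R m)) *\<^sub>R f (h *\<^sub>R m)))"
    using h by (simp add: scaleR_sum_right mult_ac)
  with lim show ?thesis by (simp add: h_def)
qed

section \<open>The quadrature formula\<close>

lemma negligible_scaleR_vimage:
  fixes N :: "'a::euclidean_space set"
  assumes "negligible N" "e \<noteq> 0"
  shows "negligible {y. e *\<^sub>R y \<in> N}"
proof -
  have "{y. e *\<^sub>R y \<in> N} = (\<lambda>x. (1/e) *\<^sub>R x) ` N"
    using assms(2) by (force intro!: image_eqI[of _ _ "e *\<^sub>R _"])
  moreover have "negligible ((\<lambda>x. (1/e) *\<^sub>R x) ` N)"
    by (rule negligible_differentiable_image_negligible[OF order_refl assms(1)]) (auto intro!: derivative_intros simp: differentiable_on_def)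
  ultimately show ?thesis by simp
qed

text \<open>Averaging a bound for symmetrised sums over the shift: since the ball is invariant under \<open>y \<mapsto> - y\<close>, the
  sums with mesh \<open>- h\<close> have the same average as those with mesh \<open>h\<close>.\<close>

lemma symmetrised_average_bound:
  fixes P :: "(real^'n) set" and f :: "real^'n \<Rightarrow> 'b::euclidean_space" and a :: 'b
  assumes P: "compact P" and f: "continuous_on UNIV f" and e: "0 < e" "e \<le> 1"
    and h: "\<And>j. h j \<noteq> 0" and J: "finite J"
    and N: "negligible N"
    and bound: "\<And>y. y \<notin> N \<Longrightarrow> norm (a - (\<Sum>j\<in>J. c j *\<^sub>R ((1/2) *\<^sub>R
      (shifted_lattice_sum P f (h j) y + shifted_lattice_sum P f (- h j) y)))) \<le> D"
  shows "norm (measure lborel (cball (0 :: real^'n) 1) *\<^sub>R a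
      - (\<Sum>j\<in>J. c j *\<^sub>R (LINT y:cball 0 1|lborel. shifted_lattice_sum P f (h j) (e *\<^sub>R y))))
    \<le> measure lborel (cball (0 :: real^'n) 1) * D"
proof -
  let ?B = "cball (0 :: real^'n) 1" and ?S = "\<lambda>j y. shifted_lattice_sum P f (h j) (e *\<^sub>R y)"
  let ?I = "indicat_real ?B"
  have B: "integrable lborel ?I"
    using emeasure_lborel_cball_finite[of "0 :: real^'n" 1] by (simp add: integrable_indicator_iff)
  have S: "set_integrable lborel ?B (?S j)" for j
    by (rule shifted_lattice_sum_average(1)[OF P f h]) (use e in auto)
  note S' = set_integral_ball_uminus[OF S]
  have i1: "integrable lborel (\<lambda>y. ?I y *\<^sub>R ?S j y)" "integrable lborel (\<lambda>y. ?I y *\<^sub>R ?S j (-y))" for j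
    using S S'(1) by (simp_all only: set_integrable_def)
  define G where "G y = (\<Sum>j\<in>J. c j *\<^sub>R ((1/2) *\<^sub>R (?I y *\<^sub>R ?S j y + ?I y *\<^sub>R ?S j (-y))))" for y
  have iG: "integrable lborel G"
    unfolding G_def by (intro Bochner_Integration.integrable_sum integrable_scaleR_right Bochner_Integration.integrable_add i1)
  have "integral\<^sup>L lborel G = (\<Sum>j\<in>J. c j *\<^sub>R ((1/2) *\<^sub>R ((LINT y:?B|lborel. ?S j y) + (LINT y:?B|lborel. ?S j (-y)))))"
    unfolding G_def set_lebesgue_integral_def
    by (simp only: Bochner_Integration.integral_sum integral_scaleR_right Bochner_Integration.integral_add
        integrable_scaleR_right Bochner_Integration.integrable_add i1)
  also have "\<dots> = (\<Sum>j\<in>J. c j *\<^sub>R (LINT y:?B|lborel. ?S j y))"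
    unfolding S'(2) by (rule sum.cong) (auto simp flip: scaleR_2)
  finally have G: "integral\<^sup>L lborel G = (\<Sum>j\<in>J. c j *\<^sub>R (LINT y:?B|lborel. ?S j y))" .
  have ia: "integrable lborel (\<lambda>y. ?I y *\<^sub>R a)" using B by (rule integrable_scaleR_left)
  have "measure lborel ?B *\<^sub>R a - integral\<^sup>L lborel G = integral\<^sup>L lborel (\<lambda>y. ?I y *\<^sub>R a - G y)"
    using B by (simp add: Bochner_Integration.integral_diff[OF ia iG])
  then have "norm (measure lborel ?B *\<^sub>R a - integral\<^sup>L lborel G) = norm (integral\<^sup>L lborel (\<lambda>y. ?I y *\<^sub>R a - G y))"
    by (rule arg_cong)
  also have "norm (integral\<^sup>L lborel (\<lambda>y. ?I y *\<^sub>R a - G y)) \<le> (LINT y|lborel. norm (?I y *\<^sub>R a - G y))"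
    by (rule integral_norm_bound)
  also have "(LINT y|lborel. norm (?I y *\<^sub>R a - G y)) \<le> (LINT y|lborel. ?I y * D)"
  proof (rule integral_mono_AE)
    show "integrable lborel (\<lambda>y. norm (?I y *\<^sub>R a - G y))"
      by (intro integrable_norm Bochner_Integration.integrable_diff ia iG)
    show "integrable lborel (\<lambda>y. ?I y * D)" using B by (rule integrable_mult_left)
    have "AE y in lborel. y \<notin> {y. e *\<^sub>R y \<in> N}"
      by (rule AE_lborel_not_in_negligible[OF negligible_scaleR_vimage[OF N]]) (use e in simp)
    then show "AE y in lborel. norm (?I y *\<^sub>R a - G y) \<le> ?I y * D"
    proof eventually_elim
      case (elim y)
      have "?I y *\<^sub>R a - G y = ?I y *\<^sub>R (a - (\<Sum>j\<in>J. c j *\<^sub>R ((1/2) *\<^sub>R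
          (shifted_lattice_sum P f (h j) (e *\<^sub>R y) + shifted_lattice_sum P f (- h j) (e *\<^sub>R y)))))"
        by (simp add: G_def shifted_lattice_sum_uminus scaleR_right_diff_distrib scaleR_right_distrib scaleR_sum_right mult_ac)
      also have "norm \<dots> = ?I y * norm (a - (\<Sum>j\<in>J. c j *\<^sub>R ((1/2) *\<^sub>R
          (shifted_lattice_sum P f (h j) (e *\<^sub>R y) + shifted_lattice_sum P f (- h j) (e *\<^sub>R y)))))" by simp
      also have "\<dots> \<le> ?I y * D" using elim by (intro mult_left_mono bound) auto
      finally show ?case .
    qed
  qed
  also have "(LINT y|lborel. ?I y * D) = measure lborel ?B * D" by simp
  finally show ?thesis unfolding G .
qed

theorem theorem11:
  fixes K :: "(real ^ 'n) set set" and w :: nat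
    and f :: "real ^ 'n \<Rightarrow> complex" and c :: "nat \<Rightarrow> real"
  assumes "homogeneous_simplicial_complex (int CARD('n)) K"
    and "integer_vertices K"
    and "Ck (w + 1) f"
    and "\<And>k. k \<le> w div 2 \<Longrightarrow>
           (\<Sum>j\<le>w div 2. (2 powi (- 2 * int k)) ^ j * c j) = (if k = 0 then 1 else 0)"
  shows "\<exists>C. \<forall>N::nat. N > 0 \<longrightarrow>
           norm ((LINT x:\<Union>K|lborel. f x)
                 - (\<Sum>j\<le>w div 2. c j *\<^sub>R solid_angle_sum (2 ^ j * N) f (\<Union>K)))
             \<le> C * real N powi (- int w - 1)"
proof -
  obtain \<T> where fin: "finite \<T>" and un: "\<Union>\<T> = \<Union>K"
    and cell: "\<And>T. T \<in> \<T> \<Longrightarrow> \<exists>C. \<not> affine_dependent C \<and> card C = Suc CARD('n) \<and> C \<subseteq> int_lattice \<and> T = convex hull C"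
    and disj: "\<And>T T'. T \<in> \<T> \<Longrightarrow> T' \<in> \<T> \<Longrightarrow> T \<noteq> T' \<Longrightarrow> interior T \<inter> T' = {}"
    using homogeneous_complex_cells[OF assms(1,2)] by metis
  let ?P = "\<Union>\<T>" and ?B = "cball (0 :: real^'n) 1"
  have conv: "convex T" if "T \<in> \<T>" for T using cell[OF that] by auto
  have comp: "compact ?P"
    using cell aff_independent_finite finite_imp_compact_convex_hull by (intro compact_Union fin) blast
  have neg: "negligible (frontier ?P)"
  proof (rule negligible_subset[OF _ frontier_Union_subset[OF fin]])
    show "negligible (\<Union>T\<in>\<T>. frontier T)"
      using fin conv by (intro negligible_Union) (auto intro: negligible_convex_frontier)
  qed
  have f: "Ck (Suc w) f" using assms(3) by simp
  have cf: "continuous_on UNIV f" by (rule Ck_imp_continuous_on[OF f])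
  obtain K0 N0 where N0: "negligible N0" and K0: "\<And>y. y \<notin> N0 \<Longrightarrow>
      has_expansion (Suc w) K0 (\<lambda>h. shifted_lattice_sum ?P f h y)"
    using complex_sum_has_expansion[OF fin cell disj f] by blast
  have c: "(\<Sum>j\<le>w div 2. c j * (1 / 2 ^ j) ^ (2 * k)) = (if k = 0 then 1 else 0)" if "k \<le> w div 2" for k
  proof -
    have eq: "(2 powi (- 2 * int k)) ^ j * c j = c j * (1 / 2 ^ j) ^ (2 * k)" for j
    proof -
      have "2 powi (- 2 * int k) = 1 / (2 :: real) ^ (2 * k)"
      proof -
        have "- 2 * int k = - int (2 * k)" by simp
        then show ?thesis by (simp only: power_int_minus power_int_of_nat inverse_eq_divide)
      qed
      then show ?thesis by (simp add: power_divide mult.commute flip: power_mult)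
    qed
    show ?thesis using assms(4)[OF that] unfolding eq .
  qed
  define a where "a = (LINT x:?P|lborel. f x)"
  define C where "C = (\<Sum>j\<le>w div 2. \<bar>c j\<bar>) * max K0 0"
  have V: "measure lborel ?B > 0" using content_cball_pos[of 1 "0 :: real^'n"] by simp
  have main: "norm (a - (\<Sum>j\<le>w div 2. c j *\<^sub>R solid_angle_sum (2 ^ j * N) f ?P)) \<le> C * (1 / real N) ^ Suc w"
    if N: "N > 0" for N
  proof -
    define D where "D = C * (1 / real N) ^ Suc w"
    define h where "h j = 1 / (2 ^ j * real N)" for j :: nat
    have h0: "h j \<noteq> 0" for j using N by (simp add: h_def)
    have hj: "h j = 1 / real (2 ^ j * N)" for j by (simp add: h_def)
    have pointwise: "norm (a - (\<Sum>j\<le>w div 2. c j *\<^sub>R ((1/2) *\<^sub>R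
      (shifted_lattice_sum ?P f (h j) y + shifted_lattice_sum ?P f (- h j) y)))) \<le> D" if "y \<notin> N0" for y
      unfolding D_def C_def h_def a_def
      by (rule has_expansion_extrapolate[OF has_expansion_mono[OF K0[OF that]] c
            shifted_lattice_sum_tendsto_integral[OF comp neg cf] _ N]) auto
    \<comment> \<open>The averaged error at scale \<open>e\<close>; its limit for \<open>e \<rightarrow> 0\<close> is the error in question times the volume of the ball.\<close>
    let ?X = "\<lambda>e. measure lborel ?B *\<^sub>R a
        - (\<Sum>j\<le>w div 2. c j *\<^sub>R (LINT y:?B|lborel. shifted_lattice_sum ?P f (h j) (e *\<^sub>R y)))"
    let ?Y = "a - (\<Sum>j\<le>w div 2. c j *\<^sub>R solid_angle_sum (2 ^ j * N) f ?P)"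
    have "(?X \<longlongrightarrow> measure lborel ?B *\<^sub>R a
        - (\<Sum>j\<le>w div 2. c j *\<^sub>R (measure lborel ?B *\<^sub>R solid_angle_sum (2 ^ j * N) f ?P))) (at_right 0)"
      unfolding hj using N
      by (intro tendsto_diff tendsto_sum tendsto_scaleR tendsto_const
          shifted_lattice_sum_average_tendsto[OF fin conv comp cf]) auto
    also have "measure lborel ?B *\<^sub>R a
        - (\<Sum>j\<le>w div 2. c j *\<^sub>R (measure lborel ?B *\<^sub>R solid_angle_sum (2 ^ j * N) f ?P)) = measure lborel ?B *\<^sub>R ?Y"
      by (simp add: scaleR_right_diff_distrib scaleR_sum_right mult.commute)
    finally have lim: "(?X \<longlongrightarrow> measure lborel ?B *\<^sub>R ?Y) (at_right 0)" .
    have "norm (measure lborel ?B *\<^sub>R ?Y) \<le> measure lborel ?B * D"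
    proof (rule tendsto_upperbound[OF tendsto_norm[OF lim]])
      have "\<forall>\<^sub>F e in at_right 0. 0 < e \<and> e < (1 :: real)"
        unfolding eventually_at_right_field by (intro exI[of _ 1]) auto
      then show "\<forall>\<^sub>F e in at_right 0. norm (?X e) \<le> measure lborel ?B * D"
        by eventually_elim
          (rule symmetrised_average_bound[OF comp cf _ _ h0 finite_atMost N0 pointwise], auto)
    qed simp
    then have "measure lborel ?B * norm ?Y \<le> measure lborel ?B * D" by simp
    then have "norm ?Y \<le> D" using V by (rule mult_left_le_imp_le)
    then show ?thesis by (simp only: D_def)
  qed
  have pw: "real N powi (- int w - 1) = (1 / real N) ^ Suc w" for N
  proof -
    have "- int w - 1 = - int (Suc w)" by simp
    then show ?thesis by (simp only: power_int_minus power_int_of_nat inverse_eq_divide power_one_over)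
  qed
  show ?thesis
    using main by (intro exI[of _ C] allI impI) (simp only: a_def un pw)
qed

end
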